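(* Consider the quantum neural network $f(\Theta,x)$ of the context, with $m$ qubits, normalization $N(m)$ and maximal light-cone sizes $|\mathcal M|,|\mathcal N|$, with randomly initialized $\Theta$. Let $\bar X$ be the vector of all $\bar N$ inputs in $\mathcal X$, let $f(\Theta,\bar X)\in\mathbb R^{\bar N}$ be the corresponding random vector of outputs, and let $\bar{\mathcal K}_0=\big(\mathcal K_0(x,x')\big)_{x,x'\in\mathcal X}$ be its covariance matrix, assumed invertible. Then $$\mathrm d_{\mathrm W}\big(f(\Theta,\bar X),\mathcal N(0,\bar{\mathcal K}_0)\big)\le \bar N^{3/2}\Big(2\|\bar{\mathcal K}_0^{-1}\|_{\rm op}\|\bar{\mathcal K}_0\|_{\rm op}^{1/2}+6\Big)\frac{m|\mathcal M|^{7/2}|\mathcal N|^{7/2}}{N^3(m)}\big(1+\log N(m)\big),$$ where $\mathcal N(0,\bar{\mathcal K}_0)$ is the centered Gaussian law on $\mathbb R^{\bar N}$ with covariance $\bar{\mathcal K}_0$.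
   Context: **Network.** $\mathcal X\subset\mathbb R^d$ is a finite set of inputs, $\bar N=|\mathcal X|$. There are $m$ qubits (Hilbert space $(\mathbb C^2)^{\otimes m}$) and $L$ layers. The parameters are $\Theta=(\theta_1,\dots,\theta_{Lm})\in[0,\pi]^{Lm}$; a parameter index is written $[\ell k]=m(\ell-1)+k$ with $1\le\ell\le L$ (layer), $1\le k\le m$ (qubit). Layer $\ell$ is the unitary $U_\ell(\Theta,x)=V_\ell(x)\,\big(W_{[\ell 1]}(\theta_{[\ell1]})\otimes\cdots\otimes W_{[\ell m]}(\theta_{[\ell m]})\big)$, where $W_i(\theta_i)=e^{-\mathrm i\mathcal G_i\theta_i}$ acts on one qubit with $\mathcal G_i=\mathcal G_i^\dagger=\mathcal G_i^{-1}$ a Hermitian $2\times2$ matrix with spectrum in $\{-1,1\}$, and $V_\ell(x)$ is a product of one- and two-qubit gates acting on disjoint qubits, each gate possibly depending on $x$ (the placement of gates is part of the architecture). $U(\Theta,x)=U_L(\Theta,x)\cdots U_1(\Theta,x)$. For each $k$, $\mathcal O_k$ is a traceless Hermitian observable acting on qubit $k$ (identity elsewhere) with spectrum in $[-1,1]$. Put $$f_k(\Theta,x)=\langle 0^m|U^\dagger(\Theta,x)\mathcal O_kU(\Theta,x)|0^m\rangle,\qquad f(\Theta,x)=\frac1{N(m)}\sum_{k=1}^m f_k(\Theta,x).$$ **Initialization.** The $\theta_i$ are independent and uniform on $[0,\pi]$; the final layer is chosen such that $\mathbb E f_k(\Theta,x)=0$ for all $k,x$. Let $\mathcal K_0(x,x')=\mathbb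 E[f(\Theta,x)f(\Theta,x')]$. It is assumed that $\mathcal K_0(x,x)>0$ for all $x\in\mathcal X$, that the normalization $N(m)>0$ is chosen such that $\max_{x\in\mathcal X}\mathcal K_0(x,x)=1$, and that $N(m)\ge1$. **Light cones.** $\mathcal I_{\ell,k}=\{k':\text{qubits }k,k'\text{ interact (share a two-qubit gate) in layer }\ell\}\cup\{k\}$; $\mathcal J_k^L=\mathcal I_{L,k}$ and $\mathcal J_k^\ell=\bigcup_{k'\in\mathcal J_k^{\ell+1}}\mathcal I_{\ell,k'}$ for $\ell<L$; $\mathcal N_k=\bigcup_{\ell=1}^L\{[\ell k']:k'\in\mathcal J_k^\ell\}$; $\mathcal M_i=\{k:i\in\mathcal N_k\}$; $|\mathcal N|=\max_k|\mathcal N_k|$, $|\mathcal M|=\max_i|\mathcal M_i|$. **Distance.** $\mathrm d_{\mathrm W}$ is the Wasserstein distance of order 1 between laws on $\mathbb R^{\bar N}$ with the Euclidean cost; a random vector stands for its law. $\|\cdot\|_{\rm op}$ is the operator norm and $\log$ is natural. *)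

theory Defs
  imports "HOL-Probability.Probability"
begin

definition dagger :: "complex^'a^'b \<Rightarrow> complex^'b^'a"
  where "dagger A = (\<chi> i j. cnj (A $ j $ i))"

definition hermitian :: "complex^'a^'a \<Rightarrow> bool"
  where "hermitian A \<longleftrightarrow> dagger A = A"

definition unitary :: "complex^'a^'a \<Rightarrow> bool"
  where "unitary A \<longleftrightarrow> dagger A ** A = mat 1 \<and> A ** dagger A = mat 1"

definition spectrum :: "complex^'a^'a \<Rightarrow> complex set"
  where "spectrum A = {c. \<exists>v. v \<noteq> 0 \<and> A *v v = c *s v}"

primrec mat_power :: "complex^'a^'a \<Rightarrow> nat \<Rightarrow> complex^'a^'a"
  where "mat_power A 0 = mat 1"
  | "mat_power A (Suc n) = A ** mat_power A n"

text \<open>The multiplication of the type class of vectors is componentwise, so the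
  generic exponential is not the matrix exponential.\<close>

definition mat_exp :: "complex^'a^'a \<Rightarrow> complex^'a^'a"
  where "mat_exp A = (\<Sum>n. mat_power A n /\<^sub>R fact n)"

definition braket :: "complex^'a \<Rightarrow> complex^'a \<Rightarrow> complex"
  where "braket v w = (\<Sum>i\<in>UNIV. cnj (v $ i) * w $ i)"

text \<open>The qubits are the elements of a finite type \<open>'q\<close>, so that \<open>m = CARD('q)\<close>. The
  computational basis of the Hilbert space of \<open>m\<close> qubits consists of the bit strings
  \<open>'q \<Rightarrow> bool\<close>, with \<open>False\<close> standing for 0 and \<open>True\<close> for 1, and
  the Hilbert space is \<open>complex^('q \<Rightarrow> bool)\<close>.\<close>

definition ket0 :: "complex^('q::finite \<Rightarrow> bool)"
  where "ket0 = axis (\<lambda>_. False) 1"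

definition tensor :: "('q::finite \<Rightarrow> complex^bool^bool) \<Rightarrow> complex^('q \<Rightarrow> bool)^('q \<Rightarrow> bool)"
  where "tensor A = (\<chi> s t. \<Prod>k\<in>UNIV. A k $ s k $ t k)"

definition on_qubit :: "'q::finite \<Rightarrow> complex^bool^bool \<Rightarrow> complex^('q \<Rightarrow> bool)^('q \<Rightarrow> bool)"
  where "on_qubit k A = (\<chi> s t. if \<forall>j. j \<noteq> k \<longrightarrow> s j = t j then A $ s k $ t k else 0)"

definition on_qubits :: "'q::finite \<Rightarrow> 'q \<Rightarrow> complex^(bool \<times> bool)^(bool \<times> bool)
    \<Rightarrow> complex^('q \<Rightarrow> bool)^('q \<Rightarrow> bool)"
  where "on_qubits a b A =
    (\<chi> s t. if \<forall>j. j \<noteq> a \<and> j \<noteq> b \<longrightarrow> s j = t j then A $ (s a, s b) $ (t a, t b) else 0)"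

text \<open>The qubits on which a gate acts are fixed, its matrix depends on the input.\<close>

datatype ('q, 'x) gate =
    One_Qubit 'q "'x \<Rightarrow> complex^bool^bool"
  | Two_Qubit 'q 'q "'x \<Rightarrow> complex^(bool \<times> bool)^(bool \<times> bool)"

primrec gate_qubits :: "('q, 'x) gate \<Rightarrow> 'q set"
  where "gate_qubits (One_Qubit k A) = {k}"
  | "gate_qubits (Two_Qubit a b A) = {a, b}"

primrec gate_matrix :: "'x \<Rightarrow> ('q::finite, 'x) gate \<Rightarrow> complex^('q \<Rightarrow> bool)^('q \<Rightarrow> bool)"
  where "gate_matrix x (One_Qubit k A) = on_qubit k (A x)"
  | "gate_matrix x (Two_Qubit a b A) = on_qubits a b (A x)"

primrec wf_gate :: "'x set \<Rightarrow> ('q, 'x) gate \<Rightarrow> bool"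
  where "wf_gate X (One_Qubit k A) \<longleftrightarrow> (\<forall>x\<in>X. unitary (A x))"
  | "wf_gate X (Two_Qubit a b A) \<longleftrightarrow> a \<noteq> b \<and> (\<forall>x\<in>X. unitary (A x))"

text \<open>Layers are numbered from 1 to \<open>depth\<close>; \<open>gates l\<close> are the gates whose product is the
  fixed part of layer \<open>l\<close>. A parameter index is a pair \<open>(l, k)\<close> of a layer and a
  qubit, in place of the number \<open>m (l - 1) + k\<close>.\<close>

record ('q, 'x) qnn =
  depth :: nat
  gates :: "nat \<Rightarrow> ('q, 'x) gate list"
  generator :: "nat \<times> 'q \<Rightarrow> complex^bool^bool"
  observable :: "'q \<Rightarrow> complex^bool^bool"
  normalization :: real

definition param_indices :: "('q::finite, 'x) qnn \<Rightarrow> (nat \<times> 'q) set"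
  where "param_indices Q = {1..depth Q} \<times> UNIV"

definition wf_qnn :: "'x set \<Rightarrow> ('q::finite, 'x) qnn \<Rightarrow> bool"
  where "wf_qnn X Q \<longleftrightarrow>
    depth Q \<ge> 1 \<and>
    (\<forall>l\<in>{1..depth Q}. (\<forall>g\<in>set (gates Q l). wf_gate X g) \<and>
       sorted_wrt (\<lambda>g h. gate_qubits g \<inter> gate_qubits h = {}) (gates Q l)) \<and>
    (\<forall>i\<in>param_indices Q. hermitian (generator Q i) \<and> generator Q i ** generator Q i = mat 1 \<and>
       spectrum (generator Q i) \<subseteq> {-1, 1}) \<and>
    (\<forall>k. hermitian (observable Q k) \<and> trace (observable Q k) = 0 \<and>
       spectrum (observable Q k) \<subseteq> complex_of_real ` {-1..1})"

definition V_layer :: "('q::finite, 'x) qnn \<Rightarrow> nat \<Rightarrow> 'x \<Rightarrow> complex^('q \<Rightarrow> bool)^('q \<Rightarrow> bool)"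
  where "V_layer Q l x = foldr (\<lambda>g B. gate_matrix x g ** B) (gates Q l) (mat 1)"

definition W_gate :: "('q, 'x) qnn \<Rightarrow> nat \<times> 'q \<Rightarrow> real \<Rightarrow> complex^bool^bool"
  where "W_gate Q i \<theta> = mat_exp (\<chi> a b. - \<i> * generator Q i $ a $ b * complex_of_real \<theta>)"

definition U_layer :: "('q::finite, 'x) qnn \<Rightarrow> nat \<Rightarrow> (nat \<times> 'q \<Rightarrow> real) \<Rightarrow> 'x
    \<Rightarrow> complex^('q \<Rightarrow> bool)^('q \<Rightarrow> bool)"
  where "U_layer Q l \<Theta> x = V_layer Q l x ** tensor (\<lambda>k. W_gate Q (l, k) (\<Theta> (l, k)))"

primrec U_upto :: "('q::finite, 'x) qnn \<Rightarrow> nat \<Rightarrow> (nat \<times> 'q \<Rightarrow> real) \<Rightarrow> 'x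
    \<Rightarrow> complex^('q \<Rightarrow> bool)^('q \<Rightarrow> bool)"
  where "U_upto Q 0 \<Theta> x = mat 1"
  | "U_upto Q (Suc l) \<Theta> x = U_layer Q (Suc l) \<Theta> x ** U_upto Q l \<Theta> x"

definition U_circuit :: "('q::finite, 'x) qnn \<Rightarrow> (nat \<times> 'q \<Rightarrow> real) \<Rightarrow> 'x
    \<Rightarrow> complex^('q \<Rightarrow> bool)^('q \<Rightarrow> bool)"
  where "U_circuit Q \<Theta> x = U_upto Q (depth Q) \<Theta> x"

text \<open>The expectation value of a Hermitian observable is real, so taking the real part only
  changes the type.\<close>

definition local_output :: "('q::finite, 'x) qnn \<Rightarrow> 'q \<Rightarrow> (nat \<times> 'q \<Rightarrow> real) \<Rightarrow> 'x \<Rightarrow> real"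
  where "local_output Q k \<Theta> x =
    Re (braket ket0 ((dagger (U_circuit Q \<Theta> x) ** on_qubit k (observable Q k) ** U_circuit Q \<Theta> x) *v ket0))"

definition network_output :: "('q::finite, 'x) qnn \<Rightarrow> (nat \<times> 'q \<Rightarrow> real) \<Rightarrow> 'x \<Rightarrow> real"
  where "network_output Q \<Theta> x = 1 / normalization Q * (\<Sum>k\<in>UNIV. local_output Q k \<Theta> x)"

definition init_measure :: "('q::finite, 'x) qnn \<Rightarrow> (nat \<times> 'q \<Rightarrow> real) measure"
  where "init_measure Q = Pi\<^sub>M (param_indices Q) (\<lambda>_. uniform_measure lborel {0..pi})"

definition K0 :: "('q::finite, 'x) qnn \<Rightarrow> 'x \<Rightarrow> 'x \<Rightarrow> real"
  where "K0 Q x y = (\<integral>\<Theta>. network_output Q \<Theta> x * network_output Q \<Theta> y \<partial>init_measure Q)"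

definition K0_matrix :: "('q::finite, 'x) qnn \<Rightarrow> 'x^'n \<Rightarrow> real^'n^'n"
  where "K0_matrix Q xs = (\<chi> i j. K0 Q (xs $ i) (xs $ j))"

definition output_law :: "('q::finite, 'x) qnn \<Rightarrow> 'x^'n \<Rightarrow> (real^'n) measure"
  where "output_law Q xs = distr (init_measure Q) borel (\<lambda>\<Theta>. \<chi> i. network_output Q \<Theta> (xs $ i))"

text \<open>In the usual notation, the following are the sets \<open>\<I>\<^bsub>l,k\<^esub>\<close>, \<open>\<J>\<^sub>k\<close> at layer
  \<open>l\<close>, \<open>\<N>\<^sub>k\<close> and \<open>\<M>\<^sub>i\<close>, and the numbers \<open>|\<N>|\<close> and \<open>|\<M>|\<close>.\<close>

definition interaction_nbhd :: "('q::finite, 'x) qnn \<Rightarrow> nat \<Rightarrow> 'q \<Rightarrow> 'q set"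
  where "interaction_nbhd Q l k =
    {k'. k \<noteq> k' \<and> (\<exists>g\<in>set (gates Q l). gate_qubits g = {k, k'})} \<union> {k}"

function cone_qubits :: "('q::finite, 'x) qnn \<Rightarrow> nat \<Rightarrow> 'q \<Rightarrow> 'q set"
  where "cone_qubits Q l k =
    (if l < depth Q then (\<Union>k'\<in>cone_qubits Q (Suc l) k. interaction_nbhd Q l k')
     else interaction_nbhd Q (depth Q) k)"
  by auto
termination by (relation "Wellfounded.measure (\<lambda>(Q, l, k). depth Q - l)") auto

declare cone_qubits.simps [simp del]

definition past_cone :: "('q::finite, 'x) qnn \<Rightarrow> 'q \<Rightarrow> (nat \<times> 'q) set"
  where "past_cone Q k = (\<Union>l\<in>{1..depth Q}. {(l, k') |k'. k' \<in> cone_qubits Q l k})"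

definition future_cone :: "('q::finite, 'x) qnn \<Rightarrow> nat \<times> 'q \<Rightarrow> 'q set"
  where "future_cone Q i = {k. i \<in> past_cone Q k}"

definition max_past :: "('q::finite, 'x) qnn \<Rightarrow> nat"
  where "max_past Q = (MAX k\<in>UNIV. card (past_cone Q k))"

definition max_future :: "('q::finite, 'x) qnn \<Rightarrow> nat"
  where "max_future Q = (MAX i\<in>param_indices Q. card (future_cone Q i))"

definition couplings :: "'a::euclidean_space measure \<Rightarrow> 'a measure \<Rightarrow> ('a \<times> 'a) measure set"
  where "couplings \<mu> \<nu> =
    {\<gamma>. sets \<gamma> = sets (borel \<Otimes>\<^sub>M borel) \<and> distr \<gamma> borel fst = \<mu> \<and> distr \<gamma> borel snd = \<nu>}"

definition wasserstein :: "'a::euclidean_space measure \<Rightarrow> 'a measure \<Rightarrow> ennreal"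
  where "wasserstein \<mu> \<nu> = (INF \<gamma>\<in>couplings \<mu> \<nu>. \<integral>\<^sup>+z. ennreal (dist (fst z) (snd z)) \<partial>\<gamma>)"

text \<open>The centered Gaussian law with covariance \<open>C\<close>, for positive definite \<open>C\<close>.\<close>

definition gaussian :: "real^'n^'n \<Rightarrow> (real^'n) measure"
  where "gaussian C = density lborel
    (\<lambda>z. ennreal (exp (- (z \<bullet> (matrix_inv C *v z)) / 2) / sqrt ((2 * pi) ^ CARD('n) * det C)))"

definition op_norm :: "real^'n^'n \<Rightarrow> real"
  where "op_norm A = onorm ((*v) A)"

end

(* By Kantorovich-Rubinstein duality it suffices to compare E h(f) with the Gaussian mean of h for
   1-Lipschitz h. The local outputs of two qubits with disjoint past light cones are independent,
   so f is a sum of m bounded terms y_k, each of which depends on at most D = |M||N| others. Let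
   V satisfy V^T K V = 1, let S = K V, and let w be a standard Gaussian vector, so that S w has
   covariance K. Smooth h(S x) by a Gaussian of width 1/N and rotate V^T f into w along
   cos t V^T f + sin t w. By Stein's method for locally dependent sums the derivative in t is
   bounded by a multiple of cos t / sin t; integrating it from sin t = 1/N yields the factor
   log N. The smoothing errors are O(sqrt n / N) and are absorbed in the bound because
   K(x,x) = 1 for some x forces N^2 <= m D. *)

theory Submission
  imports Defs
begin

section \<open>Kantorovich-Rubinstein duality\<close>

text \<open>Whitening turns the covariance into the identity, so that Stein's method compares an
  expected Laplacian with an expected radial derivative. It enlarges the summands by up to sqrt
  \<kappa>, with \<kappa> the norm of the inverse covariance. Three of them occur in the third-order
  remainder, but one is measured after mapping back with \<open>S\<close>, as \<open>h\<close> is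
  1-Lipschitz in the original coordinates; this leaves \<kappa> with exponent 1 instead of 3/2. A
  Lipschitz \<open>h\<close> has no second derivatives. Smoothing at scale sin t supplies Lipschitz
  ones at the cost 1/sin^2 t, and the resulting bound in t is not integrable at 0, hence the cut at
  sin t = 1/N. The preliminary smoothing of width 1/N serves another purpose: it makes the test
  function differentiable, as integration by parts along the rotation requires. The leading constant
  has no slack for D = 1: the Hermite constant 4/3 times the count D (7/2 D - 2) = 3/2 is exactly
  the 2 of the claim. Therefore the remainders are counted with the exact overlaps of
  neighbourhoods.\<close>

definition functional :: "(('j \<Rightarrow> real) \<Rightarrow> real) \<Rightarrow> bool"
  where "functional f \<longleftrightarrow> (\<forall>x y c. f (\<lambda>j. x j + c * y j) = f x + c * f y)"

text \<open>Induction on the number of constraints. If the new constraint is redundant, its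
  multiplier is 0. Otherwise some point satisfies the old constraints and violates the conclusion;
  projecting along it onto the kernel of the new constraint reduces to the old ones.\<close>

lemma farkas:
  assumes "finite I" and "\<And>i. i \<in> I \<Longrightarrow> functional (\<alpha> i)" and "functional \<gamma>"
    and "\<And>x. (\<And>i. i \<in> I \<Longrightarrow> \<alpha> i x \<le> 0) \<Longrightarrow> \<gamma> x \<le> 0"
  shows "\<exists>u. (\<forall>i\<in>I. u i \<ge> 0) \<and> (\<forall>x. \<gamma> x = (\<Sum>i\<in>I. u i * \<alpha> i x))"
  using assms
proof (induction I arbitrary: \<alpha> \<gamma> rule: finite_induct)
  case empty
  have neg: "\<gamma> (\<lambda>j. - x j) = - \<gamma> x" for x
  proof -
    have 1: "\<gamma> (\<lambda>j. x j + (-1) * x j) = \<gamma> x + (-1) * \<gamma> x"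
      using empty.prems(2) unfolding functional_def by blast
    have "\<gamma> (\<lambda>j. 0 + (-1) * x j) = \<gamma> (\<lambda>j. 0) + (-1) * \<gamma> x"
      using empty.prems(2)[unfolded functional_def, rule_format, of "\<lambda>_. 0" "-1" x] by simp
    with 1 show ?thesis by simp
  qed
  have "\<gamma> x = 0" for x
    using empty.prems(3)[of x] empty.prems(3)[of "\<lambda>j. - x j"] neg[of x] by simp
  then show ?case by simp
next
  case (insert k I)
  show ?case
  proof (cases "\<forall>x. (\<forall>i\<in>I. \<alpha> i x \<le> 0) \<longrightarrow> \<gamma> x \<le> 0")
    case True
    then obtain u where u: "\<forall>i\<in>I. u i \<ge> 0" "\<forall>x. \<gamma> x = (\<Sum>i\<in>I. u i * \<alpha> i x)"
      using insert.IH[of \<alpha> \<gamma>] insert.prems by blast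
    have "(\<Sum>i\<in>insert k I. (u(k := 0)) i * \<alpha> i x) = (\<Sum>i\<in>I. u i * \<alpha> i x)" for x
      using insert.hyps by (auto intro!: sum.cong)
    then show ?thesis
      using u by (intro exI[of _ "u(k := 0)"]) auto
  next
    case False
    then obtain x1 where x1: "\<And>i. i \<in> I \<Longrightarrow> \<alpha> i x1 \<le> 0" "\<gamma> x1 > 0" by (auto simp: not_le)
    have k1: "\<alpha> k x1 > 0"
    proof (rule ccontr)
      assume "\<not> \<alpha> k x1 > 0"
      then have "\<gamma> x1 \<le> 0" by (intro insert.prems(3)) (use x1 in auto)
      with x1 show False by simp
    qed
    define c where "c x = \<alpha> k x / \<alpha> k x1" for x
    \<comment> \<open>\<open>P\<close> projects along \<open>x1\<close> onto the kernel of
      \<open>\<alpha> k\<close>, where the new constraint holds with equality.\<close>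
    define P where "P x = (\<lambda>j. x j + (- c x) * x1 j)" for x
    have lin: "f (P x) = f x - c x * f x1" if "functional f" for f x
      using that unfolding functional_def P_def by (metis mult_minus_left add_uminus_conv_diff)
    have fc: "c (\<lambda>j. x j + r * y j) = c x + r * c y" for x y r
      using insert.prems(1)[of k] k1 by (simp add: c_def functional_def field_simps)
    have funP: "functional (\<lambda>x. f (P x))" if "functional f" for f
      unfolding functional_def lin[OF that] fc
      using that by (simp add: functional_def algebra_simps)
    have "\<exists>u. (\<forall>i\<in>I. u i \<ge> 0) \<and> (\<forall>x. \<gamma> (P x) = (\<Sum>i\<in>I. u i * \<alpha> i (P x)))"
    proof (rule insert.IH)
      fix x assume *: "\<And>i. i \<in> I \<Longrightarrow> \<alpha> i (P x) \<le> 0"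
      have "\<alpha> k (P x) = 0"
        using lin[of "\<alpha> k" x] insert.prems(1)[of k] k1 by (simp add: c_def)
      then show "\<gamma> (P x) \<le> 0"
        using * by (intro insert.prems(3)) auto
    qed (use funP insert.prems in auto)
    then obtain u where u: "\<And>i. i \<in> I \<Longrightarrow> u i \<ge> 0"
      "\<And>x. \<gamma> (P x) = (\<Sum>i\<in>I. u i * \<alpha> i (P x))" by blast
    \<comment> \<open>The multiplier of \<open>\<alpha> k\<close> is forced by evaluating the
      claimed identity at \<open>x1\<close>. It is nonnegative because
      \<open>\<gamma> x1 > 0\<close> while the old constraints contribute at most 0 there.\<close>
    define v where "v = (\<gamma> x1 - (\<Sum>i\<in>I. u i * \<alpha> i x1)) / \<alpha> k x1"
    have "(\<Sum>i\<in>I. u i * \<alpha> i x1) \<le> 0"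
      using u x1 by (intro sum_nonpos) (simp add: mult_nonneg_nonpos)
    then have v: "v \<ge> 0" using x1 k1 by (simp add: v_def)
    have "\<gamma> x = (\<Sum>i\<in>insert k I. (u(k := v)) i * \<alpha> i x)" for x
    proof -
      have "\<gamma> x = c x * \<gamma> x1 + (\<Sum>i\<in>I. u i * \<alpha> i (P x))"
        using lin[of \<gamma> x] insert.prems u(2)[of x] by simp
      also have "(\<Sum>i\<in>I. u i * \<alpha> i (P x)) = (\<Sum>i\<in>I. u i * \<alpha> i x - c x * (u i * \<alpha> i x1))"
      proof (intro sum.cong refl)
        fix i assume "i \<in> I"
        then have "\<alpha> i (P x) = \<alpha> i x - c x * \<alpha> i x1" using insert.prems by (intro lin) auto
        then show "u i * \<alpha> i (P x) = u i * \<alpha> i x - c x * (u i * \<alpha> i x1)"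
          by (simp only:) (simp add: right_diff_distrib mult.left_commute)
      qed
      also have "\<dots> = (\<Sum>i\<in>I. u i * \<alpha> i x) - c x * (\<Sum>i\<in>I. u i * \<alpha> i x1)"
        by (simp add: sum_subtractf sum_distrib_left)
      finally have "\<gamma> x = (\<Sum>i\<in>I. u i * \<alpha> i x) + v * \<alpha> k x"
        using k1 by (simp add: v_def c_def field_simps)
      also have "(\<Sum>i\<in>I. u i * \<alpha> i x) = (\<Sum>i\<in>I. (u(k := v)) i * \<alpha> i x)"
        using insert.hyps by (intro sum.cong) auto
      finally show ?thesis using insert.hyps by simp
    qed
    then show ?thesis using u v by (intro exI[of _ "u(k := v)"]) auto
  qed
qed

text \<open>The inf-convolution of the second potential with \<open>t dist\<close> separates the two
  potentials of the dual problem by one \<open>t\<close>-Lipschitz function.\<close>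

lemma finite_transport_duality:
  fixes a b :: "'a::metric_space \<Rightarrow> real"
  assumes fin: "finite F" and a: "\<And>x. x \<in> F \<Longrightarrow> a x \<ge> 0" and b: "\<And>x. x \<in> F \<Longrightarrow> b x \<ge> 0"
    and lip: "\<And>h t. t \<ge> 0 \<Longrightarrow> (\<And>x y. \<bar>h x - h y\<bar> \<le> t * dist x y) \<Longrightarrow>
      (\<Sum>x\<in>F. h x * a x) - (\<Sum>x\<in>F. h x * b x) \<le> t * C"
  shows "\<exists>p. (\<forall>x\<in>F. \<forall>y\<in>F. p x y \<ge> 0) \<and> (\<forall>x\<in>F. (\<Sum>y\<in>F. p x y) = a x) \<and>
    (\<forall>y\<in>F. (\<Sum>x\<in>F. p x y) = b y) \<and> (\<Sum>x\<in>F. \<Sum>y\<in>F. p x y * dist x y) \<le> C"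
proof -
  \<comment> \<open>Coordinate \<open>None\<close> carries the Lipschitz constant t,
    \<open>Inl\<close> and \<open>Inr\<close> carry the two potentials. The constraints are t >= 0
    and dual feasibility for the cost t dist; the multiplier of a pair of points becomes the mass
    transported between them. Keeping t as a variable makes the system homogeneous.\<close>
  define J where "J = insert None (Some ` (F \<times> F))"
  define \<alpha> :: "('a \<times> 'a) option \<Rightarrow> (('a + 'a) option \<Rightarrow> real) \<Rightarrow> real" where
    "\<alpha> i x = (case i of None \<Rightarrow> - x None
      | Some z \<Rightarrow> x (Some (Inl (fst z))) - x (Some (Inr (snd z))) - x None * dist (fst z) (snd z))" for i x
  define \<gamma> where "\<gamma> x = (\<Sum>p\<in>F. x (Some (Inl p)) * a p) - (\<Sum>q\<in>F. x (Some (Inr q)) * b q) - x None * C"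
    for x :: "('a + 'a) option \<Rightarrow> real"
  have "\<exists>u. (\<forall>i\<in>J. u i \<ge> 0) \<and> (\<forall>x. \<gamma> x = (\<Sum>i\<in>J. u i * \<alpha> i x))"
  proof (rule farkas)
    show "finite J" using fin by (simp add: J_def)
    show "functional (\<alpha> i)" for i
      by (auto simp: functional_def \<alpha>_def algebra_simps split: option.split)
    show "functional \<gamma>"
      by (auto simp: functional_def \<gamma>_def algebra_simps sum.distrib sum_distrib_left)
    fix x assume *: "\<And>i. i \<in> J \<Longrightarrow> \<alpha> i x \<le> 0"
    define t where "t = x None"
    have t: "t \<ge> 0" using *[of None] by (simp add: J_def \<alpha>_def t_def)
    have c: "x (Some (Inl p)) \<le> x (Some (Inr q)) + t * dist p q" if "p \<in> F" "q \<in> F" for p q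
      using *[of "Some (p, q)"] that by (simp add: J_def \<alpha>_def t_def)
    show "\<gamma> x \<le> 0"
    proof (cases "F = {}")
      case True
      then show ?thesis using lip[of t "\<lambda>_. 0"] t by (simp add: \<gamma>_def t_def)
    next
      case False
      define g where "g y = Min ((\<lambda>q. x (Some (Inr q)) + t * dist y q) ` F)" for y
      have g_le: "g y \<le> x (Some (Inr q)) + t * dist y q" if "q \<in> F" for y q
        using fin that unfolding g_def by (intro Min_le) auto
      have g_ge: "r \<le> g y" if "\<And>q. q \<in> F \<Longrightarrow> r \<le> x (Some (Inr q)) + t * dist y q" for y r
        using fin that False unfolding g_def by (subst Min_ge_iff) auto
      have g1: "g y \<le> g z + t * dist y z" for y z
      proof -
        have "g y - t * dist y z \<le> g z"
        proof (rule g_ge)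
          fix q assume q: "q \<in> F"
          have "t * dist y q \<le> t * dist y z + t * dist z q"
            using mult_left_mono[OF dist_triangle t, of y q z] by (simp add: algebra_simps)
          then show "g y - t * dist y z \<le> x (Some (Inr q)) + t * dist z q"
            using g_le[OF q, of y] by simp
        qed
        then show ?thesis by simp
      qed
      have "\<bar>g y - g z\<bar> \<le> t * dist y z" for y z
        using g1[of y z] g1[of z y] by (auto simp: dist_commute)
      then have "(\<Sum>x\<in>F. g x * a x) - (\<Sum>x\<in>F. g x * b x) \<le> t * C"
        using lip[OF t] by blast
      moreover have "(\<Sum>p\<in>F. x (Some (Inl p)) * a p) \<le> (\<Sum>x\<in>F. g x * a x)"
        using c by (intro sum_mono mult_right_mono a g_ge) auto
      moreover have "(\<Sum>x\<in>F. g x * b x) \<le> (\<Sum>q\<in>F. x (Some (Inr q)) * b q)"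
        using g_le by (intro sum_mono mult_right_mono b) (metis add.right_neutral dist_self mult_zero_right)
      ultimately show ?thesis by (simp add: \<gamma>_def t_def)
    qed
  qed
  then obtain u where u0: "\<And>i. i \<in> J \<Longrightarrow> u i \<ge> 0"
    and u: "\<And>x. \<gamma> x = (\<Sum>i\<in>J. u i * \<alpha> i x)" by blast
  define p where "p x y = u (Some (x, y))" for x y
  have expand: "\<gamma> x = - u None * x None + (\<Sum>r\<in>F. \<Sum>s\<in>F. p r s *
      (x (Some (Inl r)) - x (Some (Inr s)) - x None * dist r s))" for x
  proof -
    have "\<gamma> x = u None * \<alpha> None x + (\<Sum>i\<in>Some ` (F \<times> F). u i * \<alpha> i x)"
      unfolding u J_def using fin by (subst sum.insert) auto
    also have "(\<Sum>i\<in>Some ` (F \<times> F). u i * \<alpha> i x) = (\<Sum>z\<in>F \<times> F. u (Some z) * \<alpha> (Some z) x)"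
      by (subst sum.reindex) auto
    also have "\<dots> = (\<Sum>r\<in>F. \<Sum>s\<in>F. p r s *
      (x (Some (Inl r)) - x (Some (Inr s)) - x None * dist r s))"
      by (simp add: sum.cartesian_product split_def \<alpha>_def p_def)
    finally show ?thesis by (simp add: \<alpha>_def)
  qed
  \<comment> \<open>Unit vectors read off coefficients: \<open>Inl r\<close> and
    \<open>Inr s\<close> give the two marginals. The direction \<open>None\<close> gives the cost,
    only as an inequality, since the multiplier of t >= 0 is nonnegative.\<close>
  have 1: "(\<Sum>s\<in>F. p r s) = a r" if "r \<in> F" for r
  proof -
    have "a r = (\<Sum>r'\<in>F. \<Sum>s\<in>F. if r' = r then p r' s else 0)"
      using expand[of "\<lambda>j. if j = Some (Inl r) then 1 else 0"] that fin
      by (simp add: \<gamma>_def if_distrib if_distribR sum.delta' cong: if_cong)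
    also have "\<dots> = (\<Sum>s\<in>F. p r s)"
      using that fin by (subst sum.swap) simp
    finally show ?thesis by simp
  qed
  have 2: "(\<Sum>r\<in>F. p r s) = b s" if "s \<in> F" for s
    using expand[of "\<lambda>j. if j = Some (Inr s) then 1 else 0"] that fin
    by (simp add: \<gamma>_def if_distrib if_distribR sum.delta' sum_negf cong: if_cong)
  have 3: "(\<Sum>r\<in>F. \<Sum>s\<in>F. p r s * dist r s) \<le> C"
    using expand[of "\<lambda>j. if j = None then 1 else 0"] u0[of None]
    by (simp add: \<gamma>_def sum_negf J_def)
  show ?thesis
    using 1 2 3 u0 by (intro exI[of _ p]) (auto simp: p_def J_def)
qed

section \<open>Lifting finite plans to Borel laws\<close>

lemma simple_function_comp_eq_sum:
  fixes g :: "'b \<Rightarrow> 'c::semiring_1"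
  assumes "finite (range T)"
  shows "g (T y) = (\<Sum>s\<in>range T. g s * indicator (T -` {s}) y)"
  using assms by (simp add: indicator_def if_distrib cong: if_cong)

lemma nn_integral_simple_comp:
  fixes g :: "'b \<Rightarrow> ennreal"
  assumes "simple_function M T" and [simp]: "space M = UNIV"
  shows "(\<integral>\<^sup>+y. g (T y) \<partial>M) = (\<Sum>s\<in>range T. g s * emeasure M (T -` {s}))"
proof -
  have fin: "finite (range T)" and [measurable]: "\<And>s. T -` {s} \<in> sets M"
    using simple_functionD[OF assms(1)] by auto
  show ?thesis
    by (subst simple_function_comp_eq_sum[OF fin]) (simp add: nn_integral_sum nn_integral_cmult)
qed

lemma integral_simple_comp:
  fixes g :: "'b \<Rightarrow> real"
  assumes "simple_function M T" and [simp]: "space M = UNIV" and "finite_measure M"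
  shows "(\<integral>y. g (T y) \<partial>M) = (\<Sum>s\<in>range T. g s * measure M (T -` {s}))"
    and "integrable M (\<lambda>y. g (T y))"
proof -
  interpret finite_measure M by fact
  have fin: "finite (range T)" and [measurable]: "\<And>s. T -` {s} \<in> sets M"
    using simple_functionD[OF assms(1)] by auto
  have [simp]: "integrable M (indicator (T -` {s}) :: _ \<Rightarrow> real)" for s
    by (intro integrable_real_indicator) (auto simp: less_top[symmetric])
  show "(\<integral>y. g (T y) \<partial>M) = (\<Sum>s\<in>range T. g s * measure M (T -` {s}))"
    by (subst simple_function_comp_eq_sum[OF fin]) simp
  show "integrable M (\<lambda>y. g (T y))"
    by (subst simple_function_comp_eq_sum[OF fin]) simp
qed

text \<open>Spreading the mass of a discrete plan \<open>p\<close> over the cells of \<open>T\<close>. A cell of mass zero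
  carries no mass of \<open>p\<close>, so the division by zero is harmless.\<close>

lemma AE_lifted_plan_marginal:
  fixes \<mu> \<nu> :: "'a measure"
  assumes T: "simple_function \<mu> T" "simple_function \<nu> T"
    and sp: "space \<mu> = UNIV" "space \<nu> = UNIV"
    and "prob_space \<mu>" "prob_space \<nu>"
    and p: "\<And>x y. x \<in> range T \<Longrightarrow> y \<in> range T \<Longrightarrow> p x y \<ge> 0"
    and p1: "\<And>x. x \<in> range T \<Longrightarrow> (\<Sum>y\<in>range T. p x y) = measure \<mu> (T -` {x})"
    and p2: "\<And>y. y \<in> range T \<Longrightarrow> (\<Sum>x\<in>range T. p x y) = measure \<nu> (T -` {y})"
  shows "AE x in \<mu>. (\<integral>\<^sup>+y. ennreal (p (T x) (T y) /
    (measure \<mu> (T -` {T x}) * measure \<nu> (T -` {T y}))) \<partial>\<nu>) = 1"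
proof -
  interpret M: prob_space \<mu> by fact
  interpret N: prob_space \<nu> by fact
  have fin: "finite (range T)" and [measurable]: "\<And>s. T -` {s} \<in> sets \<mu>"
    using simple_functionD[OF T(1)] sp by auto
  have "AE x in \<mu>. \<forall>r\<in>range T. measure \<mu> (T -` {r}) = 0 \<longrightarrow> T x \<noteq> r"
  proof (intro AE_finite_allI fin)
    fix r
    show "AE x in \<mu>. measure \<mu> (T -` {r}) = 0 \<longrightarrow> T x \<noteq> r"
    proof (cases "measure \<mu> (T -` {r}) = 0")
      case True
      then show ?thesis
        by (intro AE_I[where N = "T -` {r}"]) (auto simp: M.emeasure_eq_measure)
    qed simp
  qed
  then show ?thesis
  proof (rule AE_mp, intro AE_I2 impI)
    fix x assume "\<forall>r\<in>range T. measure \<mu> (T -` {r}) = 0 \<longrightarrow> T x \<noteq> r"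
    then have a: "measure \<mu> (T -` {T x}) \<noteq> 0" by auto
    let ?a = "measure \<mu> (T -` {T x})"
    let ?q = "\<lambda>s. p (T x) s / (?a * measure \<nu> (T -` {s}))"
    have "(\<integral>\<^sup>+y. ennreal (?q (T y)) \<partial>\<nu>) = (\<Sum>s\<in>range T. ennreal (?q s) * emeasure \<nu> (T -` {s}))"
      by (rule nn_integral_simple_comp) (use T sp in auto)
    also have "\<dots> = (\<Sum>s\<in>range T. ennreal (p (T x) s / ?a))"
    proof (intro sum.cong refl)
      fix s assume s: "s \<in> range T"
      have "p (T x) s \<le> measure \<nu> (T -` {s})"
        unfolding p2[OF s, symmetric]
        by (rule member_le_sum) (use fin p s in auto)
      then have "?q s * measure \<nu> (T -` {s}) = p (T x) s / ?a"
        using p[of "T x" s] s by (cases "measure \<nu> (T -` {s}) = 0") auto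
      then show "ennreal (?q s) * emeasure \<nu> (T -` {s}) = ennreal (p (T x) s / ?a)"
        using p[of "T x" s] s by (simp add: N.emeasure_eq_measure ennreal_mult[symmetric])
    qed
    also have "\<dots> = ennreal (\<Sum>s\<in>range T. p (T x) s / ?a)"
      using p by (intro sum_ennreal) auto
    also have "(\<Sum>s\<in>range T. p (T x) s / ?a) = 1"
      using p1[of "T x"] a by (simp add: sum_divide_distrib[symmetric])
    finally show "(\<integral>\<^sup>+y. ennreal (?q (T y)) \<partial>\<nu>) = 1" by simp
  qed
qed

text \<open>This is the hard direction of the duality, as a coupling must be produced. A simple map
  \<open>T\<close> that is close to the identity in mean for both laws reduces to finite duality.
  The finite plan is then turned into a density with respect to the product of the two laws,
  constant on pairs of cells, and therefore has exactly \<open>\<mu>\<close> and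
  \<open>\<nu>\<close> as marginals, not their discretizations.\<close>

theorem wasserstein_le_of_lipschitz:
  fixes \<mu> \<nu> :: "'a::euclidean_space measure"
  assumes "prob_space \<mu>" "prob_space \<nu>" and sets: "sets \<mu> = sets borel" "sets \<nu> = sets borel"
    and int: "integrable \<mu> norm" "integrable \<nu> norm"
    and lip: "\<And>h. (\<And>x y. \<bar>h x - h y\<bar> \<le> dist x y) \<Longrightarrow> (\<integral>x. h x \<partial>\<mu>) - (\<integral>x. h x \<partial>\<nu>) \<le> B"
  shows "wasserstein \<mu> \<nu> \<le> ennreal B"
proof (rule ennreal_le_epsilon)
  interpret M: prob_space \<mu> by fact
  interpret N: prob_space \<nu> by fact
  interpret MN: pair_sigma_finite \<mu> \<nu> ..
  note [measurable_cong] = sets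
  have sp: "space \<mu> = UNIV" "space \<nu> = UNIV"
    using sets_eq_imp_space_eq[OF sets(1)] sets_eq_imp_space_eq[OF sets(2)] by auto
  fix e :: real assume e: "e > 0"
  \<comment> \<open>Two of the four parts of \<open>e\<close> pay for replacing \<open>h\<close> by
    its composition with \<open>T\<close> in the dual functional, once for each law; the other two
    pay for moving both points of the coupling to the representatives of their cells.\<close>
  define d where "d = e / 4"
  have d: "d > 0" using e by (simp add: d_def)
  obtain s where s: "\<And>i. simple_function borel (s i)" "\<And>x. (\<lambda>i. s i x) \<longlonglongrightarrow> (x::'a)"
      "\<And>i x. dist (s i x) 0 \<le> 2 * dist x 0"
    using borel_measurable_implies_sequence_metric[of "\<lambda>x::'a. x" borel 0] by auto
  have [measurable]: "s i \<in> borel_measurable borel" for i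
    using s(1) by (rule borel_measurable_simple_function)
  have lim: "(\<lambda>i. \<integral>x. norm (x - s i x) \<partial>M) \<longlonglongrightarrow> 0"
    if [measurable_cong]: "sets M = sets borel" and "integrable M norm" for M
  proof -
    have "(\<lambda>i. \<integral>x. norm (x - s i x) \<partial>M) \<longlonglongrightarrow> (\<integral>x. (0::real) \<partial>M)"
    proof (rule integral_dominated_convergence[where w = "\<lambda>x. 3 * norm x"])
      show "integrable M (\<lambda>x. 3 * norm x)" using that by simp
      have "(\<lambda>i. norm (x - s i x)) \<longlonglongrightarrow> norm (x - x)" for x
        by (intro tendsto_intros s)
      then show "AE x in M. (\<lambda>i. norm (x - s i x)) \<longlonglongrightarrow> 0" by simp
      have "norm (x - s i x) \<le> 3 * norm x" for x i
        using norm_triangle_ineq4[of x "s i x"] s(3)[of i x] by simp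
      then show "AE x in M. norm (norm (x - s i x)) \<le> 3 * norm x" for i by simp
    qed measurable
    then show ?thesis by simp
  qed
  have "\<forall>\<^sub>F i in sequentially. (\<integral>x. norm (x - s i x) \<partial>\<mu>) < d \<and> (\<integral>x. norm (x - s i x) \<partial>\<nu>) < d"
    using order_tendstoD(2)[OF lim[OF sets(1) int(1)] d] order_tendstoD(2)[OF lim[OF sets(2) int(2)] d]
    by eventually_elim simp
  then obtain i where i: "(\<integral>x. norm (x - s i x) \<partial>\<mu>) < d" "(\<integral>x. norm (x - s i x) \<partial>\<nu>) < d"
    by (auto simp: eventually_sequentially)
  define T where "T = s i"
  have [measurable]: "T \<in> borel_measurable borel" by (simp add: T_def)
  have T: "simple_function \<mu> T" "simple_function \<nu> T"
    using s(1)[of i] unfolding T_def simple_function_def by (auto simp: sp sets)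
  have fin: "finite (range T)" using simple_functionD(1)[OF T(1)] sp by simp
  have intT: "integrable M (\<lambda>x. norm (x - T x))"
    if [measurable_cong]: "sets M = sets borel" and "integrable M norm" for M
  proof (rule Bochner_Integration.integrable_bound)
    show "integrable M (\<lambda>x. 3 * norm x)" using that by simp
    have "norm (x - T x) \<le> 3 * norm x" for x
      using norm_triangle_ineq4[of x "T x"] s(3)[of i x] by (simp add: T_def)
    then show "AE x in M. norm (norm (x - T x)) \<le> norm (3 * norm x)" by simp
  qed measurable
  let ?a = "\<lambda>x. measure \<mu> (T -` {x})" and ?b = "\<lambda>x. measure \<nu> (T -` {x})"
  \<comment> \<open>The modulus t stays general because the finite duality quantifies over Lipschitz
    constants of every size, 0 included.\<close>
  have disc: "\<bar>(\<integral>x. h (T x) \<partial>M) - (\<integral>x. h x \<partial>M)\<bar> \<le> t * d"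
    if [measurable_cong]: "sets M = sets borel" and M: "integrable M norm" "prob_space M"
      and T: "simple_function M T" and md: "(\<integral>x. norm (x - s i x) \<partial>M) < d"
      and t: "t \<ge> 0" "\<And>x y. \<bar>h x - h y\<bar> \<le> t * dist x y" for M and h :: "'a \<Rightarrow> real" and t
  proof -
    interpret prob_space M by fact
    have spM: "space M = UNIV" using sets_eq_imp_space_eq[OF that(1)] by simp
    have "continuous_on UNIV h"
      using t by (intro lipschitz_on_continuous_on[of t] lipschitz_onI) (auto simp: dist_real_def)
    then have [measurable]: "h \<in> borel_measurable borel" by (rule borel_measurable_continuous_onI)
    have ih: "integrable M h"
    proof (rule Bochner_Integration.integrable_bound)
      show "integrable M (\<lambda>x. \<bar>h 0\<bar> + t * norm x)" using M by simp
      have "\<bar>h x\<bar> \<le> \<bar>h 0\<bar> + t * norm x" for x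
        using t(2)[of x 0] by auto
      then show "AE x in M. norm (h x) \<le> norm (\<bar>h 0\<bar> + t * norm x)" using t by simp
    qed measurable
    have iT: "integrable M (\<lambda>x. h (T x))"
      by (rule integral_simple_comp) (auto simp: T spM finite_measure_axioms)
    have "\<bar>(\<integral>x. h (T x) \<partial>M) - (\<integral>x. h x \<partial>M)\<bar> = \<bar>\<integral>x. h (T x) - h x \<partial>M\<bar>"
      using ih iT by simp
    also have "\<dots> \<le> (\<integral>x. \<bar>h (T x) - h x\<bar> \<partial>M)"
      by (rule integral_abs_bound)
    also have "\<dots> \<le> (\<integral>x. t * norm (x - T x) \<partial>M)"
    proof (intro integral_mono)
      show "\<bar>h (T x) - h x\<bar> \<le> t * norm (x - T x)" for x
        using t(2)[of x "T x"] by (simp add: dist_norm abs_minus_commute)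
    qed (use ih iT intT[OF that(1) M(1)] in auto)
    also have "\<dots> \<le> t * d"
      using md t by (auto simp: T_def intro!: mult_left_mono)
    finally show ?thesis .
  qed
  have B: "B \<ge> 0" using lip[of "\<lambda>_. 0"] by simp
  have "\<exists>p. (\<forall>x\<in>range T. \<forall>y\<in>range T. p x y \<ge> 0) \<and> (\<forall>x\<in>range T. (\<Sum>y\<in>range T. p x y) = ?a x) \<and>
    (\<forall>y\<in>range T. (\<Sum>x\<in>range T. p x y) = ?b y) \<and>
    (\<Sum>x\<in>range T. \<Sum>y\<in>range T. p x y * dist x y) \<le> B + 2 * d"
  proof (rule finite_transport_duality[OF fin])
    fix h :: "'a \<Rightarrow> real" and t :: real
    assume t: "t \<ge> 0" and h: "\<And>x y. \<bar>h x - h y\<bar> \<le> t * dist x y"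
    have "(\<Sum>x\<in>range T. h x * ?a x) = (\<integral>x. h (T x) \<partial>\<mu>)"
      by (rule integral_simple_comp(1)[symmetric]) (auto simp: T sp M.finite_measure_axioms)
    moreover have "(\<Sum>x\<in>range T. h x * ?b x) = (\<integral>x. h (T x) \<partial>\<nu>)"
      by (rule integral_simple_comp(1)[symmetric]) (auto simp: T sp N.finite_measure_axioms)
    moreover have "\<bar>(\<integral>x. h (T x) \<partial>\<mu>) - (\<integral>x. h x \<partial>\<mu>)\<bar> \<le> t * d"
      by (intro disc) (use T sets int i t h M.prob_space_axioms in auto)
    moreover have "\<bar>(\<integral>x. h (T x) \<partial>\<nu>) - (\<integral>x. h x \<partial>\<nu>)\<bar> \<le> t * d"
      by (intro disc) (use T sets int i t h N.prob_space_axioms in auto)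
    moreover have "(\<integral>x. h x \<partial>\<mu>) - (\<integral>x. h x \<partial>\<nu>) \<le> t * B"
    proof (cases "t = 0")
      case True
      then have "h = (\<lambda>_. h 0)" using h[of _ 0] by auto
      then have "(\<integral>x. h x \<partial>\<mu>) = h 0" "(\<integral>x. h x \<partial>\<nu>) = h 0"
        by (metis M.prob_space lebesgue_integral_const scaleR_one,
            metis N.prob_space lebesgue_integral_const scaleR_one)
      with True show ?thesis by simp
    next
      case False
      then have "(\<integral>x. h x / t \<partial>\<mu>) - (\<integral>x. h x / t \<partial>\<nu>) \<le> B"
        using t h by (intro lip) (auto simp: field_simps simp flip: diff_divide_distrib)
      then show ?thesis using t False by (simp add: field_simps)
    qed
    ultimately show "(\<Sum>x\<in>range T. h x * ?a x) - (\<Sum>x\<in>range T. h x * ?b x) \<le> t * (B + 2 * d)"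
      by (simp add: algebra_simps abs_le_iff)
  qed auto
  then obtain p where p: "\<And>x y. x \<in> range T \<Longrightarrow> y \<in> range T \<Longrightarrow> p x y \<ge> 0"
      "\<And>x. x \<in> range T \<Longrightarrow> (\<Sum>y\<in>range T. p x y) = ?a x"
      "\<And>y. y \<in> range T \<Longrightarrow> (\<Sum>x\<in>range T. p x y) = ?b y"
      "(\<Sum>x\<in>range T. \<Sum>y\<in>range T. p x y * dist x y) \<le> B + 2 * d"
    by blast
  define k where "k x y = ennreal (p (T x) (T y) / (?a (T x) * ?b (T y)))" for x y
  have TT: "simple_function (\<mu> \<Otimes>\<^sub>M \<nu>) (\<lambda>z. (T (fst z), T (snd z)))"
    unfolding simple_function_def
  proof (intro conjI ballI)
    show "finite ((\<lambda>z. (T (fst z), T (snd z))) ` space (\<mu> \<Otimes>\<^sub>M \<nu>))"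
      by (rule finite_subset[of _ "range T \<times> range T"]) (use fin in auto)
    have [measurable]: "T -` {r} \<in> sets \<mu>" "T -` {r} \<in> sets \<nu>" for r
      using simple_functionD(2)[OF T(1), of "{r}"] simple_functionD(2)[OF T(2), of "{r}"] sp by auto
    fix y :: "'a \<times> 'a"
    have "(\<lambda>z. (T (fst z), T (snd z))) -` {y} \<inter> space (\<mu> \<Otimes>\<^sub>M \<nu>) = (T -` {fst y}) \<times> (T -` {snd y})"
      by (auto simp: space_pair_measure sp)
    then show "(\<lambda>z. (T (fst z), T (snd z))) -` {y} \<inter> space (\<mu> \<Otimes>\<^sub>M \<nu>) \<in> sets (\<mu> \<Otimes>\<^sub>M \<nu>)"
      by simp
  qed
  have km[measurable]: "(\<lambda>z. k (fst z) (snd z)) \<in> borel_measurable (\<mu> \<Otimes>\<^sub>M \<nu>)"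
    using borel_measurable_simple_function[OF simple_function_compose1[OF TT,
      of "\<lambda>(r, s). ennreal (p r s / (?a r * ?b s))"]]
    by (simp add: k_def split_def)
  have [measurable]: "k x \<in> borel_measurable \<nu>" "(\<lambda>x. k x y) \<in> borel_measurable \<mu>" for x y
    using measurable_compose[OF measurable_Pair1'[of x \<mu> \<nu>] km]
      measurable_compose[OF measurable_Pair2'[of y \<nu> \<mu>] km] sp by auto
  define \<gamma> where "\<gamma> = density (\<mu> \<Otimes>\<^sub>M \<nu>) (\<lambda>z. k (fst z) (snd z))"
  have k1: "AE x in \<mu>. (\<integral>\<^sup>+y. k x y \<partial>\<nu>) = 1"
    unfolding k_def
    by (rule AE_lifted_plan_marginal) (use T sp p M.prob_space_axioms N.prob_space_axioms in auto)
  have "AE y in \<nu>. (\<integral>\<^sup>+x. ennreal (p (T x) (T y) / (?b (T y) * ?a (T x))) \<partial>\<mu>) = 1"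
    by (rule AE_lifted_plan_marginal[where p = "\<lambda>x y. p y x"])
      (use T sp p M.prob_space_axioms N.prob_space_axioms in auto)
  then have k2: "AE y in \<nu>. (\<integral>\<^sup>+x. k x y \<partial>\<mu>) = 1"
    by (simp add: k_def mult.commute)
  have g1: "(\<integral>\<^sup>+z. f (fst z) \<partial>\<gamma>) = (\<integral>\<^sup>+x. f x \<partial>\<mu>)" if [measurable]: "f \<in> borel_measurable borel" for f
  proof -
    have "(\<integral>\<^sup>+z. f (fst z) \<partial>\<gamma>) = (\<integral>\<^sup>+z. k (fst z) (snd z) * f (fst z) \<partial>(\<mu> \<Otimes>\<^sub>M \<nu>))"
      unfolding \<gamma>_def by (subst nn_integral_density) auto
    also have "\<dots> = (\<integral>\<^sup>+x. \<integral>\<^sup>+y. k x y * f x \<partial>\<nu> \<partial>\<mu>)"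
      by (subst N.nn_integral_fst[symmetric]) auto
    also have "\<dots> = (\<integral>\<^sup>+x. (\<integral>\<^sup>+y. k x y \<partial>\<nu>) * f x \<partial>\<mu>)"
      by (intro nn_integral_cong nn_integral_multc) (simp add: sp)
    also have "\<dots> = (\<integral>\<^sup>+x. f x \<partial>\<mu>)"
      using k1 by (intro nn_integral_cong_AE) auto
    finally show ?thesis .
  qed
  have g2: "(\<integral>\<^sup>+z. f (snd z) \<partial>\<gamma>) = (\<integral>\<^sup>+x. f x \<partial>\<nu>)" if [measurable]: "f \<in> borel_measurable borel" for f
  proof -
    have "(\<integral>\<^sup>+z. f (snd z) \<partial>\<gamma>) = (\<integral>\<^sup>+z. k (fst z) (snd z) * f (snd z) \<partial>(\<mu> \<Otimes>\<^sub>M \<nu>))"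
      unfolding \<gamma>_def by (subst nn_integral_density) auto
    also have "\<dots> = (\<integral>\<^sup>+y. \<integral>\<^sup>+x. k x y * f y \<partial>\<mu> \<partial>\<nu>)"
      by (subst MN.nn_integral_snd[symmetric]) auto
    also have "\<dots> = (\<integral>\<^sup>+y. (\<integral>\<^sup>+x. k x y \<partial>\<mu>) * f y \<partial>\<nu>)"
      by (intro nn_integral_cong nn_integral_multc) (simp add: sp)
    also have "\<dots> = (\<integral>\<^sup>+x. f x \<partial>\<nu>)"
      using k2 by (intro nn_integral_cong_AE) auto
    finally show ?thesis .
  qed
  have sg: "sets \<gamma> = sets (borel \<Otimes>\<^sub>M borel)"
    unfolding \<gamma>_def using sets_pair_measure_cong[OF sets] by simp
  note [measurable_cong] = sg
  have "\<gamma> \<in> couplings \<mu> \<nu>"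
    unfolding couplings_def
  proof (intro CollectI conjI sg measure_eqI)
    fix A assume "A \<in> sets (distr \<gamma> borel fst)"
    then have [measurable]: "A \<in> sets borel" by simp
    have "emeasure (distr \<gamma> borel fst) A = (\<integral>\<^sup>+x. indicator A x \<partial>distr \<gamma> borel fst)"
      by simp
    also have "\<dots> = (\<integral>\<^sup>+z. indicator A (fst z) \<partial>\<gamma>)"
      by (rule nn_integral_distr) simp_all
    finally have "emeasure (distr \<gamma> borel fst) A = (\<integral>\<^sup>+z. indicator A (fst z) \<partial>\<gamma>)" .
    then show "emeasure (distr \<gamma> borel fst) A = emeasure \<mu> A"
      by (simp add: g1 sets)
  next
    fix A assume "A \<in> sets (distr \<gamma> borel snd)"
    then have [measurable]: "A \<in> sets borel" by simp
    have "emeasure (distr \<gamma> borel snd) A = (\<integral>\<^sup>+x. indicator A x \<partial>distr \<gamma> borel snd)"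
      by simp
    also have "\<dots> = (\<integral>\<^sup>+z. indicator A (snd z) \<partial>\<gamma>)"
      by (rule nn_integral_distr) simp_all
    finally have "emeasure (distr \<gamma> borel snd) A = (\<integral>\<^sup>+z. indicator A (snd z) \<partial>\<gamma>)" .
    then show "emeasure (distr \<gamma> borel snd) A = emeasure \<nu> A"
      by (simp add: g2 sets)
  qed (simp_all add: sets)
  then have "wasserstein \<mu> \<nu> \<le> (\<integral>\<^sup>+z. ennreal (dist (fst z) (snd z)) \<partial>\<gamma>)"
    unfolding wasserstein_def by (rule INF_lower)
  also have "\<dots> \<le> (\<integral>\<^sup>+z. ennreal (norm (fst z - T (fst z))) + (ennreal (norm (snd z - T (snd z)))
      + ennreal (dist (T (fst z)) (T (snd z)))) \<partial>\<gamma>)"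
  proof (intro nn_integral_mono)
    fix z :: "'a \<times> 'a"
    have "dist (fst z) (snd z) \<le> norm (fst z - T (fst z)) + (norm (snd z - T (snd z))
      + dist (T (fst z)) (T (snd z)))"
      using dist_triangle[of "fst z" "snd z" "T (fst z)"] dist_triangle2[of "T (fst z)" "snd z" "T (snd z)"]
      by (simp add: dist_norm)
    then show "ennreal (dist (fst z) (snd z)) \<le> ennreal (norm (fst z - T (fst z))) +
        (ennreal (norm (snd z - T (snd z))) + ennreal (dist (T (fst z)) (T (snd z))))"
      by (simp flip: ennreal_plus add: ennreal_leI)
  qed
  also have "\<dots> = (\<integral>\<^sup>+z. ennreal (norm (fst z - T (fst z))) \<partial>\<gamma>)
      + ((\<integral>\<^sup>+z. ennreal (norm (snd z - T (snd z))) \<partial>\<gamma>)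
      + (\<integral>\<^sup>+z. ennreal (dist (T (fst z)) (T (snd z))) \<partial>\<gamma>))"
    by (subst nn_integral_add, measurable)+
  also have "(\<integral>\<^sup>+z. ennreal (norm (fst z - T (fst z))) \<partial>\<gamma>) = (\<integral>\<^sup>+x. ennreal (norm (x - T x)) \<partial>\<mu>)"
    by (rule g1) simp
  also have "\<dots> = ennreal (\<integral>x. norm (x - T x) \<partial>\<mu>)"
    using intT[OF sets(1) int(1)] by (intro nn_integral_eq_integral) auto
  also have "\<dots> \<le> ennreal d" using i by (intro ennreal_leI) (simp add: T_def)
  also have "(\<integral>\<^sup>+z. ennreal (norm (snd z - T (snd z))) \<partial>\<gamma>) = (\<integral>\<^sup>+x. ennreal (norm (x - T x)) \<partial>\<nu>)"
    by (rule g2) simp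
  also have "\<dots> = ennreal (\<integral>x. norm (x - T x) \<partial>\<nu>)"
    using intT[OF sets(2) int(2)] by (intro nn_integral_eq_integral) auto
  also have "\<dots> \<le> ennreal d" using i by (intro ennreal_leI) (simp add: T_def)
  also have "(\<integral>\<^sup>+z. ennreal (dist (T (fst z)) (T (snd z))) \<partial>\<gamma>) \<le> ennreal (B + 2 * d)"
  proof -
    have "(\<integral>\<^sup>+z. ennreal (dist (T (fst z)) (T (snd z))) \<partial>\<gamma>)
      = (\<integral>\<^sup>+z. k (fst z) (snd z) * ennreal (dist (T (fst z)) (T (snd z))) \<partial>(\<mu> \<Otimes>\<^sub>M \<nu>))"
      unfolding \<gamma>_def by (subst nn_integral_density) auto
    also have "\<dots> = (\<integral>\<^sup>+x. \<integral>\<^sup>+y. k x y * ennreal (dist (T x) (T y)) \<partial>\<nu> \<partial>\<mu>)"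
      by (subst N.nn_integral_fst[symmetric]) auto
    also have "\<dots> = (\<integral>\<^sup>+x. (\<Sum>s\<in>range T. ennreal (p (T x) s / (?a (T x) * ?b s)) * ennreal (dist (T x) s)
        * ennreal (?b s)) \<partial>\<mu>)"
      unfolding k_def
      by (intro nn_integral_cong trans[OF nn_integral_simple_comp[OF T(2) sp(2),
          of "\<lambda>s. ennreal (p (T _) s / (?a (T _) * ?b s)) * ennreal (dist (T _) s)"]])
        (simp add: N.emeasure_eq_measure)
    also have "\<dots> = (\<Sum>r\<in>range T. (\<Sum>s\<in>range T. ennreal (p r s / (?a r * ?b s)) * ennreal (dist r s)
        * ennreal (?b s)) * ennreal (?a r))"
      by (subst nn_integral_simple_comp[OF T(1) sp(1),
          of "\<lambda>r. \<Sum>s\<in>range T. ennreal (p r s / (?a r * ?b s)) * ennreal (dist r s) * ennreal (?b s)"])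
        (simp add: M.emeasure_eq_measure)
    also have "\<dots> = (\<Sum>r\<in>range T. \<Sum>s\<in>range T. ennreal (p r s / (?a r * ?b s) * dist r s * ?b s * ?a r))"
      unfolding sum_distrib_right
    proof (intro sum.cong refl)
      fix r s assume "r \<in> range T" "s \<in> range T"
      then have "p r s / (?a r * ?b s) \<ge> 0" using p(1) by auto
      then show "ennreal (p r s / (?a r * ?b s)) * ennreal (dist r s) * ennreal (?b s) * ennreal (?a r)
        = ennreal (p r s / (?a r * ?b s) * dist r s * ?b s * ?a r)"
        by (simp only: ennreal_mult[symmetric] mult_nonneg_nonneg zero_le_dist measure_nonneg)
    qed
    \<comment> \<open>The factors cancel unless a cell has mass 0; there the left side is 0 because
      x / 0 = 0, so only an inequality is claimed.\<close>
    also have "\<dots> \<le> (\<Sum>r\<in>range T. \<Sum>s\<in>range T. ennreal (p r s * dist r s))"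
    proof (intro sum_mono ennreal_leI)
      fix r s assume "r \<in> range T" "s \<in> range T"
      then show "p r s / (?a r * ?b s) * dist r s * ?b s * ?a r \<le> p r s * dist r s"
        using p(1)[of r s] by (cases "?a r = 0"; cases "?b s = 0") auto
    qed
    also have "\<dots> = ennreal (\<Sum>r\<in>range T. \<Sum>s\<in>range T. p r s * dist r s)"
      using p(1) by (simp add: sum_ennreal sum_nonneg)
    also have "\<dots> \<le> ennreal (B + 2 * d)" using p(4) by (rule ennreal_leI)
    finally show ?thesis .
  qed
  finally have "wasserstein \<mu> \<nu> \<le> ennreal d + (ennreal d + ennreal (B + 2 * d))"
    by (simp add: add_mono add_left_mono)
  also have "\<dots> = ennreal B + ennreal e"
    using d B by (simp add: d_def flip: ennreal_plus)
  finally show "wasserstein \<mu> \<nu> \<le> ennreal B + ennreal e" .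
qed

section \<open>The standard Gaussian measure\<close>

text \<open>Dominated convergence for the difference quotients. The domination is stated for
  increments rather than for the derivative: the integrands below are Lipschitz in the parameter
  near \<open>r0\<close>, whereas differentiability may be known at \<open>r0\<close> alone.\<close>

lemma has_real_derivative_integral:
  fixes f :: "real \<Rightarrow> 'a \<Rightarrow> real"
  assumes d: "d > 0"
    and int: "\<And>r. \<bar>r - r0\<bar> < d \<Longrightarrow> integrable M (f r)"
    and f': "f' \<in> borel_measurable M"
    and deriv: "\<And>w. w \<in> space M \<Longrightarrow> ((\<lambda>r. f r w) has_real_derivative f' w) (at r0)"
    and B: "integrable M B"
    and bound: "\<And>r w. \<bar>r - r0\<bar> < d \<Longrightarrow> w \<in> space M \<Longrightarrow> \<bar>f r w - f r0 w\<bar> \<le> \<bar>r - r0\<bar> * B w"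
  shows "((\<lambda>r. \<integral>w. f r w \<partial>M) has_real_derivative (\<integral>w. f' w \<partial>M)) (at r0)"
proof -
  have "((\<lambda>r. ((\<integral>w. f r w \<partial>M) - (\<integral>w. f r0 w \<partial>M)) / (r - r0)) \<longlongrightarrow> (\<integral>w. f' w \<partial>M)) (at r0 within ball r0 d)"
    unfolding tendsto_at_iff_sequentially
  proof (intro allI impI)
    fix X assume X: "\<forall>i. X i \<in> ball r0 d - {r0}" "X \<longlonglongrightarrow> r0"
    then have Xd: "\<bar>X i - r0\<bar> < d" "X i \<noteq> r0" for i
      by (auto simp: dist_real_def abs_minus_commute)
    have "(\<lambda>i. \<integral>w. (f (X i) w - f r0 w) / (X i - r0) \<partial>M) \<longlonglongrightarrow> (\<integral>w. f' w \<partial>M)"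
    proof (rule integral_dominated_convergence[where w = B])
      show "(\<lambda>w. (f (X i) w - f r0 w) / (X i - r0)) \<in> borel_measurable M" for i
        using int[OF Xd(1)] int[of r0] d by (intro borel_measurable_divide borel_measurable_diff) auto
      show "AE w in M. (\<lambda>i. (f (X i) w - f r0 w) / (X i - r0)) \<longlonglongrightarrow> f' w"
      proof (rule AE_I2)
        fix w assume "w \<in> space M"
        then have "((\<lambda>r. (f r w - f r0 w) / (r - r0)) \<longlongrightarrow> f' w) (at r0)"
          using deriv by (simp add: has_field_derivative_iff)
        then have "((\<lambda>r. (f r w - f r0 w) / (r - r0)) \<circ> X) \<longlonglongrightarrow> f' w"
          using X Xd unfolding tendsto_at_iff_sequentially by auto
        then show "(\<lambda>i. (f (X i) w - f r0 w) / (X i - r0)) \<longlonglongrightarrow> f' w"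
          by (simp add: comp_def)
      qed
      show "AE w in M. norm ((f (X i) w - f r0 w) / (X i - r0)) \<le> B w" for i
        using bound[OF Xd(1)] Xd(2)[of i] by (intro AE_I2) (simp add: field_simps)
    qed (use f' B in auto)
    moreover have "(\<integral>w. (f (X i) w - f r0 w) / (X i - r0) \<partial>M)
        = ((\<integral>w. f (X i) w \<partial>M) - (\<integral>w. f r0 w \<partial>M)) / (X i - r0)" for i
      using int[OF Xd(1)] int[of r0] d by simp
    ultimately show "((\<lambda>r. ((\<integral>w. f r w \<partial>M) - (\<integral>w. f r0 w \<partial>M)) / (r - r0)) \<circ> X) \<longlonglongrightarrow> (\<integral>w. f' w \<partial>M)"
      by (simp only: comp_def)
  qed
  then show ?thesis
    using d at_within_open[of r0 "ball r0 d"] by (simp add: has_field_derivative_iff)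
qed

text \<open>A class that is closed under sums, products and affine substitutions and, for measurable
  functions, integrable against Gaussians, so that integrability goals reduce to introduction rules.
  The growth is exponential rather than polynomial because translating a Gaussian density by c costs
  a factor of the order exp(|c| |w|).\<close>

definition exp_bounded :: "('a::real_normed_vector \<Rightarrow> real) \<Rightarrow> bool"
  where "exp_bounded f \<longleftrightarrow> (\<exists>C a. C \<ge> 0 \<and> a \<ge> 0 \<and> (\<forall>w. \<bar>f w\<bar> \<le> C * exp (a * norm w)))"

lemma exp_boundedI: "C \<ge> 0 \<Longrightarrow> a \<ge> 0 \<Longrightarrow> (\<And>w. \<bar>f w\<bar> \<le> C * exp (a * norm w)) \<Longrightarrow> exp_bounded f"
  by (auto simp: exp_bounded_def)

lemma exp_bounded_mono:
  assumes "exp_bounded g" "\<And>w. \<bar>f w\<bar> \<le> \<bar>g w\<bar>"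
  shows "exp_bounded f"
  using assms unfolding exp_bounded_def by (meson order_trans)

lemma exp_bounded_const [intro!, simp]: "exp_bounded (\<lambda>_. c)"
  by (rule exp_boundedI[of "\<bar>c\<bar>" 0]) auto

lemma exp_bounded_mult [intro!]:
  assumes "exp_bounded f" "exp_bounded g"
  shows "exp_bounded (\<lambda>w. f w * g w)"
proof -
  obtain C a D b where *: "C \<ge> 0" "a \<ge> 0" "D \<ge> 0" "b \<ge> 0"
    "\<And>w. \<bar>f w\<bar> \<le> C * exp (a * norm w)" "\<And>w. \<bar>g w\<bar> \<le> D * exp (b * norm w)"
    using assms by (auto simp: exp_bounded_def)
  show ?thesis
  proof (rule exp_boundedI[of "C * D" "a + b"])
    fix w
    have "\<bar>f w * g w\<bar> \<le> (C * exp (a * norm w)) * (D * exp (b * norm w))"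
      unfolding abs_mult using * by (intro mult_mono) auto
    then show "\<bar>f w * g w\<bar> \<le> C * D * exp ((a + b) * norm w)"
      by (simp add: exp_add algebra_simps)
  qed (use * in auto)
qed

lemma exp_bounded_add [intro!]:
  assumes "exp_bounded f" "exp_bounded g"
  shows "exp_bounded (\<lambda>w. f w + g w)"
proof -
  obtain C a D b where *: "C \<ge> 0" "a \<ge> 0" "D \<ge> 0" "b \<ge> 0"
    "\<And>w. \<bar>f w\<bar> \<le> C * exp (a * norm w)" "\<And>w. \<bar>g w\<bar> \<le> D * exp (b * norm w)"
    using assms by (auto simp: exp_bounded_def)
  show ?thesis
  proof (rule exp_boundedI[of "C + D" "a + b"])
    fix w
    have "\<bar>f w\<bar> \<le> C * exp ((a + b) * norm w)"
      by (rule order_trans[OF *(5)]) (use * in \<open>auto intro!: mult_left_mono mult_right_mono\<close>)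
    moreover have "\<bar>g w\<bar> \<le> D * exp ((a + b) * norm w)"
      by (rule order_trans[OF *(6)]) (use * in \<open>auto intro!: mult_left_mono mult_right_mono\<close>)
    ultimately show "\<bar>f w + g w\<bar> \<le> (C + D) * exp ((a + b) * norm w)"
      by (auto simp: distrib_right)
  qed (use * in auto)
qed

lemma exp_bounded_uminus [intro!]: "exp_bounded f \<Longrightarrow> exp_bounded (\<lambda>w. - f w)"
  by (auto simp: exp_bounded_def)

lemma exp_bounded_diff [intro!]:
  "exp_bounded f \<Longrightarrow> exp_bounded g \<Longrightarrow> exp_bounded (\<lambda>w. f w - g w)"
  using exp_bounded_add[of f "\<lambda>w. - g w"] by auto

lemma exp_bounded_divide [intro!]: "exp_bounded f \<Longrightarrow> exp_bounded (\<lambda>w. f w / c)"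
  using exp_bounded_mult[OF _ exp_bounded_const[of "1 / c"], of f] by simp

lemma exp_bounded_power [intro!]: "exp_bounded f \<Longrightarrow> exp_bounded (\<lambda>w. f w ^ k)"
  by (induction k) auto

lemma exp_bounded_norm [intro!, simp]: "exp_bounded norm"
  by (rule exp_boundedI[of 1 1]) (auto intro: order_trans[OF _ exp_ge_add_one_self])

lemma exp_bounded_abs [intro!]: "exp_bounded f \<Longrightarrow> exp_bounded (\<lambda>w. \<bar>f w\<bar>)"
  by (auto simp: exp_bounded_def)

lemma exp_bounded_inner [intro!, simp]: "exp_bounded (\<lambda>w. b \<bullet> w)" "exp_bounded (\<lambda>w. w \<bullet> b)"
proof -
  show "exp_bounded (\<lambda>w. b \<bullet> w)"
    by (rule exp_bounded_mono[of "\<lambda>w. norm b * norm w"]) (auto simp: Cauchy_Schwarz_ineq2)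
  then show "exp_bounded (\<lambda>w. w \<bullet> b)" by (simp add: inner_commute)
qed

lemma exp_bounded_affine:
  assumes "exp_bounded h"
  shows "exp_bounded (\<lambda>w. h (x + s *\<^sub>R w))"
proof -
  obtain C a where *: "C \<ge> 0" "a \<ge> 0" "\<And>w. \<bar>h w\<bar> \<le> C * exp (a * norm w)"
    using assms by (auto simp: exp_bounded_def)
  show ?thesis
  proof (rule exp_boundedI[of "C * exp (a * norm x)" "a * \<bar>s\<bar>"])
    fix w
    have "norm (x + s *\<^sub>R w) \<le> norm x + \<bar>s\<bar> * norm w"
      using norm_triangle_ineq[of x "s *\<^sub>R w"] by simp
    then have "a * norm (x + s *\<^sub>R w) \<le> a * norm x + a * \<bar>s\<bar> * norm w"
      using mult_left_mono[OF _ *(2)] by (fastforce simp: algebra_simps)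
    then have "C * exp (a * norm (x + s *\<^sub>R w)) \<le> C * (exp (a * norm x) * exp (a * \<bar>s\<bar> * norm w))"
      using *(1) by (intro mult_left_mono) (auto simp flip: exp_add)
    then show "\<bar>h (x + s *\<^sub>R w)\<bar> \<le> C * exp (a * norm x) * exp (a * \<bar>s\<bar> * norm w)"
      using *(3)[of "x + s *\<^sub>R w"] by simp
  qed (use * in auto)
qed

lemma lipschitz_exp_bounded:
  fixes h :: "'a::real_normed_vector \<Rightarrow> real"
  assumes "\<And>x y. \<bar>h x - h y\<bar> \<le> \<Lambda> * norm (x - y)"
  shows "exp_bounded h"
proof (rule exp_bounded_mono[of "\<lambda>w. \<bar>h 0\<bar> + \<bar>\<Lambda>\<bar> * norm w"])
  fix w :: 'a
  have "\<Lambda> * norm w \<le> \<bar>\<Lambda>\<bar> * norm w" by (intro mult_right_mono) auto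
  then show "\<bar>h w\<bar> \<le> \<bar>\<bar>h 0\<bar> + \<bar>\<Lambda>\<bar> * norm w\<bar>" using assms[of w 0] by auto
qed auto

lemma lipschitz_measurable:
  fixes h :: "'a::real_normed_vector \<Rightarrow> real"
  assumes "\<And>x y. \<bar>h x - h y\<bar> \<le> \<Lambda> * norm (x - y)"
  shows "h \<in> borel_measurable borel"
proof -
  have "\<bar>h x - h y\<bar> \<le> \<bar>\<Lambda>\<bar> * norm (x - y)" for x y
    using assms[of x y] mult_right_mono[OF abs_ge_self[of \<Lambda>] norm_ge_zero[of "x - y"]] by linarith
  then have "continuous_on UNIV h"
    by (intro lipschitz_on_continuous_on[of "\<bar>\<Lambda>\<bar>"] lipschitz_onI) (simp_all only: dist_real_def dist_norm abs_ge_zero)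
  then show ?thesis by (rule borel_measurable_continuous_onI)
qed

section \<open>Standard Gaussian density and integrability\<close>

definition gauss_density :: "'a::euclidean_space \<Rightarrow> real"
  where "gauss_density w = exp (- (norm w)\<^sup>2 / 2) / sqrt ((2 * pi) ^ DIM('a))"

definition std_gauss :: "'a::euclidean_space measure"
  where "std_gauss = density lborel (\<lambda>w. ennreal (gauss_density w))"

lemma gauss_density_nonneg [simp]: "gauss_density w \<ge> 0"
  by (simp add: gauss_density_def)

lemma gauss_density_measurable [measurable]: "gauss_density \<in> borel_measurable borel"
  by (simp add: gauss_density_def[abs_def])

lemma sets_std_gauss [simp, measurable_cong]: "sets std_gauss = sets borel"
  by (simp add: std_gauss_def)

lemma space_std_gauss [simp]: "space std_gauss = UNIV"
  by (simp add: std_gauss_def)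

text \<open>Used with \<sigma> = 1 to obtain total mass one, and with \<sigma> = sqrt 2 to obtain a
  wider Gaussian that dominates exp(a |w|) times the standard density.\<close>

lemma prod_normal_density:
  fixes w :: "'a::euclidean_space"
  shows "(\<Prod>b\<in>Basis. normal_density 0 \<sigma> (w \<bullet> b))
    = exp (- (norm w)\<^sup>2 / (2 * \<sigma>\<^sup>2)) / sqrt ((2 * pi * \<sigma>\<^sup>2) ^ DIM('a))"
proof -
  have "(norm w)\<^sup>2 = (\<Sum>b\<in>Basis. (w \<bullet> b)\<^sup>2)"
    unfolding power2_norm_eq_inner by (subst euclidean_inner) (simp add: power2_eq_square)
  then show ?thesis
    by (simp add: normal_density_def prod.distrib prod_dividef exp_sum[symmetric] real_sqrt_power
        sum_negf sum_divide_distrib)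
qed

lemma nn_integral_prod_normal_density:
  assumes "\<sigma> > 0"
  shows "(\<integral>\<^sup>+(w::'a::euclidean_space). (\<Prod>b\<in>Basis. ennreal (normal_density 0 \<sigma> (w \<bullet> b))) \<partial>lborel) = 1"
proof -
  have "(\<integral>\<^sup>+x. ennreal (normal_density 0 \<sigma> x) \<partial>lborel) = ennreal (\<integral>x. normal_density 0 \<sigma> x \<partial>lborel)"
    using assms by (intro nn_integral_eq_integral) (simp_all add: integrable_normal_density)
  also have "\<dots> = 1" using assms by (simp add: integral_normal_density)
  finally show ?thesis
    by (subst nn_integral_lborel_prod[of "\<lambda>_ x. ennreal (normal_density 0 \<sigma> x)"]) simp_all
qed

lemma prob_space_std_gauss: "prob_space (std_gauss :: 'a::euclidean_space measure)"
proof
  have "(\<integral>\<^sup>+(w::'a). ennreal (gauss_density w) \<partial>lborel)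
      = (\<integral>\<^sup>+(w::'a). (\<Prod>b\<in>Basis. ennreal (normal_density 0 1 (w \<bullet> b))) \<partial>lborel)"
    by (simp add: prod_ennreal prod_normal_density gauss_density_def)
  then show "emeasure std_gauss (space (std_gauss :: 'a measure)) = 1"
    by (simp add: std_gauss_def emeasure_density nn_integral_prod_normal_density)
qed

interpretation std_gauss: prob_space std_gauss
  by (rule prob_space_std_gauss)

lemma integrable_exp_norm_gauss_density:
  "integrable lborel (\<lambda>w::'a::euclidean_space. exp (a * norm w) * gauss_density w)"
proof (rule Bochner_Integration.integrable_bound)
  have "integrable lborel (\<lambda>w::'a. \<Prod>b\<in>Basis. normal_density 0 (sqrt 2) (w \<bullet> b))"
    using nn_integral_prod_normal_density[of "sqrt 2", where ?'a = 'a]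
    by (intro integrableI_nonneg) (auto simp: prod_ennreal prod_nonneg)
  then have "integrable lborel (\<lambda>w::'a. exp (- (norm w)\<^sup>2 / 4) / sqrt ((4 * pi) ^ DIM('a)))"
    by (simp add: prod_normal_density mult.commute)
  then have "integrable lborel (\<lambda>w::'a. sqrt ((4 * pi) ^ DIM('a)) *
      (exp (- (norm w)\<^sup>2 / 4) / sqrt ((4 * pi) ^ DIM('a))))"
    by (rule integrable_mult_right)
  then have "integrable lborel (\<lambda>w::'a. exp (- (norm w)\<^sup>2 / 4))" by simp
  then show "integrable lborel (\<lambda>w::'a. exp (a\<^sup>2) / sqrt ((2 * pi) ^ DIM('a)) * exp (- (norm w)\<^sup>2 / 4))"
    by (rule integrable_mult_right)
  have "exp (a * norm w) * exp (- (norm w)\<^sup>2 / 2) \<le> exp (a\<^sup>2) * exp (- (norm w)\<^sup>2 / 4)" for w :: 'a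
  proof -
    have "0 \<le> (a - norm w / 2)\<^sup>2" by simp
    then show ?thesis by (simp add: power2_diff power_divide flip: exp_add)
  qed
  then show "AE w in lborel. norm (exp (a * norm w) * gauss_density w) \<le>
      norm (exp (a\<^sup>2) / sqrt ((2 * pi) ^ DIM('a)) * exp (- (norm (w::'a))\<^sup>2 / 4))"
    by (intro AE_I2) (simp add: gauss_density_def field_simps)
qed measurable

lemma integrable_gauss_density:
  fixes f :: "'a::euclidean_space \<Rightarrow> real"
  assumes [measurable]: "f \<in> borel_measurable borel" and "exp_bounded f"
  shows "integrable lborel (\<lambda>w. f w * gauss_density w)"
proof -
  obtain C a where *: "C \<ge> 0" "a \<ge> 0" "\<And>w. \<bar>f w\<bar> \<le> C * exp (a * norm w)"
    using assms by (auto simp: exp_bounded_def)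
  show ?thesis
  proof (rule Bochner_Integration.integrable_bound)
    show "integrable lborel (\<lambda>w::'a. C * (exp (a * norm w) * gauss_density w))"
      by (intro integrable_mult_right integrable_exp_norm_gauss_density)
    show "AE w in lborel. norm (f w * gauss_density w) \<le> norm (C * (exp (a * norm w) * gauss_density w))"
      using * by (intro AE_I2) (auto simp: abs_mult mult.assoc[symmetric] intro!: mult_right_mono)
  qed measurable
qed

lemma integrable_std_gauss:
  fixes f :: "'a::euclidean_space \<Rightarrow> real"
  assumes [measurable]: "f \<in> borel_measurable borel" and "exp_bounded f"
  shows "integrable std_gauss f"
  unfolding std_gauss_def using integrable_gauss_density[OF assms]
  by (subst integrable_real_density) (auto simp: mult.commute)

lemma integral_std_gauss:
  fixes f :: "'a::euclidean_space \<Rightarrow> real"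
  assumes [measurable]: "f \<in> borel_measurable borel"
  shows "(\<integral>w. f w \<partial>std_gauss) = (\<integral>w. f w * gauss_density w \<partial>lborel)"
  unfolding std_gauss_def by (subst integral_real_density) (auto simp: mult.commute)

lemma lborel_integral_translation:
  fixes f :: "'a::euclidean_space \<Rightarrow> real"
  assumes [measurable]: "f \<in> borel_measurable borel"
  shows "(\<integral>x. f (t + x) \<partial>lborel) = (\<integral>x. f x \<partial>lborel)"
proof -
  have "lborel = distr lborel borel (\<lambda>x::'a. t + x)"
    using lborel_affine[of 1 t] by (simp add: density_1)
  then have "(\<integral>x. f x \<partial>lborel) = (\<integral>x. f x \<partial>distr lborel borel (\<lambda>x::'a. t + x))" by simp
  also have "\<dots> = (\<integral>x. f (t + x) \<partial>lborel)" by (rule integral_distr) auto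
  finally show ?thesis by simp
qed

text \<open>Translation moves the shift to the density, so no regularity of \<open>u\<close> is needed.\<close>

lemma gauss_shift_derivative:
  fixes u q q' :: "'a::euclidean_space \<Rightarrow> real"
  assumes [measurable]: "u \<in> borel_measurable borel" "q \<in> borel_measurable borel" "q' \<in> borel_measurable borel"
    and eb: "exp_bounded u" "exp_bounded q" "exp_bounded q'"
    and q': "\<And>w. ((\<lambda>r. q (w + r *\<^sub>R c)) has_real_derivative q' w) (at 0)"
  shows "((\<lambda>r. \<integral>w. u (w + r *\<^sub>R c) * q w \<partial>std_gauss) has_real_derivative
    (\<integral>w. u w * ((c \<bullet> w) * q w - q' w) \<partial>std_gauss)) (at 0)"
proof -
  define k where "k w = (c \<bullet> w) * q w - q' w" for w
  define f where "f r w = u w * (q (w - r *\<^sub>R c) * gauss_density (w - r *\<^sub>R c))" for r w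
  have [measurable]: "k \<in> borel_measurable borel" unfolding k_def by measurable
  have [measurable]: "f r \<in> borel_measurable borel" for r unfolding f_def by measurable
  have kb: "exp_bounded k" unfolding k_def using eb by auto
  have shift: "(\<integral>w. u (w + r *\<^sub>R c) * q w \<partial>std_gauss) = (\<integral>w. f r w \<partial>lborel)" for r
  proof -
    have "(\<integral>w. u (w + r *\<^sub>R c) * q w \<partial>std_gauss) = (\<integral>w. f r (r *\<^sub>R c + w) \<partial>lborel)"
      by (subst integral_std_gauss) (auto simp: f_def ac_simps)
    also have "\<dots> = (\<integral>w. f r w \<partial>lborel)"
      by (rule lborel_integral_translation) simp
    finally show ?thesis .
  qed
  have q'_at: "((\<lambda>r. q (w - r *\<^sub>R c)) has_real_derivative - q' (w - r *\<^sub>R c)) (at r)" for w r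
  proof -
    have "((\<lambda>s. - s + r) has_real_derivative - 1) (at r)" by (auto intro!: derivative_eq_intros)
    moreover have "((\<lambda>s. q ((w - r *\<^sub>R c) + s *\<^sub>R c)) has_real_derivative q' (w - r *\<^sub>R c)) (at (- r + r))"
      using q' by simp
    ultimately have "((\<lambda>s. q ((w - r *\<^sub>R c) + (- s + r) *\<^sub>R c)) has_real_derivative
        q' (w - r *\<^sub>R c) * (-1)) (at r)"
      by (rule DERIV_chain2[rotated])
    then show ?thesis by (simp add: algebra_simps)
  qed
  have norm_expand: "(norm (w - r *\<^sub>R c))\<^sup>2 = (norm w)\<^sup>2 - 2 * r * (c \<bullet> w) + r\<^sup>2 * (norm c)\<^sup>2" for w and r :: real
    unfolding power2_norm_eq_inner
    by (simp add: inner_diff_left inner_diff_right inner_commute algebra_simps power2_eq_square)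
  have g'_at: "((\<lambda>r. gauss_density (w - r *\<^sub>R c)) has_real_derivative
      (c \<bullet> (w - r *\<^sub>R c)) * gauss_density (w - r *\<^sub>R c)) (at r)" for w :: 'a and r
  proof -
    define N where "N = sqrt ((2 * pi) ^ DIM('a))"
    have N: "N \<noteq> 0" by (simp add: N_def)
    have gd: "gauss_density z = exp (- (norm z)\<^sup>2 / 2) / N" for z :: 'a
      by (simp add: gauss_density_def N_def)
    show ?thesis
      unfolding gd norm_expand using N
      by (auto intro!: derivative_eq_intros simp: inner_diff_right power2_norm_eq_inner algebra_simps diff_divide_distrib)
  qed
  have f'_at: "((\<lambda>r. f r w) has_real_derivative
      u w * (k (w - r *\<^sub>R c) * gauss_density (w - r *\<^sub>R c))) (at r)" for w r
    unfolding f_def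
    by (rule derivative_eq_intros q'_at g'_at refl)+ (simp add: k_def algebra_simps)
  obtain C a where ka: "C \<ge> 0" "a \<ge> 0" "\<And>w. \<bar>k w\<bar> \<le> C * exp (a * norm w)"
    using kb by (auto simp: exp_bounded_def)
  \<comment> \<open>\<open>a * norm c\<close> pays for the shift inside \<open>k\<close>, and
    \<open>norm c * norm w\<close> for the cross term \<open>r * (c \<bullet> w)\<close> in the
    exponent of the shifted density; both estimates hold for |r| < 1.\<close>
  define B where "B w = \<bar>u w\<bar> * (C * exp (a * norm c) * exp ((a + norm c) * norm w)) * gauss_density w" for w
  have k_bound: "\<bar>u w * (k (w - r *\<^sub>R c) * gauss_density (w - r *\<^sub>R c))\<bar> \<le> B w" if r: "\<bar>r\<bar> < 1" for w r
  proof -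
    have "norm (w - r *\<^sub>R c) \<le> norm w + norm c"
      using norm_triangle_ineq4[of w "r *\<^sub>R c"] mult_right_mono[of "\<bar>r\<bar>" 1 "norm c"] r by simp
    then have "a * norm (w - r *\<^sub>R c) \<le> a * norm c + a * norm w"
      using mult_left_mono[OF _ ka(2)] by (fastforce simp: algebra_simps)
    then have 1: "\<bar>k (w - r *\<^sub>R c)\<bar> \<le> C * exp (a * norm c + a * norm w)"
      using ka by (meson exp_le_cancel_iff mult_left_mono order_trans)
    have "r * (c \<bullet> w) \<le> \<bar>r\<bar> * (norm c * norm w)"
      using Cauchy_Schwarz_ineq2[of c w] by (metis abs_ge_self abs_ge_zero abs_mult mult_left_mono order_trans)
    also have "\<dots> \<le> norm c * norm w" using r by (intro mult_left_le_one_le) auto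
    finally have "r * (c \<bullet> w) \<le> norm c * norm w" .
    moreover have "0 \<le> r\<^sup>2 * (norm c)\<^sup>2" by simp
    ultimately have "- (norm (w - r *\<^sub>R c))\<^sup>2 / 2 \<le> norm c * norm w + - (norm w)\<^sup>2 / 2"
      unfolding norm_expand by argo
    then have "exp (- (norm (w - r *\<^sub>R c))\<^sup>2 / 2) \<le> exp (norm c * norm w) * exp (- (norm w)\<^sup>2 / 2)"
      unfolding exp_add[symmetric] by (simp only: exp_le_cancel_iff)
    then have 2: "gauss_density (w - r *\<^sub>R c) \<le> exp (norm c * norm w) * gauss_density w"
      unfolding gauss_density_def times_divide_eq_right by (rule divide_right_mono) simp
    have "\<bar>u w * (k (w - r *\<^sub>R c) * gauss_density (w - r *\<^sub>R c))\<bar>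
        \<le> \<bar>u w\<bar> * ((C * exp (a * norm c + a * norm w)) * (exp (norm c * norm w) * gauss_density w))"
      unfolding abs_mult using 1 2 ka
      by (intro mult_left_mono mult_mono) auto
    also have "\<dots> = B w" by (simp add: B_def exp_add algebra_simps)
    finally show ?thesis .
  qed
  have "exp_bounded (\<lambda>w::'a. exp ((a + norm c) * norm w))"
    by (rule exp_boundedI[of 1 "a + norm c"]) (use ka in auto)
  then have B: "integrable lborel B"
    unfolding B_def using eb by (intro integrable_gauss_density exp_bounded_mult exp_bounded_abs) auto
  have "((\<lambda>r. \<integral>w. f r w \<partial>lborel) has_real_derivative (\<integral>w. u w * (k w * gauss_density w) \<partial>lborel)) (at 0)"
  proof (rule has_real_derivative_integral[where d = 1 and B = B])
    have diff: "\<bar>f r w - f 0 w\<bar> \<le> \<bar>r - 0\<bar> * B w" if r: "\<bar>r - 0\<bar> < 1" for r w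
    proof -
      have "norm (f r w - f 0 w) \<le> B w * norm (r - 0)"
      proof (rule field_differentiable_bound[where S = "{-1<..<1}"])
        show "((\<lambda>r. f r w) has_field_derivative u w * (k (w - z *\<^sub>R c) * gauss_density (w - z *\<^sub>R c)))
            (at z within {-1<..<1})" for z
          using f'_at by (rule has_field_derivative_at_within)
        show "norm (u w * (k (w - z *\<^sub>R c) * gauss_density (w - z *\<^sub>R c))) \<le> B w" if "z \<in> {-1<..<1}" for z
          using k_bound[of z w] that by (simp add: abs_less_iff)
      qed (use r in auto)
      then show ?thesis by (simp add: mult.commute)
    qed
    then show "\<bar>f r w - f 0 w\<bar> \<le> \<bar>r - 0\<bar> * B w" if "\<bar>r - 0\<bar> < 1" for r w using that by blast
    have f0: "integrable lborel (f 0)"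
    proof -
      have "f 0 = (\<lambda>w. u w * q w * gauss_density w)" by (simp add: f_def fun_eq_iff)
      then show ?thesis using eb integrable_gauss_density[of "\<lambda>w. u w * q w"] by auto
    qed
    show "integrable lborel (f r)" if r: "\<bar>r - 0\<bar> < 1" for r
    proof (rule Bochner_Integration.integrable_bound)
      show "integrable lborel (\<lambda>w. \<bar>f 0 w\<bar> + B w)" using f0 B by simp
      have B0: "B w \<ge> 0" for w unfolding B_def using ka by auto
      have "\<bar>r - 0\<bar> * B w \<le> B w" for w using r B0 by (intro mult_left_le_one_le) auto
      then have "\<bar>f r w\<bar> \<le> \<bar>\<bar>f 0 w\<bar> + B w\<bar>" for w
        using diff[OF r, of w] B0[of w] by (smt (verit))
      then show "AE w in lborel. norm (f r w) \<le> norm (\<bar>f 0 w\<bar> + B w)" by simp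
    qed simp
    show "((\<lambda>r. f r w) has_real_derivative u w * (k w * gauss_density w)) (at 0)" for w
      using f'_at[of w 0] by simp
  qed (use B in auto)
  also have "(\<integral>w. u w * (k w * gauss_density w) \<partial>lborel) = (\<integral>w. u w * k w \<partial>std_gauss)"
    by (subst integral_std_gauss) (auto simp: mult.assoc)
  finally show ?thesis unfolding shift[symmetric] by (simp add: k_def)
qed

text \<open>Both sides are the derivative at r = 0 of the integral of u(w + r c) q(w): the right
  side after moving the shift to the density, the left side by differentiating \<open>u\<close>,
  where the Lipschitz bound along \<open>c\<close> gives the domination. In this form no boundary
  terms arise.\<close>

lemma gauss_integration_by_parts:
  fixes u u' q q' :: "'a::euclidean_space \<Rightarrow> real"
  assumes meas: "u \<in> borel_measurable borel" "u' \<in> borel_measurable borel"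
      "q \<in> borel_measurable borel" "q' \<in> borel_measurable borel"
    and eb: "exp_bounded u" "exp_bounded q" "exp_bounded q'"
    and u': "\<And>w. ((\<lambda>r. u (w + r *\<^sub>R c)) has_real_derivative u' w) (at 0)"
    and lip: "\<And>w r. \<bar>u (w + r *\<^sub>R c) - u w\<bar> \<le> \<bar>r\<bar> * \<Lambda>"
    and q': "\<And>w. ((\<lambda>r. q (w + r *\<^sub>R c)) has_real_derivative q' w) (at 0)"
  shows "(\<integral>w. u' w * q w \<partial>std_gauss) = (\<integral>w. u w * ((c \<bullet> w) * q w - q' w) \<partial>std_gauss)"
proof (rule DERIV_unique)
  note [measurable] = meas
  show "((\<lambda>r. \<integral>w. u (w + r *\<^sub>R c) * q w \<partial>std_gauss) has_real_derivative
    (\<integral>w. u w * ((c \<bullet> w) * q w - q' w) \<partial>std_gauss)) (at 0)"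
    by (rule gauss_shift_derivative) (use assms in auto)
  show "((\<lambda>r. \<integral>w. u (w + r *\<^sub>R c) * q w \<partial>std_gauss) has_real_derivative
    (\<integral>w. u' w * q w \<partial>std_gauss)) (at 0)"
  proof (rule has_real_derivative_integral[where d = 1 and B = "\<lambda>w. \<Lambda> * \<bar>q w\<bar>"])
    show "integrable std_gauss (\<lambda>w. u (w + r *\<^sub>R c) * q w)" for r
      using exp_bounded_affine[OF eb(1), of "r *\<^sub>R c" 1] eb
      by (intro integrable_std_gauss exp_bounded_mult) (auto simp: add.commute)
    show "integrable std_gauss (\<lambda>w. \<Lambda> * \<bar>q w\<bar>)"
      using eb by (intro integrable_std_gauss exp_bounded_mult exp_bounded_abs) auto
    show "((\<lambda>r. u (w + r *\<^sub>R c) * q w) has_real_derivative u' w * q w) (at 0)" for w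
      using u' by (rule DERIV_cmult_right)
    have "\<bar>(u (w + r *\<^sub>R c) - u w) * q w\<bar> \<le> (\<bar>r\<bar> * \<Lambda>) * \<bar>q w\<bar>" for r w
      unfolding abs_mult using lip by (intro mult_right_mono) auto
    then show "\<bar>u (w + r *\<^sub>R c) * q w - u (w + 0 *\<^sub>R c) * q w\<bar> \<le> \<bar>r - 0\<bar> * (\<Lambda> * \<bar>q w\<bar>)" for r w
      by (simp add: algebra_simps)
  qed auto
qed

text \<open>Integration by parts with constant \<open>u\<close>, that is, Stein's identity for the
  Gaussian. Compared with the integrand on the left, a polynomial loses two degrees, which yields
  the moments below recursively.\<close>

lemma gauss_moment_step:
  fixes q q' :: "'a::euclidean_space \<Rightarrow> real"
  assumes "q \<in> borel_measurable borel" "q' \<in> borel_measurable borel" "exp_bounded q" "exp_bounded q'"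
    and "\<And>w. ((\<lambda>r. q (w + r *\<^sub>R c)) has_real_derivative q' w) (at 0)"
  shows "(\<integral>w. (c \<bullet> w) * q w \<partial>std_gauss) = (\<integral>w. q' w \<partial>std_gauss)"
proof -
  note [measurable] = assms(1,2)
  have "(\<integral>w. 0 * q w \<partial>std_gauss) = (\<integral>w. 1 * ((c \<bullet> w) * q w - q' w) \<partial>std_gauss)"
    by (rule gauss_integration_by_parts[where \<Lambda> = 0]) (use assms in auto)
  moreover have "(\<integral>w. (c \<bullet> w) * q w - q' w \<partial>std_gauss)
      = (\<integral>w. (c \<bullet> w) * q w \<partial>std_gauss) - (\<integral>w. q' w \<partial>std_gauss)"
    using assms by (intro Bochner_Integration.integral_diff integrable_std_gauss exp_bounded_mult) auto
  ultimately show ?thesis by simp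
qed

lemma gauss_moment_1: "(\<integral>w. c \<bullet> w \<partial>std_gauss) = (0::real)" for c :: "'a::euclidean_space"
proof -
  have "(\<integral>w. (c \<bullet> w) * 1 \<partial>std_gauss) = (\<integral>w. (0::real) \<partial>(std_gauss :: 'a measure))"
    by (rule gauss_moment_step[of "\<lambda>_. 1" "\<lambda>_. 0" c]) auto
  then show ?thesis by simp
qed

lemma gauss_moment_2: "(\<integral>w. (c \<bullet> w) * (b \<bullet> w) \<partial>std_gauss) = c \<bullet> b" for b c :: "'a::euclidean_space"
proof -
  have "((\<lambda>r. b \<bullet> (w + r *\<^sub>R c)) has_real_derivative b \<bullet> c) (at 0)" for w
    by (auto intro!: derivative_eq_intros simp: inner_add_right)
  from gauss_moment_step[OF _ _ _ _ this] show ?thesis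
    by (simp add: inner_commute std_gauss.prob_space[simplified])
qed

lemma gauss_moment_4: "(\<integral>w. (b \<bullet> w) ^ 4 \<partial>std_gauss) = 3 * (norm b) ^ 4" for b :: "'a::euclidean_space"
proof -
  have "((\<lambda>r. (b \<bullet> (w + r *\<^sub>R b)) ^ 3) has_real_derivative 3 * (b \<bullet> w)\<^sup>2 * (b \<bullet> b)) (at 0)" for w
    by (auto intro!: derivative_eq_intros simp: inner_add_right)
  then have "(\<integral>w. (b \<bullet> w) * (b \<bullet> w) ^ 3 \<partial>std_gauss) = (\<integral>w. 3 * (b \<bullet> w)\<^sup>2 * (b \<bullet> b) \<partial>std_gauss)"
    by (intro gauss_moment_step) auto
  also have "\<dots> = 3 * (b \<bullet> b) * (b \<bullet> b)"
    using gauss_moment_2[of b b] by (simp add: power2_eq_square)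
  finally show ?thesis
    by (simp add: power4_eq_xxxx power3_eq_cube mult.assoc dot_square_norm power2_eq_square)
qed

text \<open>Integrates |t| <= t^2 / (2 n) + n / 2 with n = norm b, the choice of n for which the
  result equals that of Cauchy-Schwarz.\<close>

lemma gauss_abs_moment: "(\<integral>w. \<bar>b \<bullet> w\<bar> \<partial>std_gauss) \<le> norm b" for b :: "'a::euclidean_space"
proof (cases "b = 0")
  case False
  have sq: "integrable std_gauss (\<lambda>w. (b \<bullet> w)\<^sup>2)" by (intro integrable_std_gauss) auto
  have "(\<integral>w. \<bar>b \<bullet> w\<bar> \<partial>std_gauss) \<le> (\<integral>w. (b \<bullet> w)\<^sup>2 / (2 * norm b) + norm b / 2 \<partial>std_gauss)"
  proof (intro integral_mono integrable_std_gauss)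
    fix w
    have "0 \<le> (\<bar>b \<bullet> w\<bar> - norm b)\<^sup>2" by simp
    then have "2 * norm b * \<bar>b \<bullet> w\<bar> \<le> (b \<bullet> w)\<^sup>2 + (norm b)\<^sup>2"
      by (simp add: power2_diff algebra_simps)
    then show "\<bar>b \<bullet> w\<bar> \<le> (b \<bullet> w)\<^sup>2 / (2 * norm b) + norm b / 2"
      using False by (simp add: divide_simps power2_eq_square algebra_simps)
  qed auto
  also have "\<dots> = (\<integral>w. (b \<bullet> w)\<^sup>2 \<partial>std_gauss) / (2 * norm b) + norm b / 2"
    using sq by (simp add: std_gauss.prob_space[simplified])
  also have "\<dots> = norm b"
    using False gauss_moment_2[of b b] by (simp add: power2_eq_square dot_square_norm[unfolded power2_eq_square])
  finally show ?thesis .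
qed simp

text \<open>The pointwise bound \<open>\<bar>v - 1\<bar> \<le> v - 1 + 2 (1 - v / 3)\<^sup>2\<close> for \<open>v \<ge> 0\<close>
  gives the constant \<open>4/3\<close>, where Cauchy-Schwarz would only give \<open>sqrt 2\<close>. With fully independent
  summands \<open>sqrt 2\<close> is too large for the final bound.\<close>

lemma gauss_hermite2_diag: "(\<integral>w. \<bar>(b \<bullet> w)\<^sup>2 - (norm b)\<^sup>2\<bar> \<partial>std_gauss) \<le> 4/3 * (norm b)\<^sup>2"
  for b :: "'a::euclidean_space"
proof (cases "b = 0")
  case False
  have sq: "integrable std_gauss (\<lambda>w. (b \<bullet> w)\<^sup>2)" by (intro integrable_std_gauss) auto
  have qu: "integrable std_gauss (\<lambda>w. (b \<bullet> w) ^ 4)" by (intro integrable_std_gauss) auto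
  define n where "n = (norm b)\<^sup>2"
  have n: "n > 0" using False by (simp add: n_def)
  have "(\<integral>w. \<bar>(b \<bullet> w)\<^sup>2 - n\<bar> \<partial>std_gauss) \<le> (\<integral>w. n + (- 1 / 3) * (b \<bullet> w)\<^sup>2 + 2 / (9 * n) * (b \<bullet> w) ^ 4 \<partial>std_gauss)"
  proof (intro integral_mono integrable_std_gauss)
    fix w
    define v where "v = (b \<bullet> w)\<^sup>2"
    have v: "v \<ge> 0" by (simp add: v_def)
    have "\<bar>v - n\<bar> \<le> n + (- 1 / 3) * v + 2 / (9 * n) * v\<^sup>2"
    proof (cases "v \<le> n")
      case True
      have "n + (- 1 / 3) * v + 2 / (9 * n) * v\<^sup>2 - (n - v) = 2 / 3 * v + 2 / (9 * n) * v\<^sup>2" by simp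
      also have "\<dots> \<ge> 0" using v n by simp
      finally show ?thesis using True by simp
    next
      case c: False
      have "n + (- 1 / 3) * v + 2 / (9 * n) * v\<^sup>2 - (v - n) = 2 / n * (n - v / 3)\<^sup>2"
        using n by (simp add: power2_eq_square field_simps)
      also have "\<dots> \<ge> 0" using n by simp
      finally show ?thesis using c by simp
    qed
    moreover have "v\<^sup>2 = (b \<bullet> w) ^ 4" by (simp add: v_def)
    ultimately show "\<bar>(b \<bullet> w)\<^sup>2 - n\<bar> \<le> n + (- 1 / 3) * (b \<bullet> w)\<^sup>2 + 2 / (9 * n) * (b \<bullet> w) ^ 4"
      by (simp add: v_def)
  qed auto
  also have "\<dots> = n + (- 1 / 3) * (\<integral>w. (b \<bullet> w)\<^sup>2 \<partial>std_gauss) + 2 / (9 * n) * (\<integral>w. (b \<bullet> w) ^ 4 \<partial>std_gauss)"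
    using sq qu by (simp add: std_gauss.prob_space[simplified])
  also have "(\<integral>w. (b \<bullet> w)\<^sup>2 \<partial>std_gauss) = n"
    using gauss_moment_2[of b b] by (simp add: n_def power2_eq_square dot_square_norm[unfolded power2_eq_square])
  also have "(\<integral>w. (b \<bullet> w) ^ 4 \<partial>std_gauss) = 3 * n\<^sup>2"
    by (simp add: gauss_moment_4 n_def flip: power_mult)
  also have "n + (- 1 / 3) * n + 2 / (9 * n) * (3 * n\<^sup>2) = 4/3 * n"
    using n by (simp add: power2_eq_square)
  finally show ?thesis by (simp add: n_def)
qed simp

text \<open>Polarization reduces to the diagonal case. The vectors are normalized first: for unit
  vectors |x + y|^2 + |x - y|^2 = 4, so the constant 4/3 survives, while polarizing vectors of
  different lengths would replace the product of the norms by half the sum of their squares.\<close>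

lemma gauss_hermite2: "(\<integral>w. \<bar>(b \<bullet> w) * (c \<bullet> w) - b \<bullet> c\<bar> \<partial>std_gauss) \<le> 4/3 * norm b * norm c"
  for b c :: "'a::euclidean_space"
proof (cases "b = 0 \<or> c = 0")
  case False
  have int: "integrable std_gauss (\<lambda>w. \<bar>(x \<bullet> w)\<^sup>2 - (norm x)\<^sup>2\<bar>)" for x :: 'a
    by (intro integrable_std_gauss exp_bounded_abs) auto
  have abs_tri: "\<bar>p / 4 - q / 4\<bar> \<le> \<bar>p\<bar> / 4 + \<bar>q\<bar> / 4" for p q :: real by auto
  have unit: "(\<integral>w. \<bar>(x \<bullet> w) * (y \<bullet> w) - x \<bullet> y\<bar> \<partial>std_gauss) \<le> 4/3"
    if "norm x = 1" "norm y = 1" for x y :: 'a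
  proof -
    have "(\<integral>w. \<bar>(x \<bullet> w) * (y \<bullet> w) - x \<bullet> y\<bar> \<partial>std_gauss) \<le>
      (\<integral>w. \<bar>((x + y) \<bullet> w)\<^sup>2 - (norm (x + y))\<^sup>2\<bar> / 4 + \<bar>((x - y) \<bullet> w)\<^sup>2 - (norm (x - y))\<^sup>2\<bar> / 4 \<partial>std_gauss)"
    proof (intro integral_mono)
      fix w
      have "(x \<bullet> w) * (y \<bullet> w) - x \<bullet> y = (((x + y) \<bullet> w)\<^sup>2 - (norm (x + y))\<^sup>2) / 4
          - (((x - y) \<bullet> w)\<^sup>2 - (norm (x - y))\<^sup>2) / 4"
        unfolding power2_norm_eq_inner
        by (simp add: inner_add_left inner_add_right inner_diff_left inner_diff_right
            power2_eq_square inner_commute field_simps)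
      then show "\<bar>(x \<bullet> w) * (y \<bullet> w) - x \<bullet> y\<bar> \<le> \<bar>((x + y) \<bullet> w)\<^sup>2 - (norm (x + y))\<^sup>2\<bar> / 4
          + \<bar>((x - y) \<bullet> w)\<^sup>2 - (norm (x - y))\<^sup>2\<bar> / 4"
        using abs_tri[of "((x + y) \<bullet> w)\<^sup>2 - (norm (x + y))\<^sup>2" "((x - y) \<bullet> w)\<^sup>2 - (norm (x - y))\<^sup>2"]
        by (simp only:)
    qed (use int in \<open>auto intro!: integrable_std_gauss exp_bounded_abs\<close>)
    also have "\<dots> \<le> (4/3 * (norm (x + y))\<^sup>2) / 4 + (4/3 * (norm (x - y))\<^sup>2) / 4"
      using int gauss_hermite2_diag[of "x + y"] gauss_hermite2_diag[of "x - y"] by simp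
    also have "\<dots> = (norm x)\<^sup>2 * 2 / 3 + (norm y)\<^sup>2 * 2 / 3"
      unfolding power2_norm_eq_inner
      by (simp add: inner_add_left inner_add_right inner_diff_left inner_diff_right
            inner_commute field_simps)
    finally show ?thesis using that by simp
  qed
  let ?x = "b /\<^sub>R norm b" and ?y = "c /\<^sub>R norm c"
  have "(\<integral>w. \<bar>(b \<bullet> w) * (c \<bullet> w) - b \<bullet> c\<bar> \<partial>std_gauss)
      = (\<integral>w. (norm b * norm c) * \<bar>(?x \<bullet> w) * (?y \<bullet> w) - ?x \<bullet> ?y\<bar> \<partial>std_gauss)"
  proof (intro Bochner_Integration.integral_cong refl)
    fix w
    have "(b \<bullet> w) * (c \<bullet> w) - b \<bullet> c = (norm b * norm c) * ((?x \<bullet> w) * (?y \<bullet> w) - ?x \<bullet> ?y)"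
      using False by (simp add: field_simps)
    then show "\<bar>(b \<bullet> w) * (c \<bullet> w) - b \<bullet> c\<bar> = (norm b * norm c) * \<bar>(?x \<bullet> w) * (?y \<bullet> w) - ?x \<bullet> ?y\<bar>"
      by (simp only: abs_mult abs_norm_cancel)
  qed
  also have "\<dots> \<le> (norm b * norm c) * (4/3)"
    using unit[of ?x ?y] False by (subst integral_mult_right_zero) (intro mult_left_mono, auto)
  finally show ?thesis by simp
qed auto

section \<open>Gaussian smoothing of Lipschitz functions\<close>

definition gauss_smooth :: "real \<Rightarrow> ('a::euclidean_space \<Rightarrow> real) \<Rightarrow> 'a \<Rightarrow> real"
  where "gauss_smooth s h x = (\<integral>w. h (x + s *\<^sub>R w) \<partial>std_gauss)"

text \<open>The derivatives of \<open>gauss_smooth s h\<close> at \<open>x\<close>, with the differentiation moved to the density;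
  \<open>h\<close> need not be differentiable.\<close>

definition gauss_D1 :: "real \<Rightarrow> ('a::euclidean_space \<Rightarrow> real) \<Rightarrow> 'a \<Rightarrow> 'a \<Rightarrow> real"
  where "gauss_D1 s h x b = (\<integral>w. h (x + s *\<^sub>R w) * (b \<bullet> w) \<partial>std_gauss) / s"

definition gauss_D2 :: "real \<Rightarrow> ('a::euclidean_space \<Rightarrow> real) \<Rightarrow> 'a \<Rightarrow> 'a \<Rightarrow> 'a \<Rightarrow> real"
  where "gauss_D2 s h x b c = (\<integral>w. h (x + s *\<^sub>R w) * ((b \<bullet> w) * (c \<bullet> w) - b \<bullet> c) \<partial>std_gauss) / s\<^sup>2"

lemma norm_moment_2: "(\<integral>w. (norm w)\<^sup>2 \<partial>(std_gauss :: 'a::euclidean_space measure)) = DIM('a)"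
proof -
  have "(\<integral>w. (norm w)\<^sup>2 \<partial>(std_gauss :: 'a measure))
      = (\<integral>w. (\<Sum>b\<in>Basis. (b \<bullet> w) * (b \<bullet> w)) \<partial>(std_gauss :: 'a measure))"
    unfolding power2_norm_eq_inner by (subst euclidean_inner) (simp add: inner_commute)
  also have "\<dots> = (\<Sum>b\<in>Basis. (\<integral>w. (b \<bullet> w) * (b \<bullet> w) \<partial>(std_gauss :: 'a measure)))"
    by (intro Bochner_Integration.integral_sum integrable_std_gauss) auto
  also have "\<dots> = DIM('a)"
    by (simp add: gauss_moment_2)
  finally show ?thesis .
qed

locale lipschitz_function =
  fixes h :: "'a::euclidean_space \<Rightarrow> real" and \<Lambda> :: real
  assumes lipschitz: "\<bar>h x - h y\<bar> \<le> \<Lambda> * norm (x - y)"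
begin

lemma measurable_h [measurable]: "h \<in> borel_measurable borel"
  using lipschitz_measurable[OF lipschitz] .

lemma exp_bounded_h: "exp_bounded (\<lambda>w. h (x + s *\<^sub>R w))"
  by (intro exp_bounded_affine lipschitz_exp_bounded[OF lipschitz])

lemma \<Lambda>_nonneg: "\<Lambda> \<ge> 0"
proof -
  obtain b :: 'a where "b \<in> Basis" using nonempty_Basis by blast
  then have "0 \<le> \<Lambda> * norm (b - 0)" using lipschitz[of b 0] by linarith
  with \<open>b \<in> Basis\<close> show ?thesis by simp
qed

lemma integrable_h: "integrable std_gauss (\<lambda>w. h (x + s *\<^sub>R w))"
  by (intro integrable_std_gauss exp_bounded_h) simp

lemma integrable_h_mult:
  "q \<in> borel_measurable borel \<Longrightarrow> exp_bounded q \<Longrightarrow> integrable std_gauss (\<lambda>w. h (x + s *\<^sub>R w) * q w)"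
  by (intro integrable_std_gauss exp_bounded_mult exp_bounded_h) auto

lemma gauss_smooth_lipschitz: "\<bar>gauss_smooth s h x - gauss_smooth s h y\<bar> \<le> \<Lambda> * norm (x - y)"
proof -
  have "\<bar>gauss_smooth s h x - gauss_smooth s h y\<bar> = \<bar>\<integral>w. h (x + s *\<^sub>R w) - h (y + s *\<^sub>R w) \<partial>std_gauss\<bar>"
    unfolding gauss_smooth_def by (subst Bochner_Integration.integral_diff) (auto intro: integrable_h)
  also have "\<dots> \<le> (\<integral>w. \<bar>h (x + s *\<^sub>R w) - h (y + s *\<^sub>R w)\<bar> \<partial>std_gauss)"
    by (rule integral_abs_bound)
  also have "\<dots> \<le> (\<integral>w. \<Lambda> * norm (x - y) \<partial>(std_gauss :: 'a measure))"
    using lipschitz by (intro integral_mono integrable_abs Bochner_Integration.integrable_diff integrable_h)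
      (auto, metis add_diff_cancel_right)
  finally show ?thesis by (simp add: std_gauss.prob_space[simplified])
qed

lemma gauss_smooth_derivative:
  assumes "s \<noteq> 0"
  shows "((\<lambda>r. gauss_smooth s h (x + r *\<^sub>R b)) has_real_derivative gauss_D1 s h x b) (at 0)"
proof -
  \<comment> \<open>Shifting \<open>x\<close> by r b is the same as shifting the Gaussian variable
    by r b / s; this is the origin of the factor 1 / s in each derivative.\<close>
  have "((\<lambda>r. \<integral>w. h (x + s *\<^sub>R (w + r *\<^sub>R (b /\<^sub>R s))) * 1 \<partial>std_gauss) has_real_derivative
    (\<integral>w. h (x + s *\<^sub>R w) * (((b /\<^sub>R s) \<bullet> w) * 1 - 0) \<partial>std_gauss)) (at 0)"
    by (rule gauss_shift_derivative[of "\<lambda>w. h (x + s *\<^sub>R w)" "\<lambda>_. 1" "\<lambda>_. 0"]) (auto intro: exp_bounded_h)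
  moreover have "s *\<^sub>R (w + r *\<^sub>R (b /\<^sub>R s)) = r *\<^sub>R b + s *\<^sub>R w" for r w
    using assms by (simp add: scaleR_add_right add.commute)
  ultimately show ?thesis
    by (simp add: gauss_smooth_def gauss_D1_def add.assoc divide_inverse ac_simps
        flip: integral_mult_right_zero)
qed

lemma gauss_D1_derivative:
  assumes "s \<noteq> 0"
  shows "((\<lambda>r. gauss_D1 s h (x + r *\<^sub>R c) b) has_real_derivative gauss_D2 s h x b c) (at 0)"
proof -
  have "((\<lambda>r. \<integral>w. h (x + s *\<^sub>R (w + r *\<^sub>R (c /\<^sub>R s))) * (b \<bullet> w) \<partial>std_gauss) has_real_derivative
    (\<integral>w. h (x + s *\<^sub>R w) * (((c /\<^sub>R s) \<bullet> w) * (b \<bullet> w) - b \<bullet> (c /\<^sub>R s)) \<partial>std_gauss)) (at 0)"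
    by (rule gauss_shift_derivative[of "\<lambda>w. h (x + s *\<^sub>R w)" "\<lambda>w. b \<bullet> w" "\<lambda>_. b \<bullet> (c /\<^sub>R s)"])
      (auto intro!: exp_bounded_h derivative_eq_intros simp: inner_add_right)
  moreover have "s *\<^sub>R (w + r *\<^sub>R (c /\<^sub>R s)) = r *\<^sub>R c + s *\<^sub>R w" for r w
    using assms by (simp add: scaleR_add_right add.commute)
  moreover have "(\<integral>w. h (x + s *\<^sub>R w) * (((c /\<^sub>R s) \<bullet> w) * (b \<bullet> w) - b \<bullet> (c /\<^sub>R s)) \<partial>std_gauss)
      = (\<integral>w. (h (x + s *\<^sub>R w) * ((b \<bullet> w) * (c \<bullet> w) - b \<bullet> c)) / s \<partial>std_gauss)"
    by (intro Bochner_Integration.integral_cong refl) (simp add: divide_inverse algebra_simps)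
  ultimately have "((\<lambda>r. \<integral>w. h (x + r *\<^sub>R c + s *\<^sub>R w) * (b \<bullet> w) \<partial>std_gauss) has_real_derivative
    (\<integral>w. h (x + s *\<^sub>R w) * ((b \<bullet> w) * (c \<bullet> w) - b \<bullet> c) \<partial>std_gauss) / s) (at 0)"
    by (simp add: add.assoc)
  from DERIV_cdivide[OF this, of s] show ?thesis
    by (simp add: gauss_D1_def gauss_D2_def power2_eq_square)
qed

lemma linear_gauss_D1: "linear (gauss_D1 s h x)"
proof (rule linearI)
  show "gauss_D1 s h x (b + c) = gauss_D1 s h x b + gauss_D1 s h x c" for b c
  proof -
    have "(\<integral>w. h (x + s *\<^sub>R w) * ((b + c) \<bullet> w) \<partial>std_gauss)
        = (\<integral>w. h (x + s *\<^sub>R w) * (b \<bullet> w) + h (x + s *\<^sub>R w) * (c \<bullet> w) \<partial>std_gauss)"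
      by (simp add: inner_add_left distrib_left)
    also have "\<dots> = (\<integral>w. h (x + s *\<^sub>R w) * (b \<bullet> w) \<partial>std_gauss) + (\<integral>w. h (x + s *\<^sub>R w) * (c \<bullet> w) \<partial>std_gauss)"
      by (intro Bochner_Integration.integral_add integrable_h_mult) auto
    finally show ?thesis by (simp add: gauss_D1_def add_divide_distrib)
  qed
  show "gauss_D1 s h x (r *\<^sub>R b) = r *\<^sub>R gauss_D1 s h x b" for r b
    by (simp add: gauss_D1_def mult.left_commute)
qed

lemma linear_gauss_D2_right: "linear (gauss_D2 s h x b)"
proof (rule linearI)
  show "gauss_D2 s h x b (c + d) = gauss_D2 s h x b c + gauss_D2 s h x b d" for c d
  proof -
    let ?H = "\<lambda>c w. (b \<bullet> w) * (c \<bullet> w) - b \<bullet> c"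
    have "?H (c + d) w = ?H c w + ?H d w" for w
      by (simp add: inner_add_left inner_add_right distrib_left)
    then have "(\<integral>w. h (x + s *\<^sub>R w) * ?H (c + d) w \<partial>std_gauss)
        = (\<integral>w. h (x + s *\<^sub>R w) * ?H c w + h (x + s *\<^sub>R w) * ?H d w \<partial>std_gauss)"
      by (simp only: distrib_left)
    also have "\<dots> = (\<integral>w. h (x + s *\<^sub>R w) * ?H c w \<partial>std_gauss) + (\<integral>w. h (x + s *\<^sub>R w) * ?H d w \<partial>std_gauss)"
      by (intro Bochner_Integration.integral_add integrable_h_mult) auto
    finally show ?thesis by (simp add: gauss_D2_def add_divide_distrib)
  qed
  show "gauss_D2 s h x b (r *\<^sub>R c) = r *\<^sub>R gauss_D2 s h x b c" for r c
  proof -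
    have "h (x + s *\<^sub>R w) * ((b \<bullet> w) * (r *\<^sub>R c \<bullet> w) - b \<bullet> (r *\<^sub>R c))
        = r * (h (x + s *\<^sub>R w) * ((b \<bullet> w) * (c \<bullet> w) - b \<bullet> c))" for w
      by (simp add: algebra_simps)
    then have "(\<integral>w. h (x + s *\<^sub>R w) * ((b \<bullet> w) * (r *\<^sub>R c \<bullet> w) - b \<bullet> (r *\<^sub>R c)) \<partial>std_gauss)
        = r * (\<integral>w. h (x + s *\<^sub>R w) * ((b \<bullet> w) * (c \<bullet> w) - b \<bullet> c) \<partial>std_gauss)"
      by (simp only: integral_mult_right_zero)
    then show ?thesis unfolding gauss_D2_def by simp
  qed
qed

lemma gauss_D2_commute: "gauss_D2 s h x b c = gauss_D2 s h x c b"
  by (simp add: gauss_D2_def inner_commute mult.commute)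

lemma linear_gauss_D2_left: "linear (\<lambda>b. gauss_D2 s h x b c)"
  using linear_gauss_D2_right[of s x c] by (simp add: gauss_D2_commute[of s x _ c])

text \<open>Only the increment of \<open>h\<close> over the displacement \<open>a\<close> enters,
  integrated against a second Hermite polynomial. \<open>P\<close> is left free, instead of
  \<Lambda> times the norm of \<open>a\<close>, so that \<open>norm (S a)\<close> can be inserted
  later: the displacement is then measured in the coordinates before whitening.\<close>

lemma gauss_D2_lipschitz:
  assumes P: "\<And>y. \<bar>h (y + a) - h y\<bar> \<le> P"
  shows "\<bar>gauss_D2 s h (x + a) b c - gauss_D2 s h x b c\<bar> \<le> 4/3 * P / s\<^sup>2 * norm b * norm c"
proof -
  let ?H = "\<lambda>w. (b \<bullet> w) * (c \<bullet> w) - b \<bullet> c"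
  have P0: "P \<ge> 0" using P[of 0] by linarith
  have eq: "(\<integral>w. h (x + a + s *\<^sub>R w) * ?H w \<partial>std_gauss) - (\<integral>w. h (x + s *\<^sub>R w) * ?H w \<partial>std_gauss)
      = (\<integral>w. (h (x + a + s *\<^sub>R w) - h (x + s *\<^sub>R w)) * ?H w \<partial>std_gauss)"
    unfolding left_diff_distrib
    by (rule Bochner_Integration.integral_diff[symmetric]) (auto intro!: integrable_h_mult)
  have "\<bar>\<integral>w. (h (x + a + s *\<^sub>R w) - h (x + s *\<^sub>R w)) * ?H w \<partial>std_gauss\<bar>
      \<le> (\<integral>w. \<bar>(h (x + a + s *\<^sub>R w) - h (x + s *\<^sub>R w)) * ?H w\<bar> \<partial>std_gauss)"
    by (rule integral_abs_bound)
  also have "\<dots> \<le> (\<integral>w. P * \<bar>?H w\<bar> \<partial>std_gauss)"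
  proof (intro integral_mono)
    show "integrable std_gauss (\<lambda>w. \<bar>(h (x + a + s *\<^sub>R w) - h (x + s *\<^sub>R w)) * ?H w\<bar>)"
      unfolding left_diff_distrib
      by (intro integrable_abs Bochner_Integration.integrable_diff integrable_h_mult) auto
    show "integrable std_gauss (\<lambda>w. P * \<bar>?H w\<bar>)" by (intro integrable_std_gauss) auto
    fix w
    have "\<bar>h (x + a + s *\<^sub>R w) - h (x + s *\<^sub>R w)\<bar> \<le> P"
      using P[of "x + s *\<^sub>R w"] by (simp add: ac_simps)
    then show "\<bar>(h (x + a + s *\<^sub>R w) - h (x + s *\<^sub>R w)) * ?H w\<bar> \<le> P * \<bar>?H w\<bar>"
      unfolding abs_mult by (intro mult_right_mono) auto
  qed
  also have "\<dots> \<le> P * (4/3 * norm b * norm c)"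
    using mult_left_mono[OF gauss_hermite2[of b c] P0] by simp
  finally have "\<bar>(\<integral>w. h (x + a + s *\<^sub>R w) * ?H w \<partial>std_gauss) - (\<integral>w. h (x + s *\<^sub>R w) * ?H w \<partial>std_gauss)\<bar> / s\<^sup>2
      \<le> P * (4/3 * norm b * norm c) / s\<^sup>2"
    unfolding eq by (rule divide_right_mono) simp
  then show ?thesis
    unfolding gauss_D2_def diff_divide_distrib[symmetric] abs_divide by (simp add: mult.assoc)
qed

text \<open>Same argument as for the second derivative, with a linear function in place of the
  Hermite polynomial. It yields the measurability of \<open>gauss_D1\<close> and the remainder in
  \<open>gauss_smooth_has_derivative\<close>.\<close>

lemma gauss_D1_lipschitz:
  assumes s: "s > 0"
  shows "\<bar>gauss_D1 s h x b - gauss_D1 s h y b\<bar> \<le> \<Lambda> / s * norm b * norm (x - y)"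
proof -
  have eq: "(\<integral>w. h (x + s *\<^sub>R w) * (b \<bullet> w) \<partial>std_gauss) - (\<integral>w. h (y + s *\<^sub>R w) * (b \<bullet> w) \<partial>std_gauss)
      = (\<integral>w. (h (x + s *\<^sub>R w) - h (y + s *\<^sub>R w)) * (b \<bullet> w) \<partial>std_gauss)"
    unfolding left_diff_distrib
    by (rule Bochner_Integration.integral_diff[symmetric]) (auto intro!: integrable_h_mult)
  have "\<bar>\<integral>w. (h (x + s *\<^sub>R w) - h (y + s *\<^sub>R w)) * (b \<bullet> w) \<partial>std_gauss\<bar>
      \<le> (\<integral>w. \<bar>(h (x + s *\<^sub>R w) - h (y + s *\<^sub>R w)) * (b \<bullet> w)\<bar> \<partial>std_gauss)"
    by (rule integral_abs_bound)
  also have "\<dots> \<le> (\<integral>w. (\<Lambda> * norm (x - y)) * \<bar>b \<bullet> w\<bar> \<partial>std_gauss)"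
  proof (intro integral_mono)
    show "integrable std_gauss (\<lambda>w. \<bar>(h (x + s *\<^sub>R w) - h (y + s *\<^sub>R w)) * (b \<bullet> w)\<bar>)"
      unfolding left_diff_distrib
      by (intro integrable_abs Bochner_Integration.integrable_diff integrable_h_mult) auto
    show "integrable std_gauss (\<lambda>w. (\<Lambda> * norm (x - y)) * \<bar>b \<bullet> w\<bar>)" by (intro integrable_std_gauss) auto
    fix w
    have "\<bar>h (x + s *\<^sub>R w) - h (y + s *\<^sub>R w)\<bar> \<le> \<Lambda> * norm (x - y)"
      using lipschitz[of "x + s *\<^sub>R w" "y + s *\<^sub>R w"] by simp
    then show "\<bar>(h (x + s *\<^sub>R w) - h (y + s *\<^sub>R w)) * (b \<bullet> w)\<bar> \<le> (\<Lambda> * norm (x - y)) * \<bar>b \<bullet> w\<bar>"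
      unfolding abs_mult by (intro mult_right_mono) auto
  qed
  also have "\<dots> \<le> (\<Lambda> * norm (x - y)) * norm b"
    using gauss_abs_moment[of b] \<Lambda>_nonneg by (simp add: mult_left_mono)
  finally have "\<bar>(\<integral>w. h (x + s *\<^sub>R w) * (b \<bullet> w) \<partial>std_gauss) - (\<integral>w. h (y + s *\<^sub>R w) * (b \<bullet> w) \<partial>std_gauss)\<bar> / s
      \<le> \<Lambda> * norm (x - y) * norm b / s"
    unfolding eq using s by (intro divide_right_mono) auto
  then show ?thesis
    unfolding gauss_D1_def diff_divide_distrib[symmetric] abs_divide using s by (simp add: mult_ac)
qed

text \<open>The mean value theorem on a segment and the Lipschitz bound for \<open>gauss_D1\<close>
  upgrade directional derivatives to a quadratic remainder, hence to a Frechet derivative.\<close>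

lemma gauss_smooth_has_derivative:
  assumes s: "s > 0"
  shows "(gauss_smooth s h has_derivative gauss_D1 s h x) (at x)"
  unfolding has_derivative_at
proof
  show "bounded_linear (gauss_D1 s h x)"
    using linear_gauss_D1 by (rule linear_conv_bounded_linear[THEN iffD1])
  have rem: "\<bar>gauss_smooth s h (x + v) - gauss_smooth s h x - gauss_D1 s h x v\<bar> \<le> \<Lambda> / s * (norm v)\<^sup>2" for v
  proof -
    have "((\<lambda>r. gauss_smooth s h (x + r *\<^sub>R v)) has_real_derivative gauss_D1 s h (x + r *\<^sub>R v) v) (at r)" for r
    proof -
      have "((\<lambda>q. gauss_smooth s h ((x + r *\<^sub>R v) + q *\<^sub>R v)) has_real_derivative gauss_D1 s h (x + r *\<^sub>R v) v) (at (r - r))"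
        using gauss_smooth_derivative[of s "x + r *\<^sub>R v" v] s by simp
      moreover have "((\<lambda>q. q - r) has_real_derivative 1) (at r)" by (auto intro!: derivative_eq_intros)
      ultimately have "((\<lambda>q. gauss_smooth s h ((x + r *\<^sub>R v) + (q - r) *\<^sub>R v)) has_real_derivative
          gauss_D1 s h (x + r *\<^sub>R v) v * 1) (at r)"
        by (rule DERIV_chain2)
      then show ?thesis by (simp add: algebra_simps)
    qed
    then obtain z where z: "0 < z" "z < 1"
      "gauss_smooth s h (x + 1 *\<^sub>R v) - gauss_smooth s h (x + 0 *\<^sub>R v) = (1 - 0) * gauss_D1 s h (x + z *\<^sub>R v) v"
      using MVT2[of 0 1 "\<lambda>r. gauss_smooth s h (x + r *\<^sub>R v)" "\<lambda>r. gauss_D1 s h (x + r *\<^sub>R v) v"] by auto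
    have "\<bar>gauss_D1 s h (x + z *\<^sub>R v) v - gauss_D1 s h x v\<bar> \<le> \<Lambda> / s * norm v * (z * norm v)"
      using gauss_D1_lipschitz[OF s, of "x + z *\<^sub>R v" v x] z by simp
    also have "\<dots> \<le> \<Lambda> / s * norm v * norm v"
      using z s \<Lambda>_nonneg by (intro mult_left_mono mult_left_le_one_le) auto
    finally show ?thesis using z(3) by (simp add: power2_eq_square)
  qed
  have "(\<lambda>v. \<Lambda> / s * norm v) \<midarrow>0\<rightarrow> \<Lambda> / s * 0"
    by (intro tendsto_mult_left tendsto_norm_zero tendsto_ident_at)
  then have "(\<lambda>v::'a. \<Lambda> / s * norm v) \<midarrow>0\<rightarrow> 0" by simp
  then show "(\<lambda>v. norm (gauss_smooth s h (x + v) - gauss_smooth s h x - gauss_D1 s h x v) / norm v) \<midarrow>0\<rightarrow> 0"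
  proof (rule Lim_null_comparison[rotated], intro always_eventually allI)
    fix v
    show "norm (norm (gauss_smooth s h (x + v) - gauss_smooth s h x - gauss_D1 s h x v) / norm v) \<le> \<Lambda> / s * norm v"
      using rem[of v] by (cases "v = 0") (simp_all add: field_simps power2_eq_square)
  qed
qed

text \<open>Both identities are integration by parts, which moves the derivative from \<open>h\<close> to the density.\<close>

lemma gauss_D1_eq_integral_derivative:
  assumes s: "s > 0" and h': "\<And>x. (h has_derivative h' x) (at x)"
    and [measurable]: "\<And>b. (\<lambda>x. h' x b) \<in> borel_measurable borel"
  shows "(\<integral>w. h' (x + s *\<^sub>R w) b \<partial>std_gauss) = gauss_D1 s h x b"
    and "(\<integral>w. h' (x + s *\<^sub>R w) b * (b \<bullet> w) \<partial>std_gauss) = s * gauss_D2 s h x b b"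
proof -
  have lin: "h' x (s *\<^sub>R b) = s * h' x b" for x b
    using has_derivative_linear[OF h'] by (simp add: linear_scale)
  have deriv: "((\<lambda>r. h (x + s *\<^sub>R (w + r *\<^sub>R b))) has_real_derivative s * h' (x + s *\<^sub>R w) b) (at 0)" for w
  proof -
    have "((\<lambda>r. h (x + s *\<^sub>R (w + r *\<^sub>R b))) has_derivative (\<lambda>r. h' (x + s *\<^sub>R (w + 0 *\<^sub>R b)) (s *\<^sub>R (r *\<^sub>R b)))) (at 0)"
      by (rule has_derivative_compose[OF _ h']) (auto intro!: derivative_eq_intros)
    moreover have "h' y (s *\<^sub>R (r *\<^sub>R b)) = r * (s * h' y b)" for y r
      using has_derivative_linear[OF h', of y] by (simp add: linear_scale)
    ultimately show ?thesis
      by (simp add: has_field_derivative_def mult_commute_abs)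
  qed
  have lip: "\<bar>h (x + s *\<^sub>R (w + r *\<^sub>R b)) - h (x + s *\<^sub>R w)\<bar> \<le> \<bar>r\<bar> * (\<Lambda> * s * norm b)" for w r
    using lipschitz[of "x + s *\<^sub>R (w + r *\<^sub>R b)" "x + s *\<^sub>R w"] s
    by (simp add: scaleR_add_right abs_mult mult_ac)
  have "(\<integral>w. s * h' (x + s *\<^sub>R w) b * 1 \<partial>std_gauss) = (\<integral>w. h (x + s *\<^sub>R w) * ((b \<bullet> w) * 1 - 0) \<partial>std_gauss)"
    by (rule gauss_integration_by_parts[OF _ _ _ _ _ _ _ deriv lip]) (auto intro: exp_bounded_h)
  then show "(\<integral>w. h' (x + s *\<^sub>R w) b \<partial>std_gauss) = gauss_D1 s h x b"
    using s by (simp add: gauss_D1_def field_simps)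
  have "(\<integral>w. s * h' (x + s *\<^sub>R w) b * (b \<bullet> w) \<partial>std_gauss)
      = (\<integral>w. h (x + s *\<^sub>R w) * ((b \<bullet> w) * (b \<bullet> w) - b \<bullet> b) \<partial>std_gauss)"
    by (rule gauss_integration_by_parts[OF _ _ _ _ _ _ _ deriv lip])
      (auto intro!: exp_bounded_h derivative_eq_intros simp: inner_add_right)
  then show "(\<integral>w. h' (x + s *\<^sub>R w) b * (b \<bullet> w) \<partial>std_gauss) = s * gauss_D2 s h x b b"
    using s by (simp add: gauss_D2_def field_simps power2_eq_square mult.assoc)
qed

end

section \<open>Stein's method under local dependence\<close>

lemma linear_sum_Basis:
  fixes f :: "'a::euclidean_space \<Rightarrow> real"
  assumes "linear f"
  shows "f b = (\<Sum>e\<in>Basis. (b \<bullet> e) * f e)"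
proof -
  have "f b = f (\<Sum>e\<in>Basis. (b \<bullet> e) *\<^sub>R e)" by (simp add: euclidean_representation)
  also have "\<dots> = (\<Sum>e\<in>Basis. (b \<bullet> e) * f e)"
    using assms by (simp add: linear_sum linear_scale)
  finally show ?thesis .
qed

text \<open>Subtracting the linear part and K r^2 / 2 leaves a nonincreasing function, which gives
  the factor 1/2 without a second derivative. This factor is the last 1/2 in the count 7/2 = 3 + 1/2
  of \<open>stein_local_dependence\<close>.\<close>

lemma taylor_lipschitz_derivative:
  fixes f f' :: "real \<Rightarrow> real"
  assumes f: "\<And>r. (f has_real_derivative f' r) (at r)"
    and lip: "\<And>r. 0 \<le> r \<Longrightarrow> \<bar>f' r - f' 0\<bar> \<le> K * r"
  shows "\<bar>f 1 - f 0 - f' 0\<bar> \<le> K / 2"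
proof -
  have upper: "g 1 - g 0 - g' 0 \<le> K / 2"
    if "\<And>r. (g has_real_derivative g' r) (at r)" "\<And>r. 0 \<le> r \<Longrightarrow> g' r - g' 0 \<le> K * r"
    for g g' :: "real \<Rightarrow> real"
  proof -
    have d: "((\<lambda>r. g r - g' 0 * r - K * r\<^sup>2 / 2) has_real_derivative g' r - g' 0 - K * r) (at r)" for r
      using that(1)[of r] by (auto intro!: derivative_eq_intros)
    define G where "G r = g r - g' 0 * r - K * r\<^sup>2 / 2" for r
    have "G 1 \<le> G 0"
    proof (rule DERIV_nonpos_imp_nonincreasing[of 0 1 G])
      fix x :: real assume "0 \<le> x" "x \<le> 1"
      then show "\<exists>y. (G has_real_derivative y) (at x) \<and> y \<le> 0"
        using d[of x] that(2)[of x] unfolding G_def by (intro exI[of _ "g' x - g' 0 - K * x"] conjI) simp_all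
    qed simp
    then show ?thesis by (simp add: G_def)
  qed
  have "f 1 - f 0 - f' 0 \<le> K / 2"
    using lip by (intro upper[of f f'] f) (auto simp: abs_le_iff)
  moreover have "(\<lambda>r. - f r) 1 - (\<lambda>r. - f r) 0 - (\<lambda>r. - f' r) 0 \<le> K / 2"
    using lip by (intro upper[of "\<lambda>r. - f r" "\<lambda>r. - f' r"] DERIV_minus f) (force simp: abs_le_iff)
  ultimately show ?thesis unfolding abs_le_iff by (simp add: algebra_simps)
qed

text \<open>Stein's argument sees a test function only through its first and second derivatives
  \<open>D1\<close> and \<open>D2\<close>. In the modulus of \<open>D2\<close> the displacement is
  mapped back by \<open>S\<close>, while the two directions stay whitened.\<close>

locale lipschitz_hessian =
  fixes D1 :: "'a::euclidean_space \<Rightarrow> 'a \<Rightarrow> real" and D2 :: "'a \<Rightarrow> 'a \<Rightarrow> 'a \<Rightarrow> real"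
    and S :: "'a \<Rightarrow> 'a" and L L1 :: real
  assumes linear_D1: "linear (D1 x)"
    and linear_D2_left: "linear (\<lambda>b. D2 x b c)" and linear_D2_right: "linear (D2 x b)"
    and D1_derivative: "((\<lambda>r. D1 (x + r *\<^sub>R c) b) has_real_derivative D2 x b c) (at 0)"
    and D1_lipschitz: "\<bar>D1 x b - D1 y b\<bar> \<le> L1 * norm b * norm (x - y)"
    and D2_lipschitz: "\<bar>D2 (x + a) b c - D2 x b c\<bar> \<le> L * norm (S a) * norm b * norm c"
    and linear_S: "linear S" and L_nonneg: "L \<ge> 0"
begin

lemma measurable_D1 [measurable]: "(\<lambda>x. D1 x b) \<in> borel_measurable borel"
  using D1_lipschitz by (rule lipschitz_measurable)

lemma D2_lipschitz_norm: "\<bar>D2 x b c - D2 y b c\<bar> \<le> (L * onorm S * norm b * norm c) * norm (x - y)"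
proof -
  have "\<bar>D2 (y + (x - y)) b c - D2 y b c\<bar> \<le> L * norm (S (x - y)) * norm b * norm c"
    by (rule D2_lipschitz)
  also have "\<dots> \<le> L * (onorm S * norm (x - y)) * norm b * norm c"
    using L_nonneg linear_S
    by (intro mult_right_mono mult_left_mono onorm) (auto simp: linear_conv_bounded_linear)
  finally show ?thesis by (simp add: mult_ac)
qed

lemma measurable_D2 [measurable]: "(\<lambda>x. D2 x b c) \<in> borel_measurable borel"
  using D2_lipschitz_norm by (rule lipschitz_measurable)

lemma D1_bounded: "\<exists>C. \<forall>x. norm x \<le> R \<longrightarrow> \<bar>D1 x b\<bar> \<le> C"
proof (intro exI allI impI)
  fix x :: 'a assume "norm x \<le> R"
  have "\<bar>D1 x b\<bar> \<le> \<bar>D1 0 b\<bar> + L1 * norm b * norm x"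
    using D1_lipschitz[of x b 0] by simp
  also have "L1 * norm b * norm x \<le> \<bar>L1 * norm b\<bar> * norm x" by (intro mult_right_mono) auto
  also have "\<dots> \<le> \<bar>L1 * norm b\<bar> * R" using \<open>norm x \<le> R\<close> by (intro mult_left_mono) auto
  finally show "\<bar>D1 x b\<bar> \<le> \<bar>D1 0 b\<bar> + \<bar>L1 * norm b\<bar> * R" by simp
qed

lemma D2_bounded: "\<exists>C. \<forall>x. norm x \<le> R \<longrightarrow> \<bar>D2 x b c\<bar> \<le> C"
proof (intro exI allI impI)
  fix x :: 'a assume "norm x \<le> R"
  let ?K = "L * onorm S * norm b * norm c"
  have "\<bar>D2 x b c\<bar> \<le> \<bar>D2 0 b c\<bar> + ?K * norm x"
    using D2_lipschitz_norm[of x b c 0] by simp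
  also have "?K * norm x \<le> \<bar>?K\<bar> * norm x" by (intro mult_right_mono) auto
  also have "\<dots> \<le> \<bar>?K\<bar> * R" using \<open>norm x \<le> R\<close> by (intro mult_left_mono) auto
  finally show "\<bar>D2 x b c\<bar> \<le> \<bar>D2 0 b c\<bar> + \<bar>?K\<bar> * R" by simp
qed

lemma D1_taylor: "\<bar>D1 (x + a) b - D1 x b - D2 x b a\<bar> \<le> L * norm (S a) * norm b * norm a / 2"
proof -
  have d: "((\<lambda>r. D1 (x + r *\<^sub>R a) b) has_real_derivative D2 (x + r *\<^sub>R a) b a) (at r)" for r
  proof -
    have "((\<lambda>q. D1 ((x + r *\<^sub>R a) + q *\<^sub>R a) b) has_real_derivative D2 (x + r *\<^sub>R a) b a) (at (r - r))"
      using D1_derivative[of "x + r *\<^sub>R a" a b] by simp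
    moreover have "((\<lambda>q. q - r) has_real_derivative 1) (at r)" by (auto intro!: derivative_eq_intros)
    ultimately have "((\<lambda>q. D1 ((x + r *\<^sub>R a) + (q - r) *\<^sub>R a) b) has_real_derivative
        D2 (x + r *\<^sub>R a) b a * 1) (at r)"
      by (rule DERIV_chain2)
    then show ?thesis by (simp add: algebra_simps)
  qed
  have "\<bar>D2 (x + r *\<^sub>R a) b a - D2 (x + 0 *\<^sub>R a) b a\<bar> \<le> (L * norm (S a) * norm b * norm a) * r" if "0 \<le> r" for r
    using D2_lipschitz[of x "r *\<^sub>R a" b a] that linear_S by (simp add: linear_scale mult_ac)
  from taylor_lipschitz_derivative[OF d this] show ?thesis by simp
qed

lemma D1_sum_Basis: "D1 x b = (\<Sum>e\<in>Basis. (b \<bullet> e) * D1 x e)"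
  by (rule linear_sum_Basis) (rule linear_D1)

lemma D2_sum_Basis: "D2 x b c = (\<Sum>e\<in>Basis. \<Sum>e'\<in>Basis. (b \<bullet> e) * (c \<bullet> e') * D2 x e e')"
proof -
  have "D2 x b c = (\<Sum>e\<in>Basis. (b \<bullet> e) * D2 x e c)"
    by (rule linear_sum_Basis) (rule linear_D2_left)
  also have "\<dots> = (\<Sum>e\<in>Basis. \<Sum>e'\<in>Basis. (b \<bullet> e) * (c \<bullet> e') * D2 x e e')"
    by (subst linear_sum_Basis[OF linear_D2_right]) (simp add: sum_distrib_left mult.assoc)
  finally show ?thesis .
qed

end

text \<open>The summands \<open>Y k\<close> are whitened, and \<open>S\<close> maps them back to the original ones, which have
  their own bound \<open>\<beta>\<close>. Independence is only required for the expectations that Stein's method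
  produces.\<close>

locale local_dependence = prob_space +
  fixes Y :: "'q::finite \<Rightarrow> 'a \<Rightarrow> 'b::euclidean_space" and nbhd :: "'q \<Rightarrow> 'q set"
    and S :: "'b \<Rightarrow> 'b" and \<alpha> \<beta> :: real and D :: nat
  assumes measurable_Y [measurable]: "Y k \<in> borel_measurable M"
    and norm_Y: "\<omega> \<in> space M \<Longrightarrow> norm (Y k \<omega>) \<le> \<alpha>"
    and linear_S: "linear S" and norm_S_Y: "\<omega> \<in> space M \<Longrightarrow> norm (S (Y k \<omega>)) \<le> \<beta>"
    and self_nbhd: "k \<in> nbhd k" and nbhd_sym: "j \<in> nbhd k \<Longrightarrow> k \<in> nbhd j"
    and card_nbhd: "card (nbhd k) \<le> D"
    and indep1: "\<lbrakk>\<psi> \<in> borel_measurable borel; \<And>R. \<exists>C. \<forall>x. norm x \<le> R \<longrightarrow> \<bar>\<psi> x\<bar> \<le> C\<rbrakk> \<Longrightarrow>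
      expectation (\<lambda>\<omega>. (Y k \<omega> \<bullet> e) * \<psi> (\<Sum>j\<in>-nbhd k. Y j \<omega>)) = 0"
    and indep2: "\<lbrakk>\<psi> \<in> borel_measurable borel; \<And>R. \<exists>C. \<forall>x. norm x \<le> R \<longrightarrow> \<bar>\<psi> x\<bar> \<le> C\<rbrakk> \<Longrightarrow>
      expectation (\<lambda>\<omega>. (Y k \<omega> \<bullet> e) * (Y k' \<omega> \<bullet> e') * \<psi> (\<Sum>j\<in>-(nbhd k \<union> nbhd k'). Y j \<omega>))
      = expectation (\<lambda>\<omega>. (Y k \<omega> \<bullet> e) * (Y k' \<omega> \<bullet> e')) *
        expectation (\<lambda>\<omega>. \<psi> (\<Sum>j\<in>-(nbhd k \<union> nbhd k'). Y j \<omega>))"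
    and cov: "e \<in> Basis \<Longrightarrow> e' \<in> Basis \<Longrightarrow>
      (\<Sum>k\<in>UNIV. \<Sum>k'\<in>nbhd k. expectation (\<lambda>\<omega>. (Y k \<omega> \<bullet> e) * (Y k' \<omega> \<bullet> e'))) = e \<bullet> e'"
begin

definition W :: "'q set \<Rightarrow> 'a \<Rightarrow> 'b"
  where "W J \<omega> = (\<Sum>j\<in>J. Y j \<omega>)"

lemma measurable_W [measurable]: "W J \<in> borel_measurable M"
  unfolding W_def by measurable

lemma \<alpha>_nonneg: "\<alpha> \<ge> 0"
  using norm_Y not_empty by (meson equals0I norm_ge_zero order_trans)

lemma \<beta>_nonneg: "\<beta> \<ge> 0"
  using norm_S_Y not_empty by (meson equals0I norm_ge_zero order_trans)

lemma norm_W: "\<omega> \<in> space M \<Longrightarrow> norm (W J \<omega>) \<le> card J * \<alpha>"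
  unfolding W_def using sum_norm_le[of J "\<lambda>j. Y j \<omega>" "\<lambda>_. \<alpha>"] norm_Y by simp

lemma norm_S_W: "\<omega> \<in> space M \<Longrightarrow> norm (S (W J \<omega>)) \<le> card J * \<beta>"
  unfolding W_def linear_sum[OF linear_S]
  using sum_norm_le[of J "\<lambda>j. S (Y j \<omega>)" "\<lambda>_. \<beta>"] norm_S_Y by simp

lemma W_Un: "J \<inter> K = {} \<Longrightarrow> W (J \<union> K) \<omega> = W J \<omega> + W K \<omega>"
  unfolding W_def by (intro sum.union_disjoint) auto

lemma W_compl: "W (- J) \<omega> + W J \<omega> = W UNIV \<omega>"
  using W_Un[of "- J" J] by simp

lemma integrable_W:
  fixes \<psi> :: "'b \<Rightarrow> real"
  assumes [measurable]: "\<psi> \<in> borel_measurable borel" and "\<And>R. \<exists>C. \<forall>x. norm x \<le> R \<longrightarrow> \<bar>\<psi> x\<bar> \<le> C"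
  shows "integrable M (\<lambda>\<omega>. \<psi> (W J \<omega>))"
proof -
  obtain C where "\<And>x. norm x \<le> card J * \<alpha> \<Longrightarrow> \<bar>\<psi> x\<bar> \<le> C" using assms(2) by blast
  then show ?thesis
    using norm_W by (intro integrable_const_bound[where B = C]) auto
qed

lemma integrable_Y_mult:
  assumes "integrable M f"
  shows "integrable M (\<lambda>\<omega>. (Y k \<omega> \<bullet> e) * f \<omega>)"
proof (rule Bochner_Integration.integrable_bound)
  show "integrable M (\<lambda>\<omega>. (\<alpha> * norm e) * f \<omega>)" using assms by simp
  show "AE \<omega> in M. norm ((Y k \<omega> \<bullet> e) * f \<omega>) \<le> norm ((\<alpha> * norm e) * f \<omega>)"
  proof (rule AE_I2)
    fix \<omega> assume "\<omega> \<in> space M"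
    have "\<bar>Y k \<omega> \<bullet> e\<bar> \<le> norm (Y k \<omega>) * norm e" by (rule Cauchy_Schwarz_ineq2)
    also have "\<dots> \<le> \<alpha> * norm e" using norm_Y[OF \<open>\<omega> \<in> space M\<close>] by (intro mult_right_mono) auto
    finally show "norm ((Y k \<omega> \<bullet> e) * f \<omega>) \<le> norm ((\<alpha> * norm e) * f \<omega>)"
      using \<alpha>_nonneg by (auto simp: abs_mult intro!: mult_right_mono)
  qed
qed (use assms in measurable)

lemma abs_expectation_le:
  fixes f :: "'a \<Rightarrow> real"
  assumes "\<And>\<omega>. \<omega> \<in> space M \<Longrightarrow> \<bar>f \<omega>\<bar> \<le> C"
  shows "\<bar>expectation f\<bar> \<le> C"
proof (cases "integrable M f")
  case True
  have "\<bar>expectation f\<bar> \<le> expectation (\<lambda>\<omega>. \<bar>f \<omega>\<bar>)" by (rule integral_abs_bound)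
  also have "\<dots> \<le> expectation (\<lambda>_. C)" using True assms by (intro integral_mono) auto
  finally show ?thesis by (simp add: prob_space)
next
  case False
  have "C \<ge> 0" using assms not_empty by (meson abs_ge_zero equals0I order_trans)
  then show ?thesis using False by (simp add: not_integrable_integral_eq)
qed

end

locale local_dependence_test = local_dependence M Y nbhd S \<alpha> \<beta> D + lipschitz_hessian D1 D2 S L L1
  for M :: "'a measure" and Y :: "'q::finite \<Rightarrow> 'a \<Rightarrow> 'b::euclidean_space" and nbhd S \<alpha> \<beta> D D1 D2 L L1
begin

lemma integrable_D1: "integrable M (\<lambda>\<omega>. D1 (W J \<omega>) (Y k \<omega>))"
  by (subst D1_sum_Basis)
    (auto intro!: Bochner_Integration.integrable_sum integrable_Y_mult integrable_W D1_bounded)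

lemma integrable_D2: "integrable M (\<lambda>\<omega>. D2 (W J \<omega>) (Y k \<omega>) (Y k' \<omega>))"
  by (subst D2_sum_Basis)
    (auto simp: mult.assoc intro!: Bochner_Integration.integrable_sum integrable_Y_mult integrable_W D2_bounded)

lemma integrable_D2_const: "integrable M (\<lambda>\<omega>. D2 (W J \<omega>) b c)"
  by (auto intro!: integrable_W D2_bounded)

text \<open>\<open>R1\<close> is the Taylor remainder caused by removing the neighbourhood of k from
  the sum; \<open>R2\<close> is the error of removing the neighbourhood of k' as well in the
  second-order term.\<close>

definition R1 :: "'q \<Rightarrow> 'a \<Rightarrow> real"
  where "R1 k \<omega> = D1 (W UNIV \<omega>) (Y k \<omega>) - D1 (W (- nbhd k) \<omega>) (Y k \<omega>)
    - D2 (W (- nbhd k) \<omega>) (Y k \<omega>) (W (nbhd k) \<omega>)"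

definition R2 :: "'q \<Rightarrow> 'q \<Rightarrow> 'a \<Rightarrow> real"
  where "R2 k k' \<omega> = D2 (W (- nbhd k) \<omega>) (Y k \<omega>) (Y k' \<omega>)
    - D2 (W (- (nbhd k \<union> nbhd k')) \<omega>) (Y k \<omega>) (Y k' \<omega>)"

text \<open>Here \<open>\<omega>'\<close> acts as an independent copy that carries the two
  directions, so that the expectation of \<open>R3\<close> is a decoupled analogue of that of
  \<open>R2\<close>, starting from the full sum. Keeping whole vectors as directions, instead of
  basis components, allows a bound by norms without a dimension factor.\<close>

definition R3 :: "'q \<Rightarrow> 'q \<Rightarrow> 'a \<Rightarrow> real"
  where "R3 k k' \<omega>' = expectation (\<lambda>\<omega>. D2 (W UNIV \<omega>) (Y k \<omega>') (Y k' \<omega>')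
    - D2 (W (- (nbhd k \<union> nbhd k')) \<omega>) (Y k \<omega>') (Y k' \<omega>'))"

lemma L\<alpha>\<beta>: "L * \<beta> * \<alpha>\<^sup>2 \<ge> 0"
  using L_nonneg \<alpha>_nonneg \<beta>_nonneg by simp

lemma R1_bound:
  assumes "\<omega> \<in> space M"
  shows "\<bar>R1 k \<omega>\<bar> \<le> L * \<beta> * \<alpha>\<^sup>2 * (real D * real D / 2)"
proof -
  have c: "real (card (nbhd k)) \<le> D" using card_nbhd by simp
  have "\<bar>R1 k \<omega>\<bar> \<le> L * norm (S (W (nbhd k) \<omega>)) * norm (Y k \<omega>) * norm (W (nbhd k) \<omega>) / 2"
    using D1_taylor[of "W (- nbhd k) \<omega>" "W (nbhd k) \<omega>" "Y k \<omega>"] by (simp add: R1_def W_compl)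
  also have "\<dots> \<le> L * (D * \<beta>) * \<alpha> * (D * \<alpha>) / 2"
  proof (intro divide_right_mono mult_mono mult_nonneg_nonneg)
    show "norm (S (W (nbhd k) \<omega>)) \<le> D * \<beta>"
      using norm_S_W[OF assms] mult_right_mono[OF c \<beta>_nonneg] by (rule order_trans)
    show "norm (W (nbhd k) \<omega>) \<le> D * \<alpha>"
      using norm_W[OF assms] mult_right_mono[OF c \<alpha>_nonneg] by (rule order_trans)
  qed (use norm_Y[OF assms] L_nonneg \<alpha>_nonneg \<beta>_nonneg in auto)
  finally show ?thesis by (simp add: power2_eq_square mult_ac)
qed

lemma D2_diff_bound:
  assumes "J \<inter> K = {}" and \<omega>: "\<omega> \<in> space M" "\<omega>' \<in> space M" and K: "real (card K) \<le> d"
  shows "\<bar>D2 (W (J \<union> K) \<omega>) (Y k \<omega>') (Y k' \<omega>') - D2 (W J \<omega>) (Y k \<omega>') (Y k' \<omega>')\<bar> \<le> L * \<beta> * \<alpha>\<^sup>2 * d"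
proof -
  have "0 \<le> d" using K by (meson of_nat_0_le_iff order_trans)
  have "\<bar>D2 (W (J \<union> K) \<omega>) (Y k \<omega>') (Y k' \<omega>') - D2 (W J \<omega>) (Y k \<omega>') (Y k' \<omega>')\<bar>
      \<le> L * norm (S (W K \<omega>)) * norm (Y k \<omega>') * norm (Y k' \<omega>')"
    unfolding W_Un[OF assms(1)] by (rule D2_lipschitz)
  also have "\<dots> \<le> L * (d * \<beta>) * \<alpha> * \<alpha>"
  proof (intro mult_mono mult_nonneg_nonneg)
    show "norm (S (W K \<omega>)) \<le> d * \<beta>"
      using norm_S_W[OF \<omega>(1)] mult_right_mono[OF K \<beta>_nonneg] by (rule order_trans)
  qed (use \<open>0 \<le> d\<close> norm_Y[OF \<omega>(2)] L_nonneg \<alpha>_nonneg \<beta>_nonneg in auto)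
  finally show ?thesis by (simp add: power2_eq_square mult_ac)
qed

lemma D_pos: "D \<ge> 1"
  using card_nbhd[of undefined] self_nbhd[of undefined] by (metis One_nat_def Suc_leI card_gt_0_iff empty_iff finite le_trans)

text \<open>By symmetry \<open>k\<close> lies in both neighbourhoods, which saves one element in
  each count. The savings add up to the -2 in D (7/2 D - 2), on which the value 3/2 at D = 1
  depends.\<close>

lemma card_nbhd_diff:
  assumes "k' \<in> nbhd k"
  shows "real (card (nbhd k' - nbhd k)) \<le> real D - 1" and "real (card (nbhd k \<union> nbhd k')) \<le> 2 * real D - 1"
proof -
  have k: "k \<in> nbhd k' \<inter> nbhd k" using nbhd_sym[OF assms] self_nbhd by simp
  then have "card (nbhd k' - nbhd k) < card (nbhd k')"
    by (intro psubset_card_mono) auto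
  also have "\<dots> \<le> D" by (rule card_nbhd)
  finally show 1: "real (card (nbhd k' - nbhd k)) \<le> real D - 1" by simp
  have "card (nbhd k \<union> nbhd k') \<le> card (nbhd k) + card (nbhd k' - nbhd k)"
    by (metis Un_Diff_cancel card_Un_le)
  then have "real (card (nbhd k \<union> nbhd k')) \<le> real (card (nbhd k)) + real (card (nbhd k' - nbhd k))"
    by (simp flip: of_nat_add)
  also have "\<dots> \<le> real D + (real D - 1)" using 1 card_nbhd[of k] by (intro add_mono) auto
  finally show "real (card (nbhd k \<union> nbhd k')) \<le> 2 * real D - 1" by simp
qed

lemma R2_bound:
  assumes "\<omega> \<in> space M" "k' \<in> nbhd k"
  shows "\<bar>R2 k k' \<omega>\<bar> \<le> L * \<beta> * \<alpha>\<^sup>2 * (real D - 1)"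
proof -
  have eq: "- nbhd k = - (nbhd k \<union> nbhd k') \<union> (nbhd k' - nbhd k)" by auto
  show ?thesis
    unfolding R2_def by (subst eq, rule D2_diff_bound) (use assms card_nbhd_diff in auto)
qed

lemma R3_bound:
  assumes "\<omega>' \<in> space M" "k' \<in> nbhd k"
  shows "\<bar>R3 k k' \<omega>'\<bar> \<le> L * \<beta> * \<alpha>\<^sup>2 * (2 * real D - 1)"
proof -
  have eq: "UNIV = - (nbhd k \<union> nbhd k') \<union> (nbhd k \<union> nbhd k')" by auto
  show ?thesis
    unfolding R3_def
    by (rule abs_expectation_le, subst eq, rule D2_diff_bound) (use assms card_nbhd_diff in auto)
qed

text \<open>The directions are expanded in the basis because \<open>indep2\<close> factors
  expectations of components.\<close>

lemma expectation_D2_split: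
  "expectation (\<lambda>\<omega>. D2 (W (- (nbhd k \<union> nbhd k')) \<omega>) (Y k \<omega>) (Y k' \<omega>)) =
    (\<Sum>e\<in>Basis. \<Sum>e'\<in>Basis. expectation (\<lambda>\<omega>. (Y k \<omega> \<bullet> e) * (Y k' \<omega> \<bullet> e')) *
      expectation (\<lambda>\<omega>. D2 (W (- (nbhd k \<union> nbhd k')) \<omega>) e e'))"
proof -
  let ?J = "- (nbhd k \<union> nbhd k')"
  have "expectation (\<lambda>\<omega>. D2 (W ?J \<omega>) (Y k \<omega>) (Y k' \<omega>)) =
      (\<Sum>e\<in>Basis. \<Sum>e'\<in>Basis. expectation (\<lambda>\<omega>. (Y k \<omega> \<bullet> e) * (Y k' \<omega> \<bullet> e') * D2 (W ?J \<omega>) e e'))"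
    by (subst D2_sum_Basis, subst Bochner_Integration.integral_sum)
      (auto simp: mult.assoc intro!: Bochner_Integration.integrable_sum integrable_Y_mult
        integrable_D2_const sum.cong Bochner_Integration.integral_sum)
  also have "\<dots> = (\<Sum>e\<in>Basis. \<Sum>e'\<in>Basis. expectation (\<lambda>\<omega>. (Y k \<omega> \<bullet> e) * (Y k' \<omega> \<bullet> e')) *
      expectation (\<lambda>\<omega>. D2 (W ?J \<omega>) e e'))"
    using indep2[OF measurable_D2 D2_bounded, of k] by (simp add: W_def)
  finally show ?thesis .
qed

lemma integrable_Y_Y: "integrable M (\<lambda>\<omega>. (Y k \<omega> \<bullet> e) * (Y k' \<omega> \<bullet> e'))"
  using integrable_Y_mult[OF integrable_Y_mult[of "\<lambda>_. 1" k' e'], of k e] by simp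

text \<open>Expanding the directions in the basis separates \<open>\<omega>'\<close> from the
  integration variable and brings the term into the form in which the covariances enter
  \<open>stein_local_dependence\<close>.\<close>

lemma expectation_R3:
  "expectation (R3 k k') = (\<Sum>e\<in>Basis. \<Sum>e'\<in>Basis. expectation (\<lambda>\<omega>. (Y k \<omega> \<bullet> e) * (Y k' \<omega> \<bullet> e')) *
      (expectation (\<lambda>\<omega>. D2 (W UNIV \<omega>) e e') - expectation (\<lambda>\<omega>. D2 (W (- (nbhd k \<union> nbhd k')) \<omega>) e e')))"
proof -
  have "R3 k k' = (\<lambda>\<omega>'. \<Sum>e\<in>Basis. \<Sum>e'\<in>Basis. (Y k \<omega>' \<bullet> e) * (Y k' \<omega>' \<bullet> e') *
      (expectation (\<lambda>\<omega>. D2 (W UNIV \<omega>) e e') - expectation (\<lambda>\<omega>. D2 (W (- (nbhd k \<union> nbhd k')) \<omega>) e e')))"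
  proof
    fix \<omega>'
    have E: "expectation (\<lambda>\<omega>. D2 (W J \<omega>) b c) = (\<Sum>e\<in>Basis. \<Sum>e'\<in>Basis. (b \<bullet> e) * (c \<bullet> e') *
        expectation (\<lambda>\<omega>. D2 (W J \<omega>) e e'))" for J b c
      by (subst D2_sum_Basis, subst Bochner_Integration.integral_sum)
        (auto intro!: Bochner_Integration.integrable_sum integrable_mult_right integrable_D2_const sum.cong
          trans[OF Bochner_Integration.integral_sum])
    have "R3 k k' \<omega>' = expectation (\<lambda>\<omega>. D2 (W UNIV \<omega>) (Y k \<omega>') (Y k' \<omega>'))
        - expectation (\<lambda>\<omega>. D2 (W (- (nbhd k \<union> nbhd k')) \<omega>) (Y k \<omega>') (Y k' \<omega>'))"
      unfolding R3_def by (intro Bochner_Integration.integral_diff integrable_D2_const)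
    then show "R3 k k' \<omega>' = (\<Sum>e\<in>Basis. \<Sum>e'\<in>Basis. (Y k \<omega>' \<bullet> e) * (Y k' \<omega>' \<bullet> e') *
      (expectation (\<lambda>\<omega>. D2 (W UNIV \<omega>) e e') - expectation (\<lambda>\<omega>. D2 (W (- (nbhd k \<union> nbhd k')) \<omega>) e e')))"
      by (simp only: E[of UNIV "Y k \<omega>'" "Y k' \<omega>'"] E[of "- (nbhd k \<union> nbhd k')" "Y k \<omega>'" "Y k' \<omega>'"]
          right_diff_distrib sum_subtractf)
  qed
  then show ?thesis
    by (simp add: integrable_Y_Y Bochner_Integration.integral_sum Bochner_Integration.integrable_sum)
qed

text \<open>The radial term splits over k. Expanding at the sum without the neighbourhood of k, the
  zeroth order vanishes by \<open>indep1\<close>; the first-order terms, once both neighbourhoods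
  are removed, factor into a covariance and an expected second derivative. Since the covariances sum
  to the identity, the Laplacian has the same form with the full sum, and the difference consists of
  \<open>R3\<close>, \<open>R2\<close> and \<open>R1\<close>. In units of L \<beta> \<alpha>^2 they
  contribute at most D ((2 D - 1) + (D - 1)) + D^2 / 2 for each k.\<close>

theorem stein_local_dependence:
  "\<bar>(\<Sum>e\<in>Basis. expectation (\<lambda>\<omega>. D2 (W UNIV \<omega>) e e)) - expectation (\<lambda>\<omega>. D1 (W UNIV \<omega>) (W UNIV \<omega>))\<bar>
    \<le> L * \<beta> * \<alpha>\<^sup>2 * (CARD('q) * (D * (7/2 * D - 2)))"
proof -
  let ?E2 = "\<lambda>e e'. expectation (\<lambda>\<omega>. D2 (W UNIV \<omega>) e e')"
  let ?C = "\<lambda>k k' e e'. expectation (\<lambda>\<omega>. (Y k \<omega> \<bullet> e) * (Y k' \<omega> \<bullet> e'))"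
  have "(\<Sum>e\<in>Basis. ?E2 e e) = (\<Sum>e\<in>Basis. \<Sum>e'\<in>Basis. (e \<bullet> e') * ?E2 e e')"
    by (intro sum.cong refl) (simp add: inner_Basis if_distrib[of "\<lambda>x. x * _"] cong: if_cong)
  also have "\<dots> = (\<Sum>e\<in>Basis. \<Sum>e'\<in>Basis. \<Sum>k\<in>UNIV. \<Sum>k'\<in>nbhd k. ?C k k' e e' * ?E2 e e')"
    by (intro sum.cong refl) (simp add: cov[symmetric] sum_distrib_right)
  also have "\<dots> = (\<Sum>k\<in>UNIV. \<Sum>k'\<in>nbhd k. \<Sum>e\<in>Basis. \<Sum>e'\<in>Basis. ?C k k' e e' * ?E2 e e')"
    by (subst sum.swap[of _ UNIV], subst sum.swap[of _ UNIV], subst sum.swap[of _ "nbhd _"],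
        subst sum.swap[of _ "nbhd _"]) (rule refl)
  finally have lap: "(\<Sum>e\<in>Basis. ?E2 e e) = (\<Sum>k\<in>UNIV. \<Sum>k'\<in>nbhd k. \<Sum>e\<in>Basis. \<Sum>e'\<in>Basis. ?C k k' e e' * ?E2 e e')" .
  have main: "expectation (\<lambda>\<omega>. D1 (W UNIV \<omega>) (Y k \<omega>)) = expectation (R1 k) +
      (\<Sum>k'\<in>nbhd k. expectation (R2 k k') +
        expectation (\<lambda>\<omega>. D2 (W (- (nbhd k \<union> nbhd k')) \<omega>) (Y k \<omega>) (Y k' \<omega>)))" for k
  proof -
    have d2: "D2 (W (- nbhd k) \<omega>) (Y k \<omega>) (W (nbhd k) \<omega>) =
        (\<Sum>k'\<in>nbhd k. D2 (W (- nbhd k) \<omega>) (Y k \<omega>) (Y k' \<omega>))" for \<omega>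
      unfolding W_def[of "nbhd k"] by (rule linear_sum[OF linear_D2_right])
    have "expectation (\<lambda>\<omega>. D1 (W (- nbhd k) \<omega>) (Y k \<omega>)) = 0"
    proof -
      have "expectation (\<lambda>\<omega>. D1 (W (- nbhd k) \<omega>) (Y k \<omega>)) =
          (\<Sum>e\<in>Basis. expectation (\<lambda>\<omega>. (Y k \<omega> \<bullet> e) * D1 (W (- nbhd k) \<omega>) e))"
        by (subst D1_sum_Basis, subst Bochner_Integration.integral_sum)
          (auto intro!: integrable_Y_mult integrable_W D1_bounded)
      also have "\<dots> = 0"
        using indep1[OF measurable_D1 D1_bounded] by (simp add: W_def)
      finally show ?thesis .
    qed
    moreover have "expectation (R1 k) = expectation (\<lambda>\<omega>. D1 (W UNIV \<omega>) (Y k \<omega>))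
        - expectation (\<lambda>\<omega>. D1 (W (- nbhd k) \<omega>) (Y k \<omega>))
        - (\<Sum>k'\<in>nbhd k. expectation (\<lambda>\<omega>. D2 (W (- nbhd k) \<omega>) (Y k \<omega>) (Y k' \<omega>)))"
      unfolding R1_def d2
      by (simp add: integrable_D1 integrable_D2 Bochner_Integration.integral_sum Bochner_Integration.integrable_sum)
    moreover have "expectation (R2 k k') = expectation (\<lambda>\<omega>. D2 (W (- nbhd k) \<omega>) (Y k \<omega>) (Y k' \<omega>))
        - expectation (\<lambda>\<omega>. D2 (W (- (nbhd k \<union> nbhd k')) \<omega>) (Y k \<omega>) (Y k' \<omega>))" for k'
      unfolding R2_def by (rule Bochner_Integration.integral_diff) (rule integrable_D2)+
    ultimately show ?thesis by simp
  qed
  have "expectation (\<lambda>\<omega>. D1 (W UNIV \<omega>) (W UNIV \<omega>)) = (\<Sum>k\<in>UNIV. expectation (\<lambda>\<omega>. D1 (W UNIV \<omega>) (Y k \<omega>)))"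
  proof -
    have "D1 (W UNIV \<omega>) (W UNIV \<omega>) = (\<Sum>k\<in>UNIV. D1 (W UNIV \<omega>) (Y k \<omega>))" for \<omega>
      by (subst (2) W_def) (rule linear_sum[OF linear_D1])
    then show ?thesis by (simp add: Bochner_Integration.integral_sum integrable_D1)
  qed
  also have "\<dots> = (\<Sum>k\<in>UNIV. expectation (R1 k) + (\<Sum>k'\<in>nbhd k. expectation (R2 k k') +
      (\<Sum>e\<in>Basis. \<Sum>e'\<in>Basis. ?C k k' e e' * expectation (\<lambda>\<omega>. D2 (W (- (nbhd k \<union> nbhd k')) \<omega>) e e'))))"
    by (simp only: main expectation_D2_split)
  finally have "(\<Sum>e\<in>Basis. ?E2 e e) - expectation (\<lambda>\<omega>. D1 (W UNIV \<omega>) (W UNIV \<omega>))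
      = (\<Sum>k\<in>UNIV. (\<Sum>k'\<in>nbhd k. expectation (R3 k k') - expectation (R2 k k')) - expectation (R1 k))"
    unfolding lap expectation_R3
    by (simp add: sum_subtractf sum.distrib right_diff_distrib)
  also have "\<bar>\<dots>\<bar> \<le> (\<Sum>k\<in>(UNIV::'q set). L * \<beta> * \<alpha>\<^sup>2 * (D * (7/2 * D - 2)))"
  proof (rule order_trans[OF sum_abs], rule sum_mono)
    fix k
    have "\<bar>\<Sum>k'\<in>nbhd k. expectation (R3 k k') - expectation (R2 k k')\<bar>
        \<le> (\<Sum>k'\<in>nbhd k. L * \<beta> * \<alpha>\<^sup>2 * (3 * real D - 2))"
    proof (rule order_trans[OF sum_abs], rule sum_mono)
      fix k' assume k': "k' \<in> nbhd k"
      have "\<bar>expectation (R3 k k')\<bar> \<le> L * \<beta> * \<alpha>\<^sup>2 * (2 * real D - 1)"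
        using R3_bound k' by (intro abs_expectation_le)
      moreover have "\<bar>expectation (R2 k k')\<bar> \<le> L * \<beta> * \<alpha>\<^sup>2 * (real D - 1)"
        using R2_bound k' by (intro abs_expectation_le)
      ultimately have "\<bar>expectation (R3 k k') - expectation (R2 k k')\<bar>
          \<le> L * \<beta> * \<alpha>\<^sup>2 * (2 * real D - 1) + L * \<beta> * \<alpha>\<^sup>2 * (real D - 1)" by linarith
      also have "\<dots> = L * \<beta> * \<alpha>\<^sup>2 * (3 * real D - 2)" by (simp add: algebra_simps)
      finally show "\<bar>expectation (R3 k k') - expectation (R2 k k')\<bar> \<le> L * \<beta> * \<alpha>\<^sup>2 * (3 * real D - 2)" .
    qed
    also have "\<dots> = card (nbhd k) * (L * \<beta> * \<alpha>\<^sup>2 * (3 * real D - 2))" by simp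
    also have "\<dots> \<le> D * (L * \<beta> * \<alpha>\<^sup>2 * (3 * real D - 2))"
      using card_nbhd[of k] L\<alpha>\<beta> D_pos by (intro mult_right_mono mult_nonneg_nonneg[OF L\<alpha>\<beta>]) auto
    finally have "\<bar>\<Sum>k'\<in>nbhd k. expectation (R3 k k') - expectation (R2 k k')\<bar>
        \<le> D * (L * \<beta> * \<alpha>\<^sup>2 * (3 * real D - 2))" .
    moreover have "\<bar>expectation (R1 k)\<bar> \<le> L * \<beta> * \<alpha>\<^sup>2 * (real D * real D / 2)"
      using R1_bound by (intro abs_expectation_le)
    ultimately have "\<bar>(\<Sum>k'\<in>nbhd k. expectation (R3 k k') - expectation (R2 k k')) - expectation (R1 k)\<bar>
        \<le> D * (L * \<beta> * \<alpha>\<^sup>2 * (3 * real D - 2)) + L * \<beta> * \<alpha>\<^sup>2 * (real D * real D / 2)" by linarith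
    also have "\<dots> = L * \<beta> * \<alpha>\<^sup>2 * (D * (7/2 * D - 2))" by (simp add: algebra_simps)
    finally show "\<bar>(\<Sum>k'\<in>nbhd k. expectation (R3 k k') - expectation (R2 k k')) - expectation (R1 k)\<bar>
        \<le> L * \<beta> * \<alpha>\<^sup>2 * (D * (7/2 * D - 2))" .
  qed
  also have "\<dots> = L * \<beta> * \<alpha>\<^sup>2 * (CARD('q) * (D * (7/2 * D - 2)))"
    by (simp add: mult_ac)
  finally show ?thesis .
qed

end

section \<open>Rotating a sum into a Gaussian vector\<close>

context lipschitz_function
begin

lemma gauss_smooth_rotate_lipschitz:
  "\<bar>gauss_smooth s h x - gauss_smooth t h y\<bar>
    \<le> \<Lambda> * (norm (x - y) + \<bar>s - t\<bar> * (\<integral>w. norm w \<partial>(std_gauss :: 'a measure)))"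
proof -
  have int: "integrable std_gauss (norm :: 'a \<Rightarrow> real)" by (intro integrable_std_gauss) auto
  have "gauss_smooth s h x - gauss_smooth t h y = (\<integral>w. h (x + s *\<^sub>R w) - h (y + t *\<^sub>R w) \<partial>std_gauss)"
    unfolding gauss_smooth_def
    by (rule Bochner_Integration.integral_diff[symmetric]) (rule integrable_h)+
  then have "\<bar>gauss_smooth s h x - gauss_smooth t h y\<bar> \<le> (\<integral>w. \<bar>h (x + s *\<^sub>R w) - h (y + t *\<^sub>R w)\<bar> \<partial>std_gauss)"
    using integral_abs_bound[of std_gauss "\<lambda>w. h (x + s *\<^sub>R w) - h (y + t *\<^sub>R w)"] by simp
  also have "\<dots> \<le> (\<integral>w. \<Lambda> * norm (x - y) + \<Lambda> * \<bar>s - t\<bar> * norm w \<partial>(std_gauss :: 'a measure))"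
  proof (intro integral_mono)
    fix w
    have "(x + s *\<^sub>R w) - (y + t *\<^sub>R w) = (x - y) + (s - t) *\<^sub>R w" by (simp add: algebra_simps)
    then have "norm ((x + s *\<^sub>R w) - (y + t *\<^sub>R w)) \<le> norm (x - y) + \<bar>s - t\<bar> * norm w"
      by (metis norm_scaleR norm_triangle_ineq)
    from order_trans[OF lipschitz mult_left_mono[OF this \<Lambda>_nonneg]]
    show "\<bar>h (x + s *\<^sub>R w) - h (y + t *\<^sub>R w)\<bar> \<le> \<Lambda> * norm (x - y) + \<Lambda> * \<bar>s - t\<bar> * norm w"
      by (simp add: distrib_left mult.assoc)
  qed (auto intro!: integrable_h integrable_abs Bochner_Integration.integrable_diff int
      Bochner_Integration.integrable_add integrable_mult_right)
  also have "\<dots> = \<Lambda> * (norm (x - y) + \<bar>s - t\<bar> * (\<integral>w. norm w \<partial>(std_gauss :: 'a measure)))"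
    using int by (simp add: std_gauss.prob_space[simplified] distrib_left mult.assoc)
  finally show ?thesis .
qed

lemma sin_cos_lipschitz: "\<bar>sin a - sin b\<bar> \<le> \<bar>a - b\<bar>" "\<bar>cos a - cos b\<bar> \<le> \<bar>a - b\<bar>" for a b :: real
proof -
  have "norm (sin a - sin b) \<le> 1 * norm (a - b)"
    by (rule field_differentiable_bound[of UNIV]) (auto intro!: derivative_eq_intros)
  then show "\<bar>sin a - sin b\<bar> \<le> \<bar>a - b\<bar>" by simp
  have "norm (cos a - cos b) \<le> 1 * norm (a - b)"
    by (rule field_differentiable_bound[of UNIV _ "\<lambda>x. - sin x"]) (auto intro!: derivative_eq_intros)
  then show "\<bar>cos a - cos b\<bar> \<le> \<bar>a - b\<bar>" by simp
qed

lemma gauss_rotation_lipschitz: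
  "\<bar>gauss_smooth (sin a) h (cos a *\<^sub>R x) - gauss_smooth (sin b) h (cos b *\<^sub>R x)\<bar>
    \<le> \<bar>a - b\<bar> * (\<Lambda> * (norm x + (\<integral>w. norm w \<partial>(std_gauss :: 'a measure))))"
proof -
  let ?m = "\<integral>w. norm w \<partial>(std_gauss :: 'a measure)"
  have m: "?m \<ge> 0" by simp
  have "norm (cos a *\<^sub>R x - cos b *\<^sub>R x) + \<bar>sin a - sin b\<bar> * ?m \<le> \<bar>a - b\<bar> * norm x + \<bar>a - b\<bar> * ?m"
    using sin_cos_lipschitz m
    by (intro add_mono mult_right_mono) (auto simp flip: scaleR_diff_left intro!: mult_right_mono)
  from order_trans[OF gauss_smooth_rotate_lipschitz mult_left_mono[OF this \<Lambda>_nonneg]]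
  show ?thesis by (simp add: algebra_simps)
qed

text \<open>The curve cos \<theta> x + sin \<theta> w has velocity - sin \<theta> x + cos \<theta>
  w. Integration by parts in each basis direction turns the factor w into second derivatives, which
  gives the Ornstein-Uhlenbeck form: a radial derivative against a Laplacian.\<close>

lemma gauss_rotation_derivative:
  assumes s: "sin \<theta> > 0" and h': "\<And>x. (h has_derivative h' x) (at x)"
    and [measurable]: "\<And>b. (\<lambda>x. h' x b) \<in> borel_measurable borel"
    and h'_bound: "\<And>b. \<exists>C. \<forall>x. \<bar>h' x b\<bar> \<le> C"
  shows "((\<lambda>\<theta>. gauss_smooth (sin \<theta>) h (cos \<theta> *\<^sub>R x)) has_real_derivative
    - sin \<theta> * gauss_D1 (sin \<theta>) h (cos \<theta> *\<^sub>R x) x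
    + cos \<theta> * sin \<theta> * (\<Sum>e\<in>Basis. gauss_D2 (sin \<theta>) h (cos \<theta> *\<^sub>R x) e e)) (at \<theta>)"
proof -
  have int: "integrable std_gauss (norm :: 'a \<Rightarrow> real)" by (intro integrable_std_gauss) auto
  have lin: "linear (h' y)" for y using has_derivative_linear[OF h'] .
  have ib: "integrable std_gauss (\<lambda>w. h' (y + r *\<^sub>R w) b)" for y r b
  proof -
    obtain C where "\<And>x. \<bar>h' x b\<bar> \<le> C" using h'_bound by blast
    then show ?thesis by (intro std_gauss.integrable_const_bound[where B = C]) auto
  qed
  have ibw: "integrable std_gauss (\<lambda>w. h' (y + r *\<^sub>R w) b * (b \<bullet> w))" for y r b
  proof (rule integrable_std_gauss)
    obtain C where C: "\<And>x. \<bar>h' x b\<bar> \<le> C" using h'_bound by blast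
    have "exp_bounded (\<lambda>w. h' (y + r *\<^sub>R w) b)"
      by (rule exp_bounded_mono[OF exp_bounded_const[of C]]) (meson C abs_ge_self order_trans)
    then show "exp_bounded (\<lambda>w. h' (y + r *\<^sub>R w) b * (b \<bullet> w))"
      by (intro exp_bounded_mult exp_bounded_inner)
  qed measurable
  let ?y = "\<lambda>w. cos \<theta> *\<^sub>R x + sin \<theta> *\<^sub>R w"
  let ?f' = "\<lambda>w. - sin \<theta> * h' (?y w) x + cos \<theta> * (\<Sum>e\<in>Basis. h' (?y w) e * (e \<bullet> w))"
  have "((\<lambda>\<theta>. \<integral>w. h (cos \<theta> *\<^sub>R x + sin \<theta> *\<^sub>R w) \<partial>std_gauss) has_real_derivative (\<integral>w. ?f' w \<partial>std_gauss)) (at \<theta>)"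
  proof (rule has_real_derivative_integral[where d = 1 and B = "\<lambda>w. \<Lambda> * (norm x + norm w)"])
    show "?f' \<in> borel_measurable std_gauss" by measurable
    show "integrable std_gauss (\<lambda>w. \<Lambda> * (norm x + norm w))" by (intro integrable_std_gauss) auto
    show "integrable std_gauss (\<lambda>w. h (cos r *\<^sub>R x + sin r *\<^sub>R w))" for r by (rule integrable_h)
    fix w :: 'a
    have "((\<lambda>\<theta>. h (cos \<theta> *\<^sub>R x + sin \<theta> *\<^sub>R w)) has_derivative
        (\<lambda>r. h' (?y w) (r *\<^sub>R (- sin \<theta> *\<^sub>R x + cos \<theta> *\<^sub>R w)))) (at \<theta>)"
      by (rule has_derivative_compose[OF _ h']) (auto intro!: derivative_eq_intros simp: scaleR_add_right algebra_simps)
    moreover have "h' (?y w) (r *\<^sub>R (- sin \<theta> *\<^sub>R x + cos \<theta> *\<^sub>R w)) = ?f' w * r" for r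
    proof -
      have "h' (?y w) w = (\<Sum>e\<in>Basis. h' (?y w) e * (e \<bullet> w))"
        by (subst linear_sum_Basis[OF lin]) (simp add: inner_commute mult.commute)
      then show ?thesis
        using lin[of "?y w"] by (simp add: linear_scale linear_add linear_diff linear_neg algebra_simps)
    qed
    ultimately show "((\<lambda>\<theta>. h (cos \<theta> *\<^sub>R x + sin \<theta> *\<^sub>R w)) has_real_derivative ?f' w) (at \<theta>)"
      by (simp add: has_field_derivative_def)
    fix r
    have 1: "norm ((cos r - cos \<theta>) *\<^sub>R x + (sin r - sin \<theta>) *\<^sub>R w) \<le> \<bar>r - \<theta>\<bar> * norm x + \<bar>r - \<theta>\<bar> * norm w"
      using sin_cos_lipschitz[of r \<theta>]
      by (intro order_trans[OF norm_triangle_ineq] add_mono) (auto intro!: mult_right_mono)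
    have 2: "\<bar>h (cos r *\<^sub>R x + sin r *\<^sub>R w) - h (?y w)\<bar> \<le> \<Lambda> * norm ((cos r - cos \<theta>) *\<^sub>R x + (sin r - sin \<theta>) *\<^sub>R w)"
      using lipschitz[of "cos r *\<^sub>R x + sin r *\<^sub>R w" "?y w"] by (simp add: algebra_simps)
    from order_trans[OF 2 mult_left_mono[OF 1 \<Lambda>_nonneg]]
    show "\<bar>h (cos r *\<^sub>R x + sin r *\<^sub>R w) - h (?y w)\<bar> \<le> \<bar>r - \<theta>\<bar> * (\<Lambda> * (norm x + norm w))"
      by (simp add: algebra_simps)
  qed simp
  also have "(\<integral>w. ?f' w \<partial>std_gauss) = - sin \<theta> * (\<integral>w. h' (?y w) x \<partial>std_gauss)
      + cos \<theta> * (\<Sum>e\<in>Basis. (\<integral>w. h' (?y w) e * (e \<bullet> w) \<partial>std_gauss))"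
    using ib ibw by (simp add: Bochner_Integration.integral_sum Bochner_Integration.integrable_sum)
  also have "\<dots> = - sin \<theta> * gauss_D1 (sin \<theta>) h (cos \<theta> *\<^sub>R x) x
      + cos \<theta> * (\<Sum>e\<in>Basis. sin \<theta> * gauss_D2 (sin \<theta>) h (cos \<theta> *\<^sub>R x) e e)"
    using gauss_D1_eq_integral_derivative[OF s h'] by simp
  finally show ?thesis
    by (simp add: gauss_smooth_def sum_distrib_left[symmetric] mult.assoc)
qed

text \<open>The constant \<open>h x\<close> may be subtracted because linear functions have Gaussian
  mean 0; the Lipschitz property then bounds the rest uniformly in x.
  \<open>gauss_rotation_derivative\<close> asks for such a bound on the derivative of its
  function.\<close>

lemma gauss_D1_bounded:
  assumes "s > 0"
  shows "\<exists>C. \<forall>x. \<bar>gauss_D1 s h x b\<bar> \<le> C"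
proof (intro exI allI)
  fix x
  have "\<bar>\<integral>w. (h (x + s *\<^sub>R w) - h x) * (b \<bullet> w) \<partial>std_gauss\<bar>
      \<le> (\<integral>w. \<bar>(h (x + s *\<^sub>R w) - h x) * (b \<bullet> w)\<bar> \<partial>std_gauss)"
    by (rule integral_abs_bound)
  also have "\<dots> \<le> (\<integral>w. (\<Lambda> * s * norm b) * (norm w)\<^sup>2 \<partial>(std_gauss :: 'a measure))"
  proof (intro integral_mono)
    show "integrable std_gauss (\<lambda>w. \<bar>(h (x + s *\<^sub>R w) - h x) * (b \<bullet> w)\<bar>)"
      unfolding left_diff_distrib
      by (intro integrable_abs Bochner_Integration.integrable_diff integrable_h_mult integrable_std_gauss) auto
    show "integrable std_gauss (\<lambda>w::'a. (\<Lambda> * s * norm b) * (norm w)\<^sup>2)"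
      by (intro integrable_std_gauss) auto
    fix w
    have "\<bar>h (x + s *\<^sub>R w) - h x\<bar> \<le> \<Lambda> * (s * norm w)"
      using lipschitz[of "x + s *\<^sub>R w" x] assms by simp
    then have "\<bar>h (x + s *\<^sub>R w) - h x\<bar> * \<bar>b \<bullet> w\<bar> \<le> \<Lambda> * (s * norm w) * (norm b * norm w)"
      using Cauchy_Schwarz_ineq2[of b w] assms \<Lambda>_nonneg by (intro mult_mono) auto
    then show "\<bar>(h (x + s *\<^sub>R w) - h x) * (b \<bullet> w)\<bar> \<le> (\<Lambda> * s * norm b) * (norm w)\<^sup>2"
      by (simp add: abs_mult power2_eq_square mult_ac)
  qed
  also have "\<dots> = \<Lambda> * s * norm b * DIM('a)" by (simp add: norm_moment_2)
  also have "(\<integral>w. (h (x + s *\<^sub>R w) - h x) * (b \<bullet> w) \<partial>std_gauss) = (\<integral>w. h (x + s *\<^sub>R w) * (b \<bullet> w) \<partial>std_gauss)"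
  proof -
    have "(\<integral>w. h (x + s *\<^sub>R w) * (b \<bullet> w) - h x * (b \<bullet> w) \<partial>std_gauss)
        = (\<integral>w. h (x + s *\<^sub>R w) * (b \<bullet> w) \<partial>std_gauss) - (\<integral>w. h x * (b \<bullet> w) \<partial>std_gauss)"
      by (intro Bochner_Integration.integral_diff integrable_h_mult integrable_std_gauss) auto
    then show ?thesis by (simp add: left_diff_distrib gauss_moment_1)
  qed
  finally have "\<bar>\<integral>w. h (x + s *\<^sub>R w) * (b \<bullet> w) \<partial>std_gauss\<bar> / s \<le> \<Lambda> * s * norm b * DIM('a) / s"
    using assms by (intro divide_right_mono) auto
  then show "\<bar>gauss_D1 s h x b\<bar> \<le> \<Lambda> * s * norm b * DIM('a) / s"
    using assms by (simp add: gauss_D1_def)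
qed

end

text \<open>Derivatives are demanded on the open interval only: in \<open>rotation_bound\<close> the
  right endpoint is pi / 2, where the expression for \<open>\<Phi>'\<close> divides by cos =
  0.\<close>

lemma abs_diff_le_of_derivative_le:
  fixes f g :: "real \<Rightarrow> real"
  assumes "a \<le> b" and f: "continuous_on {a..b} f" and g: "continuous_on {a..b} g"
    and f': "\<And>x. a < x \<Longrightarrow> x < b \<Longrightarrow> (f has_real_derivative f' x) (at x)"
    and g': "\<And>x. a < x \<Longrightarrow> x < b \<Longrightarrow> (g has_real_derivative g' x) (at x)"
    and le: "\<And>x. a < x \<Longrightarrow> x < b \<Longrightarrow> \<bar>f' x\<bar> \<le> g' x"
  shows "\<bar>f b - f a\<bar> \<le> g b - g a"
proof -
  have "(\<lambda>x. g x - f x) a \<le> (\<lambda>x. g x - f x) b"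
  proof (rule DERIV_nonneg_imp_increasing_open[OF \<open>a \<le> b\<close>])
    fix x assume "a < x" "x < b"
    then show "\<exists>y. ((\<lambda>x. g x - f x) has_real_derivative y) (at x) \<and> y \<ge> 0"
      using le[of x] by (intro exI[of _ "g' x - f' x"] conjI DERIV_diff f' g') auto
  qed (intro continuous_on_diff f g)
  moreover have "(\<lambda>x. g x + f x) a \<le> (\<lambda>x. g x + f x) b"
  proof (rule DERIV_nonneg_imp_increasing_open[OF \<open>a \<le> b\<close>])
    fix x assume "a < x" "x < b"
    then show "\<exists>y. ((\<lambda>x. g x + f x) has_real_derivative y) (at x) \<and> y \<ge> 0"
      using le[of x] by (intro exI[of _ "g' x + f' x"] conjI DERIV_add f' g') auto
  qed (intro continuous_on_add f g)
  ultimately show ?thesis by linarith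
qed

text \<open>Chain rule for the function x to gauss_smooth s g (c x): each derivative brings one
  factor c, and the displacement in the modulus of the second derivative brings a third.\<close>

lemma lipschitz_hessian_gauss_smooth:
  fixes g :: "'a::euclidean_space \<Rightarrow> real"
  assumes "lipschitz_function g \<Lambda>" and S: "linear S"
    and g: "\<And>x a. \<bar>g (x + a) - g x\<bar> \<le> norm (S a)" and s: "s > 0" and c: "c \<ge> 0"
  shows "lipschitz_hessian (\<lambda>x b. c * gauss_D1 s g (c *\<^sub>R x) b)
    (\<lambda>x a b. c\<^sup>2 * gauss_D2 s g (c *\<^sub>R x) a b) S (4/3 * c ^ 3 / s\<^sup>2) (c\<^sup>2 * (\<Lambda> / s))"
proof -
  interpret lipschitz_function g \<Lambda> by fact
  show ?thesis
  proof (rule lipschitz_hessian.intro)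
    fix x y a b d :: 'a
    show "linear (\<lambda>b. c * gauss_D1 s g (c *\<^sub>R x) b)"
      using linear_gauss_D1[of s "c *\<^sub>R x"]
      by (intro linearI) (simp_all add: linear_add linear_scale algebra_simps)
    show "linear (\<lambda>a. c\<^sup>2 * gauss_D2 s g (c *\<^sub>R x) a b)"
      using linear_gauss_D2_left[of s "c *\<^sub>R x" b]
      by (intro linearI) (simp_all add: linear_add[of "\<lambda>a. gauss_D2 s g (c *\<^sub>R x) a b"]
          linear_scale[of "\<lambda>a. gauss_D2 s g (c *\<^sub>R x) a b"] algebra_simps)
    show "linear (\<lambda>b. c\<^sup>2 * gauss_D2 s g (c *\<^sub>R x) a b)"
      using linear_gauss_D2_right[of s "c *\<^sub>R x" a]
      by (intro linearI) (simp_all add: linear_add linear_scale algebra_simps)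
    have "((\<lambda>r. gauss_D1 s g (c *\<^sub>R x + r *\<^sub>R (c *\<^sub>R d)) b) has_real_derivative
        gauss_D2 s g (c *\<^sub>R x) b (c *\<^sub>R d)) (at 0)"
      using s by (intro gauss_D1_derivative) auto
    then have "((\<lambda>r. c * gauss_D1 s g (c *\<^sub>R x + r *\<^sub>R (c *\<^sub>R d)) b) has_real_derivative
        c * gauss_D2 s g (c *\<^sub>R x) b (c *\<^sub>R d)) (at 0)"
      by (rule DERIV_cmult)
    then show "((\<lambda>r. c * gauss_D1 s g (c *\<^sub>R (x + r *\<^sub>R d)) b) has_real_derivative
        c\<^sup>2 * gauss_D2 s g (c *\<^sub>R x) b d) (at 0)"
      using linear_gauss_D2_right[of s "c *\<^sub>R x" b]
      by (simp add: linear_scale scaleR_add_right mult.commute power2_eq_square mult.assoc)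
    have "c * \<bar>gauss_D1 s g (c *\<^sub>R x) b - gauss_D1 s g (c *\<^sub>R y) b\<bar>
        \<le> c * (\<Lambda> / s * norm b * norm (c *\<^sub>R x - c *\<^sub>R y))"
      using c by (intro mult_left_mono gauss_D1_lipschitz s)
    also have "norm (c *\<^sub>R x - c *\<^sub>R y) = c * norm (x - y)"
      using c by (simp flip: scaleR_diff_right)
    finally have "\<bar>c * (gauss_D1 s g (c *\<^sub>R x) b - gauss_D1 s g (c *\<^sub>R y) b)\<bar>
        \<le> c * (\<Lambda> / s * norm b * (c * norm (x - y)))"
      using c by (simp add: abs_mult)
    then show "\<bar>c * gauss_D1 s g (c *\<^sub>R x) b - c * gauss_D1 s g (c *\<^sub>R y) b\<bar>
        \<le> c\<^sup>2 * (\<Lambda> / s) * norm b * norm (x - y)"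
      by (simp add: right_diff_distrib power2_eq_square mult_ac)
    have "c\<^sup>2 * \<bar>gauss_D2 s g (c *\<^sub>R x + c *\<^sub>R a) b d - gauss_D2 s g (c *\<^sub>R x) b d\<bar>
        \<le> c\<^sup>2 * (4/3 * norm (S (c *\<^sub>R a)) / s\<^sup>2 * norm b * norm d)"
      by (intro mult_left_mono gauss_D2_lipschitz g) auto
    also have "norm (S (c *\<^sub>R a)) = c * norm (S a)"
      using c S by (simp add: linear_scale)
    finally have "\<bar>c\<^sup>2 * (gauss_D2 s g (c *\<^sub>R x + c *\<^sub>R a) b d - gauss_D2 s g (c *\<^sub>R x) b d)\<bar>
        \<le> c\<^sup>2 * (4/3 * (c * norm (S a)) / s\<^sup>2 * norm b * norm d)"
      by (simp add: abs_mult)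
    then show "\<bar>c\<^sup>2 * gauss_D2 s g (c *\<^sub>R (x + a)) b d - c\<^sup>2 * gauss_D2 s g (c *\<^sub>R x) b d\<bar>
        \<le> 4/3 * c ^ 3 / s\<^sup>2 * norm (S a) * norm b * norm d"
      by (simp add: right_diff_distrib scaleR_add_right power2_eq_square power3_eq_cube mult_ac)
    show "linear S" by fact
    show "0 \<le> 4/3 * c ^ 3 / s\<^sup>2" using c by simp
  qed
qed

context local_dependence_test
begin

lemma integrable_D1_W: "integrable M (\<lambda>\<omega>. D1 (W UNIV \<omega>) (W UNIV \<omega>))"
proof -
  have "D1 (W UNIV \<omega>) (W UNIV \<omega>) = (\<Sum>k\<in>UNIV. D1 (W UNIV \<omega>) (Y k \<omega>))" for \<omega>
    by (subst (2) W_def) (rule linear_sum[OF linear_D1])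
  then show ?thesis by (simp add: integrable_D1)
qed

end

context local_dependence
begin

abbreviation X :: "'a \<Rightarrow> 'b"
  where "X \<equiv> W UNIV"

lemma norm_X: "\<omega> \<in> space M \<Longrightarrow> norm (X \<omega>) \<le> CARD('q) * \<alpha>"
  by (rule norm_W)

lemma lipschitz_bounded_on_balls:
  fixes \<psi> :: "'b \<Rightarrow> real"
  assumes "\<And>x y. \<bar>\<psi> x - \<psi> y\<bar> \<le> \<Lambda> * norm (x - y)"
  shows "\<exists>C. \<forall>x. norm x \<le> R \<longrightarrow> \<bar>\<psi> x\<bar> \<le> C"
proof (intro exI allI impI)
  fix x :: 'b assume "norm x \<le> R"
  have "\<Lambda> * norm x \<le> \<bar>\<Lambda>\<bar> * R" using \<open>norm x \<le> R\<close> by (intro mult_mono) auto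
  then show "\<bar>\<psi> x\<bar> \<le> \<bar>\<psi> 0\<bar> + \<bar>\<Lambda>\<bar> * R" using assms[of x 0] by auto
qed

lemma integrable_lipschitz_X:
  fixes \<psi> :: "'b \<Rightarrow> real"
  assumes "\<And>x y. \<bar>\<psi> x - \<psi> y\<bar> \<le> \<Lambda> * norm (x - y)"
  shows "integrable M (\<lambda>\<omega>. \<psi> (X \<omega>))"
  by (rule integrable_W) (rule lipschitz_measurable[OF assms] lipschitz_bounded_on_balls[OF assms])+

text \<open>At pi / 2 the rotated law is exactly Gaussian. The derivative in \<theta> is tan
  \<theta> times a Stein discrepancy whose test function has a Hessian of modulus 4/3 cos^3 \<theta>
  / sin^2 \<theta>; it is therefore bounded by a multiple of cos \<theta> / sin \<theta>, the
  derivative of ln (sin \<theta>).\<close>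

theorem rotation_bound:
  fixes g :: "'b \<Rightarrow> real"
  assumes "lipschitz_function g \<Lambda>"
    and g: "\<And>x a. \<bar>g (x + a) - g x\<bar> \<le> norm (S a)"
    and g': "\<And>x. (g has_derivative g' x) (at x)"
    and [measurable]: "\<And>b. (\<lambda>x. g' x b) \<in> borel_measurable borel"
    and g'_bound: "\<And>b. \<exists>C. \<forall>x. \<bar>g' x b\<bar> \<le> C"
    and t: "0 < t" "t \<le> pi / 2"
  shows "\<bar>expectation (\<lambda>\<omega>. gauss_smooth (sin t) g (cos t *\<^sub>R X \<omega>)) - (\<integral>w. g w \<partial>std_gauss)\<bar>
    \<le> 4/3 * (\<beta> * \<alpha>\<^sup>2 * (CARD('q) * (D * (7/2 * D - 2)))) * ln (1 / sin t)"
proof -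
  interpret lipschitz_function g \<Lambda> by fact
  let ?m = "\<integral>w. norm w \<partial>(std_gauss :: 'b measure)"
  define C where "C = \<beta> * \<alpha>\<^sup>2 * (CARD('q) * (D * (7/2 * D - 2)))"
  have D1: "real D \<ge> 1"
  proof -
    have "card (nbhd undefined) \<noteq> 0" using self_nbhd by (auto simp: card_eq_0_iff)
    then show ?thesis using card_nbhd[of undefined] by linarith
  qed
  have C: "C \<ge> 0"
    unfolding C_def using \<alpha>_nonneg \<beta>_nonneg D1 by (intro mult_nonneg_nonneg) auto
  define \<Phi> where "\<Phi> \<theta> = expectation (\<lambda>\<omega>. gauss_smooth (sin \<theta>) g (cos \<theta> *\<^sub>R X \<omega>))" for \<theta>
  \<comment> \<open>The bracket is the discrepancy of \<open>stein_local_dependence\<close> for the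
    test function x to gauss_smooth (sin \<theta>) g (cos \<theta> x). Its first and second
    derivatives carry cos \<theta> and cos^2 \<theta>, which fixes the prefactor sin \<theta> / cos
    \<theta>.\<close>
  define \<Phi>' where "\<Phi>' \<theta> = (sin \<theta> / cos \<theta>) *
    ((\<Sum>e\<in>Basis. expectation (\<lambda>\<omega>. (cos \<theta>)\<^sup>2 * gauss_D2 (sin \<theta>) g (cos \<theta> *\<^sub>R X \<omega>) e e))
      - expectation (\<lambda>\<omega>. cos \<theta> * gauss_D1 (sin \<theta>) g (cos \<theta> *\<^sub>R X \<omega>) (X \<omega>)))" for \<theta>
  define K where "K = \<Lambda> * (CARD('q) * \<alpha> + ?m)"
  have K_bound: "\<bar>gauss_smooth (sin a) g (cos a *\<^sub>R X \<omega>) - gauss_smooth (sin b) g (cos b *\<^sub>R X \<omega>)\<bar> \<le> \<bar>a - b\<bar> * K"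
    if "\<omega> \<in> space M" for a b \<omega>
    unfolding K_def
    by (rule order_trans[OF gauss_rotation_lipschitz])
      (use norm_X[OF that] \<Lambda>_nonneg in \<open>auto intro!: mult_left_mono\<close>)
  have int: "integrable M (\<lambda>\<omega>. gauss_smooth (sin \<theta>) g (cos \<theta> *\<^sub>R X \<omega>))" for \<theta>
  proof (rule integrable_lipschitz_X)
    fix x y :: 'b
    have "\<bar>gauss_smooth (sin \<theta>) g (cos \<theta> *\<^sub>R x) - gauss_smooth (sin \<theta>) g (cos \<theta> *\<^sub>R y)\<bar>
        \<le> \<Lambda> * norm (cos \<theta> *\<^sub>R x - cos \<theta> *\<^sub>R y)"
      by (rule gauss_smooth_lipschitz)
    then show "\<bar>gauss_smooth (sin \<theta>) g (cos \<theta> *\<^sub>R x) - gauss_smooth (sin \<theta>) g (cos \<theta> *\<^sub>R y)\<bar>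
        \<le> (\<Lambda> * \<bar>cos \<theta>\<bar>) * norm (x - y)"
      by (simp flip: scaleR_diff_right add: mult.assoc)
  qed
  have lip: "\<bar>\<Phi> a - \<Phi> b\<bar> \<le> K * \<bar>a - b\<bar>" for a b
  proof -
    have "\<Phi> a - \<Phi> b = expectation (\<lambda>\<omega>. gauss_smooth (sin a) g (cos a *\<^sub>R X \<omega>)
        - gauss_smooth (sin b) g (cos b *\<^sub>R X \<omega>))"
      unfolding \<Phi>_def by (rule Bochner_Integration.integral_diff[symmetric]) (rule int)+
    then show ?thesis
      using abs_expectation_le[of "\<lambda>\<omega>. gauss_smooth (sin a) g (cos a *\<^sub>R X \<omega>)
        - gauss_smooth (sin b) g (cos b *\<^sub>R X \<omega>)", OF K_bound] by (simp add: mult.commute)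
  qed
  have cont: "continuous_on A \<Phi>" for A
  proof -
    have "K \<ge> 0" unfolding K_def using \<Lambda>_nonneg \<alpha>_nonneg by simp
    then show ?thesis
      using lip by (intro lipschitz_on_continuous_on[of K] lipschitz_onI) (auto simp: dist_real_def)
  qed
  have \<theta>: "\<bar>\<Phi> (pi / 2) - \<Phi> t\<bar> \<le> 4/3 * C * ln (sin (pi / 2)) - 4/3 * C * ln (sin t)"
  proof (rule abs_diff_le_of_derivative_le[where f' = \<Phi>' and g' = "\<lambda>\<theta>. 4/3 * C * (cos \<theta> / sin \<theta>)"])
    show "t \<le> pi / 2" by fact
    have "sin \<theta> > 0" if "\<theta> \<in> {t..pi / 2}" for \<theta> using that t by (intro sin_gt_zero) auto
    then show "continuous_on {t..pi / 2} (\<lambda>\<theta>. 4/3 * C * ln (sin \<theta>))"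
      by (intro continuous_intros) (auto simp: less_le)
    fix \<theta> assume "t < \<theta>" "\<theta> < pi / 2"
    then have s: "sin \<theta> > 0" and c: "cos \<theta> > 0"
      using t by (auto intro: sin_gt_zero cos_gt_zero)
    show "((\<lambda>\<theta>. 4/3 * C * ln (sin \<theta>)) has_real_derivative 4/3 * C * (cos \<theta> / sin \<theta>)) (at \<theta>)"
      using s by (auto intro!: derivative_eq_intros)
    let ?D1 = "\<lambda>x b. cos \<theta> * gauss_D1 (sin \<theta>) g (cos \<theta> *\<^sub>R x) b"
    let ?D2 = "\<lambda>x a b. (cos \<theta>)\<^sup>2 * gauss_D2 (sin \<theta>) g (cos \<theta> *\<^sub>R x) a b"
    interpret T: local_dependence_test M Y nbhd S \<alpha> \<beta> D ?D1 ?D2 "4/3 * (cos \<theta>) ^ 3 / (sin \<theta>)\<^sup>2" "(cos \<theta>)\<^sup>2 * (\<Lambda> / sin \<theta>)"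
      using lipschitz_hessian_gauss_smooth[OF lipschitz_function_axioms linear_S g s, of "cos \<theta>"] c
      by (intro local_dependence_test.intro local_dependence_axioms) auto
    define f' where "f' \<omega> = (sin \<theta> / cos \<theta>) * ((\<Sum>e\<in>Basis. ?D2 (X \<omega>) e e) - ?D1 (X \<omega>) (X \<omega>))" for \<omega>
    have f'_int: "integrable M f'"
      unfolding f'_def
      by (intro integrable_mult_right Bochner_Integration.integrable_diff T.integrable_D1_W
          Bochner_Integration.integrable_sum T.integrable_D2_const)
    have "(\<Phi> has_real_derivative expectation f') (at \<theta>)"
      unfolding \<Phi>_def
    proof (rule has_real_derivative_integral[where d = 1 and B = "\<lambda>_. K"])
      show "f' \<in> borel_measurable M" using f'_int by measurable
      show "((\<lambda>r. gauss_smooth (sin r) g (cos r *\<^sub>R X \<omega>)) has_real_derivative f' \<omega>) (at \<theta>)" for \<omega>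
      proof -
        have "f' \<omega> = - sin \<theta> * gauss_D1 (sin \<theta>) g (cos \<theta> *\<^sub>R X \<omega>) (X \<omega>)
          + cos \<theta> * sin \<theta> * (\<Sum>e\<in>Basis. gauss_D2 (sin \<theta>) g (cos \<theta> *\<^sub>R X \<omega>) e e)"
          unfolding f'_def sum_distrib_left[symmetric] using c by (simp add: field_simps power2_eq_square)
        then show ?thesis
          using gauss_rotation_derivative[OF s g' _ g'_bound, of "X \<omega>"] by simp
      qed
    qed (use int K_bound in auto)
    also have "expectation f' = \<Phi>' \<theta>"
    proof -
      have "expectation f' = (sin \<theta> / cos \<theta>) * expectation (\<lambda>\<omega>. (\<Sum>e\<in>Basis. ?D2 (X \<omega>) e e) - ?D1 (X \<omega>) (X \<omega>))"
        unfolding f'_def by (rule integral_mult_right_zero)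
      also have "expectation (\<lambda>\<omega>. (\<Sum>e\<in>Basis. ?D2 (X \<omega>) e e) - ?D1 (X \<omega>) (X \<omega>))
          = expectation (\<lambda>\<omega>. \<Sum>e\<in>Basis. ?D2 (X \<omega>) e e) - expectation (\<lambda>\<omega>. ?D1 (X \<omega>) (X \<omega>))"
        by (intro Bochner_Integration.integral_diff T.integrable_D1_W
            Bochner_Integration.integrable_sum T.integrable_D2_const)
      also have "expectation (\<lambda>\<omega>. \<Sum>e\<in>Basis. ?D2 (X \<omega>) e e) = (\<Sum>e\<in>Basis. expectation (\<lambda>\<omega>. ?D2 (X \<omega>) e e))"
        by (intro Bochner_Integration.integral_sum T.integrable_D2_const)
      finally show ?thesis by (simp only: \<Phi>'_def)
    qed
    finally show "(\<Phi> has_real_derivative \<Phi>' \<theta>) (at \<theta>)" .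
    have "\<bar>\<Phi>' \<theta>\<bar> \<le> (sin \<theta> / cos \<theta>) * (4/3 * (cos \<theta>) ^ 3 / (sin \<theta>)\<^sup>2 * \<beta> * \<alpha>\<^sup>2 * (CARD('q) * (D * (7/2 * D - 2))))"
      unfolding \<Phi>'_def abs_mult using T.stein_local_dependence s c
      by (intro mult_mono) auto
    also have "\<dots> = 4/3 * C * (cos \<theta> / sin \<theta>) * cos \<theta>"
      using s c by (simp add: C_def field_simps power2_eq_square power3_eq_cube)
    \<comment> \<open>One factor cos \<theta> <= 1 is given up to reach a bound with a simple
      primitive.\<close>
    also have "\<dots> \<le> 4/3 * C * (cos \<theta> / sin \<theta>)"
      using s c C by (intro mult_right_le_one_le mult_nonneg_nonneg) auto
    finally show "\<bar>\<Phi>' \<theta>\<bar> \<le> 4/3 * C * (cos \<theta> / sin \<theta>)" .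
  qed (rule cont)
  have "\<Phi> (pi / 2) = (\<integral>w. g w \<partial>std_gauss)"
    unfolding \<Phi>_def by (simp add: gauss_smooth_def prob_space)
  moreover have "ln (1 / sin t) = - ln (sin t)"
    using t by (subst ln_div) (auto intro: sin_gt_zero)
  ultimately show ?thesis
    using \<theta> unfolding \<Phi>_def C_def by (simp add: abs_minus_commute)
qed

text \<open>The term 4 \<tau> / N collects \<tau> / N for smoothing \<open>h\<close> at each of the
  two ends, and 2 \<tau> / N for starting the rotation at sin t = 1 / N instead of 0. Distances are
  measured after applying \<open>S\<close>, so \<tau> bounds first moments of vectors in the
  original coordinates.\<close>

theorem lipschitz_expectation_bound:
  fixes h :: "'b \<Rightarrow> real"
  assumes h: "\<And>x y. \<bar>h x - h y\<bar> \<le> norm (S (x - y))"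
    and N: "N \<ge> 1"
    and \<tau>X: "expectation (\<lambda>\<omega>. norm (S (X \<omega>))) \<le> \<tau>" and \<tau>w: "(\<integral>w. norm (S w) \<partial>std_gauss) \<le> \<tau>"
  shows "\<bar>expectation (\<lambda>\<omega>. h (X \<omega>)) - (\<integral>w. h w \<partial>std_gauss)\<bar>
    \<le> 4 * \<tau> / N + 4/3 * (\<beta> * \<alpha>\<^sup>2 * (CARD('q) * (D * (7/2 * D - 2)))) * ln N"
proof -
  have S_bound: "norm (S x) \<le> onorm S * norm x" for x
    using linear_S by (intro onorm) (simp add: linear_conv_bounded_linear)
  interpret h: lipschitz_function h "onorm S"
    by standard (rule order_trans[OF h S_bound])
  have S_lip: "\<bar>norm (S x) - norm (S y)\<bar> \<le> onorm S * norm (x - y)" for x y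
    using norm_triangle_ineq3[of "S x" "S y"] S_bound[of "x - y"] linear_diff[OF linear_S, of x y] by simp
  have S_meas [measurable]: "(\<lambda>w. norm (S w)) \<in> borel_measurable borel"
    using S_lip by (rule lipschitz_measurable)
  have S_exp: "exp_bounded (\<lambda>w. norm (S w))"
    using S_lip by (rule lipschitz_exp_bounded)
  have S_int: "integrable std_gauss (\<lambda>w. norm (S w))"
    using S_meas S_exp by (rule integrable_std_gauss)
  have SX_int: "integrable M (\<lambda>\<omega>. norm (S (X \<omega>)))"
    using S_lip by (rule integrable_lipschitz_X)
  have \<tau>: "\<tau> \<ge> 0"
    using \<tau>w by (meson Bochner_Integration.integral_nonneg norm_ge_zero order_trans)
  have P: "\<bar>(\<integral>w. h (x + r *\<^sub>R w) \<partial>std_gauss) - h y\<bar> \<le> norm (S (x - y)) + \<bar>r\<bar> * \<tau>" for x y r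
  proof -
    have "(\<integral>w. h (x + r *\<^sub>R w) \<partial>std_gauss) - h y = (\<integral>w. h (x + r *\<^sub>R w) - h y \<partial>std_gauss)"
      using h.integrable_h[of x r] by (simp add: std_gauss.prob_space[simplified])
    also have "\<bar>\<dots>\<bar> \<le> (\<integral>w. \<bar>h (x + r *\<^sub>R w) - h y\<bar> \<partial>std_gauss)" by (rule integral_abs_bound)
    also have "\<dots> \<le> (\<integral>w. norm (S (x - y)) + \<bar>r\<bar> * norm (S w) \<partial>std_gauss)"
    proof (intro integral_mono)
      fix w
      have "S (x + r *\<^sub>R w - y) = S (x - y) + r *\<^sub>R S w"
        using linear_S by (simp add: linear_add linear_diff linear_scale)
      then show "\<bar>h (x + r *\<^sub>R w) - h y\<bar> \<le> norm (S (x - y)) + \<bar>r\<bar> * norm (S w)"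
        using h[of "x + r *\<^sub>R w" y] norm_triangle_ineq[of "S (x - y)" "r *\<^sub>R S w"] by simp
    qed (use h.integrable_h S_int in auto)
    also have "\<dots> = norm (S (x - y)) + \<bar>r\<bar> * (\<integral>w. norm (S w) \<partial>std_gauss)"
      using S_int by (simp add: std_gauss.prob_space[simplified])
    also have "\<dots> \<le> norm (S (x - y)) + \<bar>r\<bar> * \<tau>"
      using \<tau>w by (intro add_left_mono mult_left_mono) auto
    finally show ?thesis .
  qed
  \<comment> \<open>\<open>h\<close> is only Lipschitz. Its smoothing is differentiable with bounded
    derivative, as \<open>rotation_bound\<close> demands, and keeps the modulus
    \<open>norm (S a)\<close>.\<close>
  define g where "g = gauss_smooth (1 / N) h"
  have d: "1 / N > 0" using N by simp
  have g_lip: "\<bar>g x - g y\<bar> \<le> onorm S * norm (x - y)" for x y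
    unfolding g_def by (rule h.gauss_smooth_lipschitz)
  interpret g: lipschitz_function g "onorm S"
    by standard (rule g_lip)
  have gS: "\<bar>g (x + a) - g x\<bar> \<le> norm (S a)" for x a
  proof -
    have "g (x + a) - g x = (\<integral>w. h (x + a + (1 / N) *\<^sub>R w) - h (x + (1 / N) *\<^sub>R w) \<partial>std_gauss)"
      unfolding g_def gauss_smooth_def
      by (rule Bochner_Integration.integral_diff[symmetric]) (rule h.integrable_h)+
    also have "\<bar>\<dots>\<bar> \<le> (\<integral>w. \<bar>h (x + a + (1 / N) *\<^sub>R w) - h (x + (1 / N) *\<^sub>R w)\<bar> \<partial>std_gauss)"
      by (rule integral_abs_bound)
    also have "\<dots> \<le> (\<integral>w. norm (S a) \<partial>(std_gauss :: 'b measure))"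
    proof (intro integral_mono integrable_abs Bochner_Integration.integrable_diff h.integrable_h)
      fix w
      show "\<bar>h (x + a + (1 / N) *\<^sub>R w) - h (x + (1 / N) *\<^sub>R w)\<bar> \<le> norm (S a)"
        using h[of "x + a + (1 / N) *\<^sub>R w" "x + (1 / N) *\<^sub>R w"] by simp
    qed simp
    finally show ?thesis by (simp add: std_gauss.prob_space[simplified])
  qed
  have gh: "\<bar>g x - h x\<bar> \<le> \<tau> / N" for x
    using P[of x "1 / N" x] N linear_0[OF linear_S] by (simp add: g_def gauss_smooth_def)
  \<comment> \<open>The rotation starts where the Gaussian part has size 1 / N. For N = 1 this is
    already the end point pi / 2.\<close>
  define t where "t = arcsin (1 / N)"
  have sin_t: "sin t = 1 / N" unfolding t_def using N d by (intro sin_arcsin) (linarith, simp)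
  have N1: "- 1 \<le> 1 / N" "1 / N \<le> 1" using N d by (linarith, simp)
  have t: "0 < t" "t \<le> pi / 2"
    using N d arcsin_ubound[OF N1] arcsin_less_mono[of 0 "1 / N"] by (auto simp: t_def)
  have cos_t: "0 \<le> cos t" "cos t \<le> 1" using t by (auto intro: cos_ge_zero)
  \<comment> \<open>Hence shrinking \<open>X\<close> by the factor cos t costs no more than the rate
    sin t = 1 / N that is paid for the added Gaussian part.\<close>
  have sc: "1 - cos t \<le> sin t"
  proof -
    have "0 \<le> sin t" "sin t \<le> 1" using d by (simp_all add: sin_t[symmetric])
    then have "(cos t)\<^sup>2 \<le> cos t" "(sin t)\<^sup>2 \<le> sin t"
      using cos_t mult_left_le_one_le[of "cos t" "cos t"] mult_left_le_one_le[of "sin t" "sin t"]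
      by (simp_all add: power2_eq_square)
    then show ?thesis using sin_cos_squared_add[of t] by linarith
  qed
  define C where "C = 4/3 * (\<beta> * \<alpha>\<^sup>2 * (CARD('q) * (D * (7/2 * D - 2))))"
  have rot: "\<bar>expectation (\<lambda>\<omega>. gauss_smooth (sin t) g (cos t *\<^sub>R X \<omega>)) - (\<integral>w. g w \<partial>std_gauss)\<bar> \<le> C * ln N"
    using rotation_bound[OF g.lipschitz_function_axioms gS _ _ _ t, of "gauss_D1 (1 / N) h"]
      h.gauss_smooth_has_derivative[OF d] h.gauss_D1_bounded[OF d]
      lipschitz_measurable[OF h.gauss_D1_lipschitz[OF d]]
    unfolding g_def C_def sin_t by simp
  have 1: "\<bar>expectation (\<lambda>\<omega>. h (X \<omega>)) - expectation (\<lambda>\<omega>. g (X \<omega>))\<bar> \<le> \<tau> / N"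
  proof -
    have "expectation (\<lambda>\<omega>. h (X \<omega>)) - expectation (\<lambda>\<omega>. g (X \<omega>)) = expectation (\<lambda>\<omega>. h (X \<omega>) - g (X \<omega>))"
      by (intro Bochner_Integration.integral_diff[symmetric] integrable_lipschitz_X[OF h.lipschitz]
          integrable_lipschitz_X[OF g.lipschitz])
    then show ?thesis using gh by (auto intro!: abs_expectation_le simp: abs_minus_commute)
  qed
  have 2: "\<bar>(\<integral>w. g w \<partial>std_gauss) - (\<integral>w. h w \<partial>std_gauss)\<bar> \<le> \<tau> / N"
  proof -
    have gi: "integrable std_gauss g" "integrable std_gauss h"
      using g.integrable_h[of 0 1] h.integrable_h[of 0 1] by simp_all
    then have "\<bar>(\<integral>w. g w \<partial>std_gauss) - (\<integral>w. h w \<partial>std_gauss)\<bar> \<le> (\<integral>w. \<bar>g w - h w\<bar> \<partial>std_gauss)"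
      using integral_abs_bound[of std_gauss "\<lambda>w. g w - h w"] by simp
    also have "\<dots> \<le> (\<integral>w. \<tau> / N \<partial>(std_gauss :: 'b measure))"
      using gi gh by (intro integral_mono) auto
    finally show ?thesis by (simp add: std_gauss.prob_space[simplified])
  qed
  have 3: "\<bar>expectation (\<lambda>\<omega>. gauss_smooth (sin t) g (cos t *\<^sub>R X \<omega>)) - expectation (\<lambda>\<omega>. g (X \<omega>))\<bar> \<le> 2 * \<tau> / N"
  proof -
    have pt: "\<bar>gauss_smooth (sin t) g (cos t *\<^sub>R x) - g x\<bar> \<le> sin t * norm (S x) + sin t * \<tau>" for x
    proof -
      have "gauss_smooth (sin t) g (cos t *\<^sub>R x) - g x
          = (\<integral>w. g (cos t *\<^sub>R x + sin t *\<^sub>R w) - g x \<partial>std_gauss)"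
        using g.integrable_h[of "cos t *\<^sub>R x" "sin t"]
        by (simp add: gauss_smooth_def std_gauss.prob_space[simplified])
      also have "\<bar>\<dots>\<bar> \<le> (\<integral>w. \<bar>g (cos t *\<^sub>R x + sin t *\<^sub>R w) - g x\<bar> \<partial>std_gauss)"
        by (rule integral_abs_bound)
      also have "\<dots> \<le> (\<integral>w. sin t * norm (S x) + sin t * norm (S w) \<partial>std_gauss)"
      proof (intro integral_mono)
        fix w
        let ?a = "(cos t - 1) *\<^sub>R x + sin t *\<^sub>R w"
        have "\<bar>g (x + ?a) - g x\<bar> \<le> norm (S ?a)" by (rule gS)
        also have "S ?a = (cos t - 1) *\<^sub>R S x + sin t *\<^sub>R S w"
          using linear_S by (simp add: linear_add linear_scale)
        also have "norm \<dots> \<le> (1 - cos t) * norm (S x) + sin t * norm (S w)"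
          using norm_triangle_ineq[of "(cos t - 1) *\<^sub>R S x" "sin t *\<^sub>R S w"] cos_t sin_t d by simp
        also have "\<dots> \<le> sin t * norm (S x) + sin t * norm (S w)"
          using sc by (intro add_right_mono mult_right_mono) auto
        also have "x + ?a = cos t *\<^sub>R x + sin t *\<^sub>R w" by (simp add: algebra_simps)
        finally show "\<bar>g (cos t *\<^sub>R x + sin t *\<^sub>R w) - g x\<bar> \<le> sin t * norm (S x) + sin t * norm (S w)" .
      qed (use g.integrable_h S_int in auto)
      also have "\<dots> = sin t * norm (S x) + sin t * (\<integral>w. norm (S w) \<partial>std_gauss)"
        using S_int by (simp add: std_gauss.prob_space[simplified])
      also have "\<dots> \<le> sin t * norm (S x) + sin t * \<tau>"
        using \<tau>w sin_t d by (intro add_left_mono mult_left_mono) auto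
      finally show ?thesis .
    qed
    have gsm_lip: "\<bar>gauss_smooth (sin t) g (cos t *\<^sub>R x) - gauss_smooth (sin t) g (cos t *\<^sub>R y)\<bar>
        \<le> onorm S * norm (x - y)" for x y
    proof (rule order_trans[OF g.gauss_smooth_lipschitz mult_left_mono[OF _ g.\<Lambda>_nonneg]])
      show "norm (cos t *\<^sub>R x - cos t *\<^sub>R y) \<le> norm (x - y)"
        using cos_t by (simp flip: scaleR_diff_right add: mult_left_le_one_le)
    qed
    have int: "integrable M (\<lambda>\<omega>. gauss_smooth (sin t) g (cos t *\<^sub>R X \<omega>))" "integrable M (\<lambda>\<omega>. g (X \<omega>))"
      by (rule integrable_lipschitz_X[OF gsm_lip], rule integrable_lipschitz_X[OF g_lip])
    then have "\<bar>expectation (\<lambda>\<omega>. gauss_smooth (sin t) g (cos t *\<^sub>R X \<omega>)) - expectation (\<lambda>\<omega>. g (X \<omega>))\<bar>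
        \<le> expectation (\<lambda>\<omega>. \<bar>gauss_smooth (sin t) g (cos t *\<^sub>R X \<omega>) - g (X \<omega>)\<bar>)"
      using integral_abs_bound[of M "\<lambda>\<omega>. gauss_smooth (sin t) g (cos t *\<^sub>R X \<omega>) - g (X \<omega>)"] by simp
    also have "\<dots> \<le> expectation (\<lambda>\<omega>. sin t * norm (S (X \<omega>)) + sin t * \<tau>)"
      using pt int SX_int by (intro integral_mono) auto
    also have "\<dots> = sin t * expectation (\<lambda>\<omega>. norm (S (X \<omega>))) + sin t * \<tau>"
      using SX_int by (simp add: prob_space)
    also have "\<dots> \<le> sin t * \<tau> + sin t * \<tau>"
      using \<tau>X sin_t d by (intro add_right_mono mult_left_mono) auto
    finally show ?thesis by (simp add: sin_t)
  qed
  have "4 * \<tau> / N = \<tau> / N + 2 * \<tau> / N + \<tau> / N" by simp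
  then show ?thesis
    using 1 2 3 rot unfolding C_def by linarith
qed

end

section \<open>Operators on a system of qubits\<close>

lemma dagger_component [simp]: "dagger A $ i $ j = cnj (A $ j $ i)"
  by (simp add: dagger_def)

lemma dagger_mult: "dagger (A ** B) = dagger B ** dagger A"
  by (simp add: vec_eq_iff matrix_matrix_mult_def mult.commute)

lemma dagger_dagger [simp]: "dagger (dagger A) = A"
  by (simp add: vec_eq_iff)

lemma dagger_mat_1 [simp]: "dagger (mat 1) = mat 1"
  by (simp add: vec_eq_iff mat_def)

lemma unitary_mat_1: "unitary (mat 1)"
  by (simp add: unitary_def)

lemma unitary_mult:
  assumes "unitary A" "unitary B"
  shows "unitary (A ** B)"
proof -
  have "dagger B ** dagger A ** (A ** B) = dagger B ** (dagger A ** A) ** B"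
    "A ** B ** (dagger B ** dagger A) = A ** (B ** dagger B) ** dagger A"
    by (simp_all only: matrix_mul_assoc)
  then show ?thesis using assms by (simp add: unitary_def dagger_mult)
qed

lemma braket_dagger: "braket v (dagger A *v w) = braket (A *v v) w"
proof -
  have "(\<Sum>i\<in>UNIV. cnj (v $ i) * (\<Sum>j\<in>UNIV. cnj (A $ j $ i) * w $ j))
      = (\<Sum>i\<in>UNIV. \<Sum>j\<in>UNIV. cnj (A $ j $ i) * cnj (v $ i) * w $ j)"
    by (simp add: sum_distrib_left mult_ac)
  also have "\<dots> = (\<Sum>j\<in>UNIV. \<Sum>i\<in>UNIV. cnj (A $ j $ i) * cnj (v $ i) * w $ j)"
    by (rule sum.swap)
  also have "\<dots> = (\<Sum>j\<in>UNIV. cnj (\<Sum>i\<in>UNIV. A $ j $ i * v $ i) * w $ j)"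
    by (simp add: sum_distrib_right)
  finally show ?thesis
    by (simp add: braket_def matrix_vector_mult_def)
qed

lemma braket_self: "braket v v = complex_of_real ((norm v)\<^sup>2)"
  by (simp add: braket_def norm_vec_def L2_set_def sum_nonneg complex_norm_square[symmetric] mult.commute)

lemma braket_cauchy_schwarz: "cmod (braket v w) \<le> norm v * norm w"
proof -
  have "cmod (braket v w) \<le> (\<Sum>i\<in>UNIV. \<bar>cmod (v $ i)\<bar> * \<bar>cmod (w $ i)\<bar>)"
    unfolding braket_def by (rule order_trans[OF norm_sum]) (simp add: norm_mult)
  also have "\<dots> \<le> L2_set (\<lambda>i. cmod (v $ i)) UNIV * L2_set (\<lambda>i. cmod (w $ i)) UNIV"
    by (rule L2_set_mult_ineq)
  finally show ?thesis by (simp add: norm_vec_def)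
qed

lemma norm_unitary:
  assumes "unitary A"
  shows "norm (A *v v) = norm v"
proof -
  have "complex_of_real ((norm (A *v v))\<^sup>2) = braket v (dagger A *v (A *v v))"
    by (simp only: braket_self[symmetric] braket_dagger)
  also have "\<dots> = complex_of_real ((norm v)\<^sup>2)"
    using assms by (simp add: matrix_vector_mul_assoc unitary_def braket_self)
  finally show ?thesis by (simp del: of_real_power)
qed

lemma matrix_mult_component: "(A ** B) $ s $ t = (\<Sum>u\<in>UNIV. A $ s $ u * B $ u $ t)"
  by (simp add: matrix_matrix_mult_def)

lemma tensor_component: "tensor A $ s $ t = (\<Prod>k\<in>UNIV. A k $ s k $ t k)"
  by (simp add: tensor_def)

text \<open>By distributivity, a sum over bit strings of products over qubits is a product of sums
  over single bits.\<close>

lemma tensor_mult: "tensor A ** tensor B = tensor (\<lambda>k. A k ** B k)"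
proof -
  have "(\<Sum>u\<in>UNIV. \<Prod>k\<in>UNIV. A k $ s k $ u k * B k $ u k $ t k)
      = (\<Prod>k\<in>UNIV. \<Sum>b\<in>UNIV. A k $ s k $ b * B k $ b $ t k)" for s t
    using prod_sum_PiE[of UNIV "\<lambda>_. UNIV" "\<lambda>k b. A k $ s k $ b * B k $ b $ t k"]
    by (simp add: PiE_UNIV_domain)
  then show ?thesis
    by (simp add: vec_eq_iff matrix_mult_component tensor_component prod.distrib)
qed

lemma tensor_mat_1: "tensor (\<lambda>_. mat 1) = mat 1"
proof -
  have "(\<Prod>k\<in>UNIV. if s k = t k then 1 else 0 :: complex) = (if s = t then 1 else 0)" for s t :: "'a \<Rightarrow> bool"
    by (auto simp: fun_eq_iff)
  then show ?thesis by (simp add: vec_eq_iff tensor_component mat_def)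
qed

lemma dagger_tensor: "dagger (tensor A) = tensor (\<lambda>k. dagger (A k))"
  by (simp add: vec_eq_iff tensor_component)

lemma unitary_tensor: "(\<And>k. unitary (A k)) \<Longrightarrow> unitary (tensor A)"
  by (simp add: unitary_def dagger_tensor tensor_mult tensor_mat_1)

lemma on_qubit_tensor: "on_qubit k A = tensor (\<lambda>j. if j = k then A else mat 1)"
proof -
  have "(\<Prod>j\<in>UNIV. (if j = k then A else mat 1) $ s j $ t j) =
    (if \<forall>j. j \<noteq> k \<longrightarrow> s j = t j then A $ s k $ t k else 0)" for s t
  proof -
    have "(\<Prod>j\<in>UNIV. (if j = k then A else mat 1) $ s j $ t j)
        = A $ s k $ t k * (\<Prod>j\<in>UNIV - {k}. if s j = t j then 1 else 0)"
      by (subst prod.remove[of _ k]) (auto simp: mat_def intro!: prod.cong)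
    also have "(\<Prod>j\<in>UNIV - {k}. if s j = t j then 1 else 0 :: complex) = (if \<forall>j. j \<noteq> k \<longrightarrow> s j = t j then 1 else 0)"
      by auto
    finally have e: "(\<Prod>j\<in>UNIV. (if j = k then A else mat 1) $ s j $ t j)
        = A $ s k $ t k * (if \<forall>j. j \<noteq> k \<longrightarrow> s j = t j then 1 else 0)" .
    show ?thesis
    proof (cases "\<forall>j. j \<noteq> k \<longrightarrow> s j = t j")
      case True
      show ?thesis using e unfolding if_P[OF True] by simp
    next
      case False
      show ?thesis using e unfolding if_not_P[OF False] by simp
    qed
  qed
  then show ?thesis by (simp add: vec_eq_iff on_qubit_def tensor_component)
qed

lemma on_qubit_mult: "on_qubit k A ** on_qubit k B = on_qubit k (A ** B)"
  unfolding on_qubit_tensor tensor_mult by (rule arg_cong[of _ _ tensor]) auto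

lemma on_qubit_commute: "j \<noteq> k \<Longrightarrow> on_qubit j A ** on_qubit k B = on_qubit k B ** on_qubit j A"
  unfolding on_qubit_tensor tensor_mult by (rule arg_cong[of _ _ tensor]) auto

lemma dagger_on_qubit: "dagger (on_qubit k A) = on_qubit k (dagger A)"
  unfolding on_qubit_tensor dagger_tensor by (rule arg_cong[of _ _ tensor]) auto

lemma unitary_on_qubit: "unitary A \<Longrightarrow> unitary (on_qubit k A)"
  unfolding on_qubit_tensor by (rule unitary_tensor) (simp add: unitary_mat_1)

section \<open>Operators acting on few qubits and their supports\<close>

definition agree_off :: "'q set \<Rightarrow> ('q \<Rightarrow> bool) \<Rightarrow> ('q \<Rightarrow> bool) \<Rightarrow> bool"
  where "agree_off J s t \<longleftrightarrow> (\<forall>j. j \<notin> J \<longrightarrow> s j = t j)"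

lemma agree_off_upd [simp]:
  "k \<in> J \<Longrightarrow> agree_off J (s(k := i)) t = agree_off J s t"
  "k \<in> J \<Longrightarrow> agree_off J s (t(k := i)) = agree_off J s t"
  by (auto simp: agree_off_def)

lemma agree_off_refl [simp]: "agree_off J s s"
  by (simp add: agree_off_def)

lemma agree_off_insert_upd: "agree_off J (s(k := t k)) t \<longleftrightarrow> agree_off (insert k J) s t"
  by (auto simp: agree_off_def)

lemma on_qubit_component: "on_qubit k A $ s $ t = (if agree_off {k} s t then A $ s k $ t k else 0)"
  by (simp add: on_qubit_def agree_off_def)

lemma on_qubits_component:
  "on_qubits a b A $ s $ t = (if agree_off {a, b} s t then A $ (s a, s b) $ (t a, t b) else 0)"
  by (simp add: on_qubits_def agree_off_def)

lemma on_qubits_mult: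
  assumes "a \<noteq> b"
  shows "on_qubits a b A ** on_qubits a b B = on_qubits a b (A ** B)"
proof -
  have "(\<Sum>u\<in>UNIV. on_qubits a b A $ s $ u * on_qubits a b B $ u $ t)
      = on_qubits a b (A ** B) $ s $ t" for s t
  proof -
    \<comment> \<open>\<open>\<phi>\<close> enumerates the bit strings that agree with
      \<open>s\<close> off a and b; all other strings contribute 0 to the product.\<close>
    define \<phi> where "\<phi> = (\<lambda>(i, j). s(a := i, b := j))"
    have \<phi>: "\<phi> p a = fst p" "\<phi> p b = snd p" for p
      using assms by (auto simp: \<phi>_def split_def)
    have inj: "inj \<phi>"
      by (rule injI, rule prod_eqI) (simp_all flip: \<phi>)
    have "(\<Sum>u\<in>UNIV. on_qubits a b A $ s $ u * on_qubits a b B $ u $ t)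
        = (\<Sum>u\<in>range \<phi>. on_qubits a b A $ s $ u * on_qubits a b B $ u $ t)"
    proof (rule sum.mono_neutral_right)
      show "\<forall>u\<in>UNIV - range \<phi>. on_qubits a b A $ s $ u * on_qubits a b B $ u $ t = 0"
      proof
        fix u assume u: "u \<in> UNIV - range \<phi>"
        have "\<not> agree_off {a, b} s u"
        proof
          assume "agree_off {a, b} s u"
          then have "u = \<phi> (u a, u b)" by (auto simp: \<phi>_def fun_eq_iff agree_off_def)
          with u show False by blast
        qed
        then show "on_qubits a b A $ s $ u * on_qubits a b B $ u $ t = 0"
          by (simp add: on_qubits_component)
      qed
    qed auto
    also have "\<dots> = (\<Sum>p\<in>UNIV. on_qubits a b A $ s $ \<phi> p * on_qubits a b B $ \<phi> p $ t)"
      by (simp add: sum.reindex[OF inj])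
    also have "\<dots> = (\<Sum>p\<in>UNIV. if agree_off {a, b} s t then A $ (s a, s b) $ p * B $ p $ (t a, t b) else 0)"
      by (intro sum.cong refl) (simp add: on_qubits_component \<phi>, simp add: \<phi>_def split_def)
    finally show ?thesis by (simp add: on_qubits_component matrix_mult_component)
  qed
  then show ?thesis by (simp add: vec_eq_iff matrix_mult_component)
qed

lemma dagger_on_qubits: "dagger (on_qubits a b A) = on_qubits a b (dagger A)"
proof -
  have "agree_off J s t = agree_off J t s" for J and s t :: "'a \<Rightarrow> bool"
    by (auto simp: agree_off_def)
  then show ?thesis by (simp add: vec_eq_iff on_qubits_component)
qed

lemma on_qubits_mat_1: "on_qubits a b (mat 1) = mat 1"
proof -
  have "agree_off {a, b} s t \<and> s a = t a \<and> s b = t b \<longleftrightarrow> s = t" for s t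
    by (auto simp: agree_off_def fun_eq_iff)
  then show ?thesis by (auto simp: vec_eq_iff on_qubits_component mat_def)
qed

lemma unitary_on_qubits: "a \<noteq> b \<Longrightarrow> unitary A \<Longrightarrow> unitary (on_qubits a b A)"
  by (simp add: unitary_def dagger_on_qubits on_qubits_mult on_qubits_mat_1)

lemma on_qubit_on_qubit_component:
  assumes "a \<noteq> b"
  shows "(on_qubit a P ** on_qubit b R) $ s $ t =
    (if agree_off {a, b} s t then P $ s a $ t a * R $ s b $ t b else 0)"
proof -
  have "(on_qubit a P ** on_qubit b R) $ s $ t =
      (\<Sum>u\<in>UNIV. if u = s(a := t a) then on_qubit a P $ s $ u * on_qubit b R $ u $ t else 0)"
    unfolding matrix_mult_component
  proof (intro sum.cong refl)
    fix u
    have "u = s(a := t a)" if "agree_off {a} s u" "agree_off {b} u t"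
    proof
      fix j show "u j = (s(a := t a)) j"
        using that assms by (cases "j = a") (auto simp: agree_off_def)
    qed
    then have "on_qubit a P $ s $ u * on_qubit b R $ u $ t = 0" if "u \<noteq> s(a := t a)"
      using that by (cases "agree_off {a} s u"; cases "agree_off {b} u t") (simp_all add: on_qubit_component)
    then show "on_qubit a P $ s $ u * on_qubit b R $ u $ t =
      (if u = s(a := t a) then on_qubit a P $ s $ u * on_qubit b R $ u $ t else 0)"
      by presburger
  qed
  also have "\<dots> = on_qubit a P $ s $ (s(a := t a)) * on_qubit b R $ (s(a := t a)) $ t" by simp
  also have "\<dots> = (if agree_off {a, b} s t then P $ s a $ t a * R $ s b $ t b else 0)"
    using assms by (simp add: on_qubit_component agree_off_insert_upd)
  finally show ?thesis .
qed

definition unit_matrix :: "bool \<Rightarrow> bool \<Rightarrow> complex \<Rightarrow> complex^bool^bool"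
  where "unit_matrix i j c = (\<chi> x y. if x = i \<and> y = j then c else 0)"

text \<open>Expansion in matrix units. It transfers commutation relations from one-qubit operators,
  in terms of which \<open>supported\<close> is defined, to two-qubit gates.\<close>

lemma on_qubits_expand:
  assumes "a \<noteq> b"
  shows "on_qubits a b A = (\<Sum>(i, j, k, l)\<in>UNIV.
    on_qubit a (unit_matrix i k (A $ (i, j) $ (k, l))) ** on_qubit b (unit_matrix j l 1))"
proof -
  have "on_qubits a b A $ s $ t = (\<Sum>(i, j, k, l)\<in>UNIV.
    (on_qubit a (unit_matrix i k (A $ (i, j) $ (k, l))) ** on_qubit b (unit_matrix j l 1)) $ s $ t)" for s t
  proof -
    have "(\<Sum>(i, j, k, l)\<in>UNIV.
      (on_qubit a (unit_matrix i k (A $ (i, j) $ (k, l))) ** on_qubit b (unit_matrix j l 1)) $ s $ t)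
      = (\<Sum>p\<in>UNIV. if p = (s a, s b, t a, t b) then on_qubits a b A $ s $ t else 0)"
      using assms by (intro sum.cong refl)
        (auto simp: on_qubit_on_qubit_component on_qubits_component unit_matrix_def split: if_splits)
    then show ?thesis by simp
  qed
  then show ?thesis by (simp add: vec_eq_iff sum_component split_def)
qed

text \<open>An operator acts only on the qubits in \<open>J\<close> iff it commutes with every one-qubit operator
  outside \<open>J\<close>. This makes closure under products and adjoints immediate.\<close>

definition supported :: "'q::finite set \<Rightarrow> complex^('q \<Rightarrow> bool)^('q \<Rightarrow> bool) \<Rightarrow> bool"
  where "supported J A \<longleftrightarrow> (\<forall>k B. k \<notin> J \<longrightarrow> A ** on_qubit k B = on_qubit k B ** A)"

lemma commute_mult:
  fixes A B C :: "complex^'n^'n"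
  assumes "A ** B = B ** A" "A ** C = C ** A"
  shows "A ** (B ** C) = (B ** C) ** A"
proof -
  have "A ** (B ** C) = B ** (A ** C)" by (simp only: matrix_mul_assoc assms(1))
  also have "\<dots> = (B ** C) ** A" by (simp only: assms(2) matrix_mul_assoc)
  finally show ?thesis .
qed

lemma matrix_add_rdistrib: "(A + B) ** C = A ** C + B ** C"
  for A B :: "complex^'n^'m"
  by (simp add: vec_eq_iff matrix_mult_component distrib_right sum.distrib)

lemma commute_sum:
  fixes A :: "complex^'n^'n"
  assumes "\<And>i. i \<in> I \<Longrightarrow> A ** f i = f i ** A"
  shows "A ** sum f I = sum f I ** A"
  using assms
proof (induction I rule: infinite_finite_induct)
  case (insert x F)
  then show ?case by (simp add: matrix_add_ldistrib matrix_add_rdistrib)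
qed (simp_all add: vec_eq_iff matrix_mult_component)

lemma supported_mult: "supported J A \<Longrightarrow> supported J B \<Longrightarrow> supported J (A ** B)"
  unfolding supported_def using commute_mult[of "on_qubit _ _" A B] by simp

lemma supported_dagger:
  assumes "supported J A"
  shows "supported J (dagger A)"
  unfolding supported_def
proof (intro allI impI)
  fix k B assume "k \<notin> J"
  then have "dagger (A ** on_qubit k (dagger B)) = dagger (on_qubit k (dagger B) ** A)"
    using assms unfolding supported_def by metis
  then show "dagger A ** on_qubit k B = on_qubit k B ** dagger A"
    by (simp add: dagger_mult dagger_on_qubit)
qed

lemma supported_mono: "supported J A \<Longrightarrow> J \<subseteq> K \<Longrightarrow> supported K A"
  unfolding supported_def by blast

lemma supported_on_qubit: "supported {k} (on_qubit k A)"
  unfolding supported_def by (auto intro: on_qubit_commute)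

lemma supported_on_qubits:
  assumes "a \<noteq> b"
  shows "supported {a, b} (on_qubits a b A)"
  unfolding supported_def
proof (intro allI impI)
  fix k B assume k: "k \<notin> {a, b}"
  have "on_qubit k B ** on_qubits a b A = on_qubits a b A ** on_qubit k B"
    unfolding on_qubits_expand[OF assms] using k
    by (intro commute_sum) (auto simp: split_def intro!: commute_mult on_qubit_commute)
  then show "on_qubits a b A ** on_qubit k B = on_qubit k B ** on_qubits a b A" by simp
qed

lemma supported_gate_matrix: "wf_gate X g \<Longrightarrow> supported (gate_qubits g) (gate_matrix x g)"
  by (cases g) (auto simp: supported_on_qubit supported_on_qubits)

lemma supported_commute_gate:
  assumes "supported J A" "wf_gate X g" "gate_qubits g \<inter> J = {}"
  shows "A ** gate_matrix x g = gate_matrix x g ** A"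
proof (cases g)
  case (One_Qubit k B)
  then show ?thesis using assms by (auto simp: supported_def)
next
  case (Two_Qubit a b B)
  then have "a \<noteq> b" "a \<notin> J" "b \<notin> J" using assms by auto
  then show ?thesis
    using assms(1) Two_Qubit
    by (simp add: on_qubits_expand) (intro commute_sum, auto simp: split_def supported_def intro!: commute_mult)
qed

lemma supported_tensor:
  assumes "\<And>k. k \<notin> J \<Longrightarrow> A k = mat 1"
  shows "supported J (tensor A)"
  unfolding supported_def on_qubit_tensor tensor_mult
proof (intro allI impI)
  fix k B assume "k \<notin> J"
  then show "tensor (\<lambda>j. A j ** (if j = k then B else mat 1)) = tensor (\<lambda>j. (if j = k then B else mat 1) ** A j)"
    using assms by (intro arg_cong[of _ _ tensor]) auto
qed

text \<open>The tensor product is built up one factor at a time, since \<open>supported\<close>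
  gives commutation with one-qubit operators.\<close>

lemma supported_commute_tensor:
  assumes "supported J B" "\<And>k. k \<in> J \<Longrightarrow> A k = mat 1"
  shows "B ** tensor A = tensor A ** B"
proof -
  have "B ** tensor (\<lambda>k. if k \<in> T then A k else mat 1) = tensor (\<lambda>k. if k \<in> T then A k else mat 1) ** B"
    if "finite T" "T \<subseteq> - J" for T
    using that
  proof (induction T rule: finite_induct)
    case empty
    then show ?case by (simp add: tensor_mat_1)
  next
    case (insert k T)
    have "tensor (\<lambda>j. if j \<in> insert k T then A j else mat 1)
        = on_qubit k (A k) ** tensor (\<lambda>j. if j \<in> T then A j else mat 1)"
      unfolding on_qubit_tensor tensor_mult
      using insert.hyps by (intro arg_cong[of _ _ tensor]) auto
    then show ?case
      using insert assms(1) by (auto intro!: commute_mult simp: supported_def)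
  qed
  from this[of "- J"] have "B ** tensor (\<lambda>k. if k \<in> - J then A k else mat 1)
      = tensor (\<lambda>k. if k \<in> - J then A k else mat 1) ** B" by simp
  moreover have "(\<lambda>k. if k \<in> - J then A k else mat 1) = A" using assms(2) by auto
  ultimately show ?thesis by simp
qed

text \<open>In the Heisenberg picture this makes every gate away from the support of an observable
  cancel.\<close>

lemma conjugate_commuting_unitary:
  assumes "unitary U" "A ** U = U ** A"
  shows "dagger U ** A ** U = A"
proof -
  have "dagger U ** A ** U = dagger U ** (U ** A)" by (metis assms(2) matrix_mul_assoc)
  also have "\<dots> = A" using assms(1) by (simp add: unitary_def matrix_mul_assoc)
  finally show ?thesis .
qed

lemma unitary_gate_matrix: "wf_gate X g \<Longrightarrow> x \<in> X \<Longrightarrow> unitary (gate_matrix x g)"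
  by (cases g) (auto intro: unitary_on_qubit unitary_on_qubits)

text \<open>A gate inside J preserves the support, and a gate disjoint from J cancels. Conjugation
  by the product peels off the leftmost gate first and changes the observable, hence the induction
  for arbitrary \<open>A\<close>.\<close>

lemma supported_conjugate_gates:
  assumes "supported J A" "x \<in> X"
    and "\<And>g. g \<in> set gs \<Longrightarrow> wf_gate X g \<and> (gate_qubits g \<subseteq> J \<or> gate_qubits g \<inter> J = {})"
  shows "supported J (dagger (foldr (\<lambda>g B. gate_matrix x g ** B) gs (mat 1)) ** A **
    foldr (\<lambda>g B. gate_matrix x g ** B) gs (mat 1))"
  using assms(1,3)
proof (induction gs arbitrary: A)
  case Nil
  then show ?case by simp
next
  case (Cons g gs)
  let ?G = "gate_matrix x g"
  have wf: "wf_gate X g" using Cons.prems(2) by simp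
  have "supported J (dagger ?G ** A ** ?G)"
  proof (cases "gate_qubits g \<subseteq> J")
    case True
    then have "supported J ?G" using supported_gate_matrix[OF wf] supported_mono by blast
    then show ?thesis using Cons.prems(1) by (intro supported_mult supported_dagger)
  next
    case False
    then have "A ** ?G = ?G ** A"
      using Cons.prems by (intro supported_commute_gate[OF _ wf]) auto
    then show ?thesis
      using conjugate_commuting_unitary[OF unitary_gate_matrix[OF wf assms(2)]] Cons.prems(1) by simp
  qed
  from Cons.IH[OF this] Cons.prems(2) show ?case
    by (simp add: dagger_mult matrix_mul_assoc)
qed

section \<open>Light cones\<close>

lemma sums_vec:
  fixes f :: "nat \<Rightarrow> 'a::real_normed_vector^'n"
  assumes "\<And>i. (\<lambda>n. f n $ i) sums (L $ i)"
  shows "f sums L"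
  unfolding sums_def by (rule vec_tendstoI) (use assms in \<open>simp add: sums_def\<close>)

text \<open>The powers of G alternate between 1 and G, so the exponential series splits over the
  complementary projections (1 + G) / 2 and (1 - G) / 2.\<close>

lemma mat_exp_involution:
  fixes G :: "complex^'n^'n"
  assumes "G ** G = mat 1"
  shows "mat_exp (\<chi> a b. z * G $ a $ b) =
    (\<chi> a b. exp z * (mat 1 $ a $ b + G $ a $ b) / 2 + exp (- z) * (mat 1 $ a $ b - G $ a $ b) / 2)"
proof -
  let ?M = "\<chi> a b. z * G $ a $ b"
  have pow: "mat_power ?M n = (\<chi> a b. z ^ n * (if even n then mat 1 else G) $ a $ b)" for n
  proof (induction n)
    case 0
    then show ?case by (simp add: vec_eq_iff)
  next
    case (Suc n)
    have step: "?M ** (\<chi> a b. z ^ n * H $ a $ b) = (\<chi> a b. z ^ Suc n * (G ** H) $ a $ b)" for H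
      by (simp add: vec_eq_iff matrix_mult_component sum_distrib_left mult_ac)
    have "mat_power ?M (Suc n) = (\<chi> a b. z ^ Suc n * (G ** (if even n then mat 1 else G)) $ a $ b)"
      unfolding mat_power.simps Suc.IH by (rule step)
    also have "G ** (if even n then mat 1 else G) = (if even (Suc n) then mat 1 else G)"
      using assms by simp
    finally show ?case .
  qed
  have "(\<lambda>n. mat_power ?M n /\<^sub>R fact n) sums
    (\<chi> a b. exp z * (mat 1 $ a $ b + G $ a $ b) / 2 + exp (- z) * (mat 1 $ a $ b - G $ a $ b) / 2)"
  proof (intro sums_vec)
    fix a b
    have e: "(\<lambda>n. w ^ n /\<^sub>R fact n) sums exp w" for w :: complex
      unfolding exp_def by (rule summable_sums) (rule summable_exp_generic)
    have "(\<lambda>n. (z ^ n /\<^sub>R fact n) * ((mat 1 $ a $ b + G $ a $ b) / 2) + ((- z) ^ n /\<^sub>R fact n) * ((mat 1 $ a $ b - G $ a $ b) / 2))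
      sums (exp z * ((mat 1 $ a $ b + G $ a $ b) / 2) + exp (- z) * ((mat 1 $ a $ b - G $ a $ b) / 2))"
      by (intro sums_add sums_mult2 e)
    moreover have "(z ^ n /\<^sub>R fact n) * ((mat 1 $ a $ b + G $ a $ b) / 2) + ((- z) ^ n /\<^sub>R fact n) * ((mat 1 $ a $ b - G $ a $ b) / 2)
      = (mat_power ?M n /\<^sub>R fact n) $ a $ b" for n
      unfolding pow vector_scaleR_component vec_lambda_beta by (cases "even n") (simp_all add: scaleR_conv_of_real field_simps)
    ultimately show "(\<lambda>n. (mat_power ?M n /\<^sub>R fact n) $ a $ b) sums
        (\<chi> a b. exp z * (mat 1 $ a $ b + G $ a $ b) / 2 + exp (- z) * (mat 1 $ a $ b - G $ a $ b) / 2) $ a $ b"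
      by simp
  qed
  then show ?thesis unfolding mat_exp_def by (rule sums_unique[symmetric])
qed

lemma W_gate_component:
  assumes "generator Q i ** generator Q i = mat 1"
  shows "W_gate Q i \<theta> $ a $ b = exp (- (\<i> * complex_of_real \<theta>)) * (mat 1 $ a $ b + generator Q i $ a $ b) / 2
    + exp (\<i> * complex_of_real \<theta>) * (mat 1 $ a $ b - generator Q i $ a $ b) / 2"
proof -
  have "(\<chi> a b. - \<i> * generator Q i $ a $ b * complex_of_real \<theta>)
      = (\<chi> a b. (- \<i> * complex_of_real \<theta>) * generator Q i $ a $ b)"
    by (simp add: vec_eq_iff mult_ac)
  then show ?thesis
    unfolding W_gate_def using mat_exp_involution[OF assms, of "- \<i> * complex_of_real \<theta>"] by simp
qed

lemma unitary_W_gate: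
  assumes G: "generator Q i ** generator Q i = mat 1" and h: "hermitian (generator Q i)"
  shows "unitary (W_gate Q i \<theta>)"
proof -
  let ?G = "generator Q i" and ?I = "mat 1 :: complex^bool^bool"
  let ?e = "exp (- (\<i> * complex_of_real \<theta>))" and ?f = "exp (\<i> * complex_of_real \<theta>)"
  have ef: "?e * ?f = 1" by (simp add: exp_add[symmetric])
  have cnj: "cnj ?e = ?f" "cnj ?f = ?e" by (simp_all add: exp_cnj)
  have Gc: "cnj (?G $ a $ b) = ?G $ b $ a" for a b
    using h unfolding hermitian_def by (metis dagger_component)
  have Ic: "cnj (?I $ a $ b) = ?I $ b $ a" for a b by (simp add: mat_def)
  have dag: "dagger (W_gate Q i \<theta>) $ a $ b = ?f * (?I $ a $ b + ?G $ a $ b) / 2 + ?e * (?I $ a $ b - ?G $ a $ b) / 2" for a b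
    by (simp add: W_gate_component[OF G] cnj Gc Ic)
  have GG: "(\<Sum>c\<in>UNIV. ?G $ a $ c * ?G $ c $ b) = ?I $ a $ b" for a b
    by (simp add: matrix_mult_component[symmetric] G)
  \<comment> \<open>With the projections P = (1 + G) / 2 and R = (1 - G) / 2 this is (x P + y R) (y
    P + x R) = x y (P + R). Stating it for general x and y covers both orders of the unitarity
    relation.\<close>
  have key: "(\<Sum>c\<in>UNIV. (x * (?I $ a $ c + ?G $ a $ c) / 2 + y * (?I $ a $ c - ?G $ a $ c) / 2) *
      (y * (?I $ c $ b + ?G $ c $ b) / 2 + x * (?I $ c $ b - ?G $ c $ b) / 2)) = ?I $ a $ b"
    if "x * y = 1" for x y :: complex and a b
  proof -
    have "(x * (?I $ a $ c + ?G $ a $ c) / 2 + y * (?I $ a $ c - ?G $ a $ c) / 2) *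
        (y * (?I $ c $ b + ?G $ c $ b) / 2 + x * (?I $ c $ b - ?G $ c $ b) / 2)
        = (x * x + y * y + 2) / 4 * (?I $ a $ c * ?I $ c $ b) + (2 - x * x - y * y) / 4 * (?G $ a $ c * ?G $ c $ b)
        + (y * y - x * x) / 4 * (?I $ a $ c * ?G $ c $ b) + (x * x - y * y) / 4 * (?G $ a $ c * ?I $ c $ b)" for c
    proof -
      have E: "(x * p1 / 2 + y * p2 / 2) * (y * q1 / 2 + x * q2 / 2)
          = (x * y * (p1 * q1 + p2 * q2) + x * x * p1 * q2 + y * y * p2 * q1) / 4" for p1 p2 q1 q2
        by (simp add: algebra_simps add_divide_distrib)
      show ?thesis
        by (simp only: E that) (simp add: algebra_simps add_divide_distrib diff_divide_distrib)
    qed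
    then have "(\<Sum>c\<in>UNIV. (x * (?I $ a $ c + ?G $ a $ c) / 2 + y * (?I $ a $ c - ?G $ a $ c) / 2) *
        (y * (?I $ c $ b + ?G $ c $ b) / 2 + x * (?I $ c $ b - ?G $ c $ b) / 2))
        = (x * x + y * y + 2) / 4 * (?I ** ?I) $ a $ b + (2 - x * x - y * y) / 4 * (?G ** ?G) $ a $ b
        + (y * y - x * x) / 4 * (?I ** ?G) $ a $ b + (x * x - y * y) / 4 * (?G ** ?I) $ a $ b"
      by (simp only: sum.distrib sum_distrib_left[symmetric] matrix_mult_component)
    also have "\<dots> = ?I $ a $ b" by (simp add: G algebra_simps add_divide_distrib diff_divide_distrib)
    finally show ?thesis .
  qed
  show ?thesis
    unfolding unitary_def
  proof
    show "dagger (W_gate Q i \<theta>) ** W_gate Q i \<theta> = mat 1"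
      unfolding vec_eq_iff matrix_mult_component dag W_gate_component[OF G]
      using key[of ?f ?e] ef by (simp only: mult.commute[of ?f ?e]) blast
    show "W_gate Q i \<theta> ** dagger (W_gate Q i \<theta>) = mat 1"
      unfolding vec_eq_iff matrix_mult_component dag W_gate_component[OF G]
      using key[of ?e ?f] ef by blast
  qed
qed

text \<open>With first row (a, b), a traceless Hermitian 2 x 2 matrix has eigenvalues r and -r for
  r^2 = a^2 + |b|^2, and its square is r^2 times the identity. That r is an eigenvalue brings in the
  bound on the spectrum.\<close>

lemma observable_square:
  fixes A :: "complex^bool^bool"
  assumes h: "hermitian A" and tr: "trace A = 0" and sp: "spectrum A \<subseteq> complex_of_real ` {-1..1}"
  obtains r :: real where "0 \<le> r" "r \<le> 1" "A ** A = (\<chi> i j. complex_of_real (r\<^sup>2) * mat 1 $ i $ j)"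
proof -
  define a where "a = Re (A $ False $ False)"
  define b where "b = A $ False $ True"
  have hc: "A $ i $ j = cnj (A $ j $ i)" for i j
    using h unfolding hermitian_def by (metis dagger_component)
  have A00: "A $ False $ False = complex_of_real a"
    using hc[of False False] by (simp add: a_def complex_eq_iff)
  have A01: "A $ False $ True = b" by (simp add: b_def)
  have A10: "A $ True $ False = cnj b" using hc[of True False] by (simp add: b_def)
  have A11: "A $ True $ True = - complex_of_real a"
    using tr A00 by (simp add: trace_def UNIV_bool add_eq_0_iff)
  define r where "r = sqrt (a\<^sup>2 + (cmod b)\<^sup>2)"
  have r0: "r \<ge> 0" by (simp add: r_def)
  have r2: "r\<^sup>2 = a\<^sup>2 + (cmod b)\<^sup>2" by (simp add: r_def)
  have bb: "b * cnj b = complex_of_real (r\<^sup>2 - a\<^sup>2)" by (simp only: r2 add_diff_cancel_left' complex_norm_square)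
  have "complex_of_real r \<in> spectrum A"
  \<comment> \<open>The vector (b, r - a) is an eigenvector for r as soon as it is nonzero. It
    vanishes exactly in the first case, where the basis vector of \<open>False\<close> takes its
    place.\<close>
  proof (cases "b = 0 \<and> r = a")
    case True
    let ?v = "\<chi> i. if i then 0 else (1::complex)"
    have "A *v ?v = complex_of_real r *s ?v"
      using True by (auto simp: vec_eq_iff matrix_vector_mult_def UNIV_bool A00 A10 all_bool_eq)
    moreover have "?v \<noteq> 0" by (auto simp: vec_eq_iff)
    ultimately show ?thesis unfolding spectrum_def by blast
  next
    case False
    let ?v = "\<chi> i. if i then complex_of_real (r - a) else b"
    have "complex_of_real (r\<^sup>2 - a\<^sup>2) + - complex_of_real a * complex_of_real (r - a)
        = complex_of_real r * complex_of_real (r - a)"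
      by (simp flip: of_real_mult of_real_minus of_real_add add: power2_eq_square algebra_simps)
    then have "A *v ?v = complex_of_real r *s ?v"
      using bb by (auto simp: vec_eq_iff matrix_vector_mult_def UNIV_bool A00 A10 A01 A11 all_bool_eq power2_eq_square algebra_simps)
    moreover have "?v \<noteq> 0" using False by (auto simp: vec_eq_iff all_bool_eq)
    ultimately show ?thesis unfolding spectrum_def by blast
  qed
  then have "r \<le> 1" using sp by auto
  moreover have "A ** A = (\<chi> i j. complex_of_real (r\<^sup>2) * mat 1 $ i $ j)"
    using bb by (auto simp: vec_eq_iff matrix_mult_component UNIV_bool mat_def A00 A01 A10 A11 all_bool_eq power2_eq_square algebra_simps)
  ultimately show ?thesis using that r0 by blast
qed

lemma on_qubit_scaled_identity:
  "on_qubit k (\<chi> i j. c * mat 1 $ i $ j) *v v = c *s v"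
proof -
  have "on_qubit k (\<chi> i j. c * mat 1 $ i $ j) = (\<chi> i j. c * mat 1 $ i $ j)"
  proof -
    have "on_qubit k (\<chi> i j. c * mat 1 $ i $ j) $ s $ t = (\<chi> i j. c * mat 1 $ i $ j) $ s $ t" for s t
    proof -
      have "agree_off {k} s t \<and> s k = t k \<longleftrightarrow> s = t" by (auto simp: agree_off_def fun_eq_iff)
      then show ?thesis by (auto simp: on_qubit_component mat_def)
    qed
    then show ?thesis unfolding vec_eq_iff by blast
  qed
  moreover have "(if P then c else 0) * y = (if P then c * y else 0)" for P y by simp
  ultimately show ?thesis
    by (simp add: vec_eq_iff matrix_vector_mult_def mat_def if_distrib[of "\<lambda>x. _ * x"] cong: if_cong)
qed

text \<open>Since A A is r^2 times the identity and A is Hermitian, the operator scales every norm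
  by exactly r <= 1; Cauchy-Schwarz does the rest.\<close>

lemma abs_braket_observable_le:
  fixes A :: "complex^bool^bool"
  assumes h: "hermitian A" and "trace A = 0" and "spectrum A \<subseteq> complex_of_real ` {-1..1}"
  shows "\<bar>Re (braket v (on_qubit k A *v v))\<bar> \<le> (norm v)\<^sup>2"
proof -
  obtain r :: real where r: "0 \<le> r" "r \<le> 1" "A ** A = (\<chi> i j. complex_of_real (r\<^sup>2) * mat 1 $ i $ j)"
    using observable_square assms by blast
  have hq: "dagger (on_qubit k A) = on_qubit k A"
    using h by (simp add: dagger_on_qubit hermitian_def)
  have "complex_of_real ((norm (on_qubit k A *v v))\<^sup>2) = braket (on_qubit k A *v v) (on_qubit k A *v v)"
    by (simp only: braket_self)
  also have "\<dots> = braket v (on_qubit k A *v (on_qubit k A *v v))"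
    by (metis braket_dagger hq)
  also have "\<dots> = braket v (complex_of_real (r\<^sup>2) *s v)"
    by (simp only: matrix_vector_mul_assoc on_qubit_mult r(3) on_qubit_scaled_identity)
  also have "\<dots> = complex_of_real (r\<^sup>2) * braket v v"
    by (simp add: braket_def sum_distrib_left mult_ac)
  also have "\<dots> = complex_of_real ((r * norm v)\<^sup>2)"
    by (simp add: braket_self power_mult_distrib)
  finally have "(norm (on_qubit k A *v v))\<^sup>2 = (r * norm v)\<^sup>2"
    using of_real_eq_iff by blast
  then have "norm (on_qubit k A *v v) = r * norm v"
    using r(1) by (simp add: power2_eq_iff_nonneg)
  also have "\<dots> \<le> norm v" using r by (intro mult_left_le_one_le) auto
  finally have n: "norm (on_qubit k A *v v) \<le> norm v" .
  have "\<bar>Re (braket v (on_qubit k A *v v))\<bar> \<le> norm v * norm (on_qubit k A *v v)"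
    using abs_Re_le_cmod braket_cauchy_schwarz order_trans by blast
  also have "\<dots> \<le> norm v * norm v" using n by (intro mult_left_mono) auto
  finally show ?thesis by (simp add: power2_eq_square)
qed

lemma sorted_wrt_symmetric_member:
  assumes "sorted_wrt P xs" "\<And>x y. P x y \<Longrightarrow> P y x" "x \<in> set xs" "y \<in> set xs" "x \<noteq> y"
  shows "P x y"
  using assms by (induction xs) auto

locale network =
  fixes Q :: "('q::finite, 'x) qnn" and X :: "'x set"
  assumes wf: "wf_qnn X Q"
begin

lemma wf_gates: "l \<in> {1..depth Q} \<Longrightarrow> g \<in> set (gates Q l) \<Longrightarrow> wf_gate X g"
  using wf unfolding wf_qnn_def by blast

lemma gates_disjoint:
  assumes "l \<in> {1..depth Q}" "g \<in> set (gates Q l)" "h \<in> set (gates Q l)" "a \<in> gate_qubits g" "a \<in> gate_qubits h"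
  shows "g = h"
proof (rule ccontr)
  assume "g \<noteq> h"
  moreover have "sorted_wrt (\<lambda>g h. gate_qubits g \<inter> gate_qubits h = {}) (gates Q l)"
    using wf assms(1) unfolding wf_qnn_def by blast
  ultimately have "gate_qubits g \<inter> gate_qubits h = {}"
    using sorted_wrt_symmetric_member[of "\<lambda>g h. gate_qubits g \<inter> gate_qubits h = {}"] assms by blast
  then show False using assms by blast
qed

definition nbhds :: "nat \<Rightarrow> 'q set \<Rightarrow> 'q set"
  where "nbhds l J = (\<Union>k\<in>J. interaction_nbhd Q l k)"

lemma subset_nbhds: "J \<subseteq> nbhds l J"
  by (auto simp: nbhds_def interaction_nbhd_def)

text \<open>Gates of one layer are disjoint and have at most two qubits: a gate that meets the
  neighbourhood of k must contain k, and then lies inside that neighbourhood. This is the dichotomy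
  that \<open>supported_conjugate_gates\<close> asks for.\<close>

lemma gate_nbhds:
  assumes l: "l \<in> {1..depth Q}" and g: "g \<in> set (gates Q l)"
  shows "gate_qubits g \<subseteq> nbhds l J \<or> gate_qubits g \<inter> nbhds l J = {}"
proof (rule disjCI)
  assume "gate_qubits g \<inter> nbhds l J \<noteq> {}"
  then obtain q k where q: "q \<in> gate_qubits g" "k \<in> J" "q \<in> interaction_nbhd Q l k"
    by (auto simp: nbhds_def)
  have "k \<in> gate_qubits g"
  proof (cases "q = k")
    case False
    then obtain h where h: "h \<in> set (gates Q l)" "gate_qubits h = {k, q}"
      using q(3) by (auto simp: interaction_nbhd_def)
    then have "g = h" using gates_disjoint[OF l g h(1) q(1)] by simp
    then show ?thesis using h by simp
  qed (use q in simp)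
  have "gate_qubits g \<subseteq> interaction_nbhd Q l k"
  proof
    fix p assume p: "p \<in> gate_qubits g"
    show "p \<in> interaction_nbhd Q l k"
    proof (cases "p = k")
      case False
      then have "gate_qubits g = {k, p}"
        using p \<open>k \<in> gate_qubits g\<close> by (cases g) auto
      then show ?thesis using False g by (auto simp: interaction_nbhd_def)
    qed (simp add: interaction_nbhd_def)
  qed
  then show "gate_qubits g \<subseteq> nbhds l J" using q(2) by (auto simp: nbhds_def)
qed

lemma generator_facts:
  assumes "l \<in> {1..depth Q}"
  shows "generator Q (l, k) ** generator Q (l, k) = mat 1" "hermitian (generator Q (l, k))"
  using wf assms unfolding wf_qnn_def param_indices_def by blast+

lemma unitary_W: "l \<in> {1..depth Q} \<Longrightarrow> unitary (W_gate Q (l, k) \<theta>)"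
  by (intro unitary_W_gate generator_facts)

lemma unitary_V_layer:
  assumes "l \<in> {1..depth Q}" "x \<in> X"
  shows "unitary (V_layer Q l x)"
proof -
  have "unitary (foldr (\<lambda>g B. gate_matrix x g ** B) gs (mat 1))" if "\<And>g. g \<in> set gs \<Longrightarrow> wf_gate X g" for gs
    using that by (induction gs) (auto simp: unitary_mat_1 intro!: unitary_mult unitary_gate_matrix[OF _ assms(2)])
  then show ?thesis unfolding V_layer_def using wf_gates[OF assms(1)] by blast
qed

lemma unitary_U_layer: "l \<in> {1..depth Q} \<Longrightarrow> x \<in> X \<Longrightarrow> unitary (U_layer Q l \<Theta> x)"
  unfolding U_layer_def by (intro unitary_mult unitary_V_layer unitary_tensor unitary_W)

lemma unitary_U_upto: "l \<le> depth Q \<Longrightarrow> x \<in> X \<Longrightarrow> unitary (U_upto Q l \<Theta> x)"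
  by (induction l) (auto intro!: unitary_mult unitary_U_layer simp: unitary_mat_1)

text \<open>Conjugation by the gates of the layer spreads the support from J to its neighbourhood.
  The rotations split into a factor on that neighbourhood and a factor off it; the latter commutes
  with the spread observable and cancels, and its parameters disappear with it.\<close>

lemma conjugate_layer:
  assumes l: "l \<in> {1..depth Q}" and x: "x \<in> X" and A: "supported J A"
  shows "supported (nbhds l J) (dagger (U_layer Q l \<Theta> x) ** A ** U_layer Q l \<Theta> x)"
    and "(\<And>k. k \<in> nbhds l J \<Longrightarrow> \<Theta> (l, k) = \<Theta>' (l, k)) \<Longrightarrow>
      dagger (U_layer Q l \<Theta> x) ** A ** U_layer Q l \<Theta> x = dagger (U_layer Q l \<Theta>' x) ** A ** U_layer Q l \<Theta>' x"
proof -
  let ?N = "nbhds l J" and ?V = "V_layer Q l x"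
  define B where "B = dagger ?V ** A ** ?V"
  have B: "supported ?N B"
    unfolding B_def V_layer_def
    by (rule supported_conjugate_gates[OF supported_mono[OF A subset_nbhds] x])
      (use wf_gates[OF l] gate_nbhds[OF l] in auto)
  define T where "T \<Theta> = tensor (\<lambda>k. if k \<in> ?N then W_gate Q (l, k) (\<Theta> (l, k)) else mat 1)" for \<Theta>
  define T' where "T' \<Theta> = tensor (\<lambda>k. if k \<in> ?N then mat 1 else W_gate Q (l, k) (\<Theta> (l, k)))" for \<Theta>
  have conj: "dagger (U_layer Q l \<Theta> x) ** A ** U_layer Q l \<Theta> x = dagger (T \<Theta>) ** B ** T \<Theta>" for \<Theta>
  proof -
    have "tensor (\<lambda>k. W_gate Q (l, k) (\<Theta> (l, k))) = T' \<Theta> ** T \<Theta>"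
      unfolding T_def T'_def tensor_mult by (rule arg_cong[of _ _ tensor]) auto
    then have "dagger (U_layer Q l \<Theta> x) ** A ** U_layer Q l \<Theta> x
        = dagger (T \<Theta>) ** (dagger (T' \<Theta>) ** B ** T' \<Theta>) ** T \<Theta>"
      by (simp add: U_layer_def dagger_mult B_def matrix_mul_assoc)
    moreover have "unitary (T' \<Theta>)"
      unfolding T'_def using unitary_W[OF l] by (intro unitary_tensor) (simp add: unitary_mat_1)
    moreover have "B ** T' \<Theta> = T' \<Theta> ** B"
      unfolding T'_def by (rule supported_commute_tensor[OF B]) simp
    ultimately show ?thesis by (simp add: conjugate_commuting_unitary)
  qed
  have "supported ?N (T \<Theta>)" unfolding T_def by (rule supported_tensor) simp
  then show "supported ?N (dagger (U_layer Q l \<Theta> x) ** A ** U_layer Q l \<Theta> x)"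
    unfolding conj using B by (intro supported_mult supported_dagger)
  assume "\<And>k. k \<in> ?N \<Longrightarrow> \<Theta> (l, k) = \<Theta>' (l, k)"
  then have "T \<Theta> = T \<Theta>'" unfolding T_def by (intro arg_cong[of _ _ tensor]) auto
  then show "dagger (U_layer Q l \<Theta> x) ** A ** U_layer Q l \<Theta> x = dagger (U_layer Q l \<Theta>' x) ** A ** U_layer Q l \<Theta>' x"
    unfolding conj by simp
qed

text \<open>The qubits touched by the observable of k when the layers above l have been undone. It
  extends \<open>cone_qubits\<close> by the stage before the last layer is undone, where the support
  is {k}; this is where the recursion over layers starts.\<close>

definition cone_after :: "nat \<Rightarrow> 'q \<Rightarrow> 'q set"
  where "cone_after l k = (if l < depth Q then cone_qubits Q (Suc l) k else {k})"

lemma cone_qubits_nbhds: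
  assumes "l \<in> {1..depth Q}"
  shows "cone_qubits Q l k = nbhds l (cone_after l k)"
  using assms by (subst cone_qubits.simps) (auto simp: nbhds_def cone_after_def)

text \<open>The outermost layer is conjugated first and leaves an observable with a known, larger
  support, which is why \<open>A\<close> is generalized in the induction over layers.\<close>

lemma heisenberg_light_cone:
  assumes "l \<le> depth Q" "x \<in> X" "supported (cone_after l k) A"
    and "\<And>i. i \<in> past_cone Q k \<Longrightarrow> \<Theta> i = \<Theta>' i"
  shows "dagger (U_upto Q l \<Theta> x) ** A ** U_upto Q l \<Theta> x = dagger (U_upto Q l \<Theta>' x) ** A ** U_upto Q l \<Theta>' x"
  using assms(1,3)
proof (induction l arbitrary: A)
  case 0
  then show ?case by simp
next
  case (Suc l)
  have l: "Suc l \<in> {1..depth Q}" using Suc.prems by simp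
  have cone: "nbhds (Suc l) (cone_after (Suc l) k) = cone_after l k"
    using cone_qubits_nbhds[OF l] Suc.prems(1) by (simp add: cone_after_def)
  have eq: "\<Theta> (Suc l, k') = \<Theta>' (Suc l, k')" if "k' \<in> nbhds (Suc l) (cone_after (Suc l) k)" for k'
  proof -
    have "(Suc l, k') \<in> past_cone Q k"
      using that l unfolding cone_qubits_nbhds[OF l, symmetric] past_cone_def by blast
    then show ?thesis by (rule assms(4))
  qed
  let ?A = "dagger (U_layer Q (Suc l) \<Theta> x) ** A ** U_layer Q (Suc l) \<Theta> x"
  have A_eq: "?A = dagger (U_layer Q (Suc l) \<Theta>' x) ** A ** U_layer Q (Suc l) \<Theta>' x"
    by (rule conjugate_layer(2)[OF l assms(2) Suc.prems(2)]) (rule eq)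
  have "supported (cone_after l k) ?A"
    using conjugate_layer(1)[OF l assms(2) Suc.prems(2)] by (simp only: cone)
  then have "dagger (U_upto Q l \<Theta> x) ** ?A ** U_upto Q l \<Theta> x = dagger (U_upto Q l \<Theta>' x) ** ?A ** U_upto Q l \<Theta>' x"
    using Suc.prems by (intro Suc.IH) auto
  then have "dagger (U_upto Q l \<Theta> x) ** ?A ** U_upto Q l \<Theta> x = dagger (U_upto Q l \<Theta>' x) **
      (dagger (U_layer Q (Suc l) \<Theta>' x) ** A ** U_layer Q (Suc l) \<Theta>' x) ** U_upto Q l \<Theta>' x"
    by (simp only: A_eq)
  then show ?case by (simp add: dagger_mult matrix_mul_assoc)
qed

text \<open>The case of all layers, with an observable supported on the single qubit k. It makes the
  local output a function of the parameters in its past cone, from which independence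
  follows.\<close>

theorem local_output_light_cone:
  assumes "x \<in> X" "\<And>i. i \<in> past_cone Q k \<Longrightarrow> \<Theta> i = \<Theta>' i"
  shows "local_output Q k \<Theta> x = local_output Q k \<Theta>' x"
  unfolding local_output_def U_circuit_def
  by (subst heisenberg_light_cone[OF order_refl assms(1), where \<Theta> = \<Theta> and \<Theta>' = \<Theta>' and k = k])
    (simp_all add: cone_after_def supported_on_qubit assms(2))

lemma norm_ket0: "norm (ket0 :: complex^('q \<Rightarrow> bool)) = 1"
  by (simp add: ket0_def norm_axis_1)

lemma abs_local_output_le: "x \<in> X \<Longrightarrow> \<bar>local_output Q k \<Theta> x\<bar> \<le> 1"
proof -
  assume x: "x \<in> X"
  let ?U = "U_circuit Q \<Theta> x" and ?O = "on_qubit k (observable Q k)"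
  have "braket ket0 ((dagger ?U ** ?O ** ?U) *v ket0) = braket ket0 (dagger ?U *v (?O *v (?U *v ket0)))"
    by (simp only: matrix_vector_mul_assoc matrix_mul_assoc)
  also have "\<dots> = braket (?U *v ket0) (?O *v (?U *v ket0))" by (rule braket_dagger)
  finally have "\<bar>local_output Q k \<Theta> x\<bar> \<le> (norm (?U *v ket0))\<^sup>2"
    unfolding local_output_def using wf unfolding wf_qnn_def
    by (simp only:) (intro abs_braket_observable_le, auto)
  also have "norm (?U *v ket0) = 1"
    using norm_unitary[OF unitary_U_upto[OF order_refl x]] by (simp add: U_circuit_def norm_ket0)
  finally show ?thesis by simp
qed

section \<open>Measurability in the random parameters\<close>

lemma prob_space_init: "prob_space (init_measure Q)"
  unfolding init_measure_def
  by (intro prob_space_PiM prob_space_uniform_measure) auto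

lemma sets_init [measurable_cong]: "sets (init_measure Q) = sets (Pi\<^sub>M (param_indices Q) (\<lambda>_. borel))"
  unfolding init_measure_def by (rule sets_PiM_cong) auto

lemma W_gate_measurable:
  assumes "l \<in> {1..depth Q}"
  shows "(\<lambda>\<Theta>. W_gate Q (l, k) (\<Theta> (l, k)) $ a $ b) \<in> borel_measurable (init_measure Q)"
proof -
  have "(l, k) \<in> param_indices Q" using assms by (simp add: param_indices_def)
  then have [measurable]: "(\<lambda>\<Theta>. \<Theta> (l, k)) \<in> borel_measurable (init_measure Q)"
    by (subst measurable_cong_sets[OF sets_init refl]) (rule measurable_component_singleton)
  have "(\<lambda>\<theta>. exp (- (\<i> * complex_of_real \<theta>))) \<in> borel_measurable borel"
    "(\<lambda>\<theta>. exp (\<i> * complex_of_real \<theta>)) \<in> borel_measurable borel"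
    by (intro borel_measurable_continuous_onI continuous_intros)+
  from this[THEN measurable_compose[rotated], of "\<lambda>\<Theta>. \<Theta> (l, k)"]
  show ?thesis
    unfolding W_gate_component[OF generator_facts(1)[OF assms]] by measurable
qed

lemma U_upto_measurable:
  "l \<le> depth Q \<Longrightarrow> (\<lambda>\<Theta>. U_upto Q l \<Theta> x $ s $ t) \<in> borel_measurable (init_measure Q)"
proof (induction l arbitrary: s t)
  case (Suc l)
  then have "Suc l \<in> {1..depth Q}" by simp
  note [measurable] = W_gate_measurable[OF this]
  have [measurable]: "(\<lambda>\<Theta>. U_upto Q l \<Theta> x $ s $ t) \<in> borel_measurable (init_measure Q)" for s t
    using Suc by simp
  show ?case
    by (simp add: matrix_mult_component U_layer_def tensor_component)
qed simp

lemma local_output_measurable [measurable]: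
  "(\<lambda>\<Theta>. local_output Q k \<Theta> x) \<in> borel_measurable (init_measure Q)"
proof -
  note [measurable] = U_upto_measurable[OF order_refl]
  have [measurable]: "(\<lambda>\<Theta>. cnj (U_upto Q (depth Q) \<Theta> x $ s $ t)) \<in> borel_measurable (init_measure Q)" for s t
    by (rule measurable_compose[OF U_upto_measurable[OF order_refl]])
      (intro borel_measurable_continuous_onI continuous_intros)
  show ?thesis
    unfolding local_output_def braket_def matrix_vector_mult_def U_circuit_def
    by (simp add: matrix_mult_component)
qed

end

section \<open>Whitening\<close>

text \<open>The change of variables formulas of the library for linear maps on \<open>real^'n\<close> need a
  well-ordered index type; this one holds for every finite one.\<close>

lemma nn_integral_lborel_shear:
  fixes f :: "'a::euclidean_space \<Rightarrow> ennreal" and \<phi> :: "'a \<Rightarrow> real"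
  assumes e: "e \<in> Basis" and [measurable]: "f \<in> borel_measurable borel" "\<phi> \<in> borel_measurable borel"
    and \<phi>: "\<And>w x. \<phi> (w + x *\<^sub>R e) = \<phi> w"
  shows "(\<integral>\<^sup>+w. f (w + \<phi> w *\<^sub>R e) \<partial>lborel) = (\<integral>\<^sup>+w. f w \<partial>lborel)"
proof -
  interpret product_sigma_finite "\<lambda>_::'a. lborel :: real measure" by standard
  let ?B = "Basis - {e} :: 'a set"
  have B: "Basis = insert e ?B" using e by auto
  \<comment> \<open>Fubini with coordinate \<open>e\<close> innermost: once the other coordinates
    are fixed, the shear is a translation of a line.\<close>
  have int: "(\<integral>\<^sup>+w. g w \<partial>lborel) = (\<integral>\<^sup>+\<omega>. (\<integral>\<^sup>+x. g (x *\<^sub>R e + (\<Sum>b\<in>?B. \<omega> b *\<^sub>R b)) \<partial>lborel) \<partial>Pi\<^sub>M ?B (\<lambda>_. lborel))"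
    if [measurable]: "g \<in> borel_measurable borel" for g :: "'a \<Rightarrow> ennreal"
  proof -
    have upd: "(\<Sum>b\<in>Basis. fun_upd \<omega> e x b *\<^sub>R b) = x *\<^sub>R e + (\<Sum>b\<in>?B. \<omega> b *\<^sub>R b)" for \<omega> x
      using e by (subst sum.remove[of _ e]) (auto intro!: arg_cong2[of _ _ _ _ "(+)"] sum.cong)
    have "(\<integral>\<^sup>+w. g w \<partial>lborel) = (\<integral>\<^sup>+\<omega>. g (\<Sum>b\<in>Basis. \<omega> b *\<^sub>R b) \<partial>Pi\<^sub>M Basis (\<lambda>_. lborel))"
      by (subst lborel_eq, subst nn_integral_distr) auto
    also have "\<dots> = (\<integral>\<^sup>+\<omega>. g (\<Sum>b\<in>Basis. \<omega> b *\<^sub>R b) \<partial>Pi\<^sub>M (insert e ?B) (\<lambda>_. lborel))"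
      by (simp only: B[symmetric])
    also have "\<dots> = (\<integral>\<^sup>+\<omega>. (\<integral>\<^sup>+x. g (\<Sum>b\<in>Basis. fun_upd \<omega> e x b *\<^sub>R b) \<partial>lborel) \<partial>Pi\<^sub>M ?B (\<lambda>_. lborel))"
    proof (rule product_nn_integral_insert)
      show "(\<lambda>\<omega>. g (\<Sum>b\<in>Basis. \<omega> b *\<^sub>R b)) \<in> borel_measurable (Pi\<^sub>M (insert e ?B) (\<lambda>_. lborel))"
        unfolding B[symmetric] by measurable
    qed auto
    finally show ?thesis unfolding upd .
  qed
  have "(\<integral>\<^sup>+x. f ((x *\<^sub>R e + v) + \<phi> (x *\<^sub>R e + v) *\<^sub>R e) \<partial>lborel) = (\<integral>\<^sup>+x. f (x *\<^sub>R e + v) \<partial>lborel)" for v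
  proof -
    have eq: "(x *\<^sub>R e + v) + \<phi> (x *\<^sub>R e + v) *\<^sub>R e = (\<phi> v + 1 * x) *\<^sub>R e + v" for x
      using \<phi>[of v x] by (simp add: algebra_simps)
    have "(\<integral>\<^sup>+x. f (x *\<^sub>R e + v) \<partial>lborel) = ennreal \<bar>1\<bar> * (\<integral>\<^sup>+x. f ((\<phi> v + 1 * x) *\<^sub>R e + v) \<partial>lborel)"
      by (rule nn_integral_real_affine) auto
    then show ?thesis unfolding eq by simp
  qed
  then show ?thesis by (subst (1 2) int) auto
qed

text \<open>Induction over elementary matrices: diagonal matrices scale, transpositions permute the
  sides of boxes, and row operations are shears.\<close>

lemma nn_integral_lborel_linear:
  fixes A :: "real^'n^'n"
  assumes "det A \<noteq> 0" "f \<in> borel_measurable borel"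
  shows "(\<integral>\<^sup>+w. f w \<partial>lborel) = ennreal \<bar>det A\<bar> * (\<integral>\<^sup>+w. f (A *v w) \<partial>lborel)"
proof -
  \<comment> \<open>The premise on the determinant makes the case of a zero row vacuous. The
    quantifier over f lets a product use the formula of its right factor for f composed with the
    left one.\<close>
  define P :: "real^'n^'n \<Rightarrow> bool" where "P A \<longleftrightarrow> (det A \<noteq> 0 \<longrightarrow> (\<forall>f\<in>borel_measurable borel.
    (\<integral>\<^sup>+w. f w \<partial>lborel) = ennreal \<bar>det A\<bar> * (\<integral>\<^sup>+w. f (A *v w) \<partial>lborel)))" for A
  have mv [measurable]: "(*v) B \<in> borel_measurable borel" for B :: "real^'n^'n"
    by (intro borel_measurable_continuous_onI linear_continuous_on) (simp add: linear_conv_bounded_linear[symmetric])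
  have "P A"
  proof (rule induct_matrix_elementary)
    fix A B :: "real^'n^'n"
    assume A: "P A" and B: "P B"
    show "P (A ** B)"
      unfolding P_def
    proof (intro impI ballI)
      fix f :: "real^'n \<Rightarrow> ennreal"
      assume d: "det (A ** B) \<noteq> 0" and [measurable]: "f \<in> borel_measurable borel"
      have "det A \<noteq> 0" "det B \<noteq> 0" using d by (auto simp: det_mul)
      then have "(\<integral>\<^sup>+w. f w \<partial>lborel) = ennreal \<bar>det A\<bar> * (\<integral>\<^sup>+w. f (A *v w) \<partial>lborel)"
        using \<open>f \<in> borel_measurable borel\<close> by (intro A[unfolded P_def, rule_format])
      also have "(\<integral>\<^sup>+w. f (A *v w) \<partial>lborel) = ennreal \<bar>det B\<bar> * (\<integral>\<^sup>+w. f (A *v (B *v w)) \<partial>lborel)"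
      proof -
        have "(\<lambda>w. f (A *v w)) \<in> borel_measurable borel" by measurable
        then show ?thesis using \<open>det B \<noteq> 0\<close> by (intro B[unfolded P_def, rule_format])
      qed
      finally show "(\<integral>\<^sup>+w. f w \<partial>lborel) = ennreal \<bar>det (A ** B)\<bar> * (\<integral>\<^sup>+w. f (A ** B *v w) \<partial>lborel)"
        by (simp add: det_mul abs_mult ennreal_mult mult.assoc matrix_vector_mul_assoc)
    qed
  next
    fix A :: "real^'n^'n" and i assume "row i A = 0"
    then have "det A = 0" by (rule det_zero_row)
    then show "P A" by (simp add: P_def)
  next
    fix A :: "real^'n^'n" assume diag: "\<And>i j. i \<noteq> j \<Longrightarrow> A $ i $ j = 0"
    show "P A"
      unfolding P_def
    proof (intro impI ballI)
      fix f :: "real^'n \<Rightarrow> ennreal"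
      assume d: "det A \<noteq> 0" and [measurable]: "f \<in> borel_measurable borel"
      have det: "det A = (\<Prod>i\<in>UNIV. A $ i $ i)" by (rule det_diagonal) (rule diag)
      then have nz: "A $ i $ i \<noteq> 0" for i using d by auto
      define c where "c b = b \<bullet> (A *v b)" for b :: "real^'n"
      have c_axis: "c (axis i 1) = A $ i $ i" for i
        by (simp add: c_def inner_axis' matrix_vector_mul_component inner_axis row_def)
      have Basis: "(Basis :: (real^'n) set) = (\<lambda>i. axis i 1) ` UNIV" by (auto simp: Basis_vec_def)
      have inj: "inj (\<lambda>i::'n. axis i (1::real))" by (auto simp: inj_def axis_eq_axis)
      have T: "(0 + (\<Sum>j\<in>Basis. (c j * (x \<bullet> j)) *\<^sub>R j)) = A *v x" for x
      proof -
        have "(\<Sum>j\<in>Basis. (c j * (x \<bullet> j)) *\<^sub>R j) = (\<Sum>i\<in>UNIV. (A $ i $ i * x $ i) *\<^sub>R axis i 1)"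
          unfolding Basis by (simp add: sum.reindex[OF inj] c_axis inner_axis)
        moreover have "(\<Sum>i\<in>UNIV. (A $ i $ i * x $ i) *\<^sub>R axis i 1) $ k = (A *v x) $ k" for k
        proof -
          have "(A *v x) $ k = (\<Sum>j\<in>UNIV. if j = k then A $ k $ k * x $ k else 0)"
            unfolding matrix_vector_mult_def vec_lambda_beta
          proof (intro sum.cong refl)
            fix j show "A $ k $ j * x $ j = (if j = k then A $ k $ k * x $ k else 0)"
              using diag[of k j] by (cases "j = k") auto
          qed
          then show ?thesis by (simp add: axis_def if_distrib cong: if_cong)
        qed
        ultimately show ?thesis by (simp add: vec_eq_iff)
      qed
      have nzB: "c j \<noteq> 0" if "j \<in> Basis" for j
        using that nz c_axis by (auto simp: Basis)
      have "lborel = density (distr lborel borel ((*v) A)) (\<lambda>_. ennreal (\<Prod>j\<in>Basis. \<bar>c j\<bar>))"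
        by (rule lborel_affine_euclidean[of c "0 :: real^'n", OF nzB, unfolded T])
      also have "(\<Prod>j\<in>Basis. \<bar>c j\<bar>) = \<bar>det A\<bar>"
        unfolding Basis det by (simp add: prod.reindex[OF inj] c_axis abs_prod)
      finally have l: "lborel = density (distr lborel borel ((*v) A)) (\<lambda>_. ennreal \<bar>det A\<bar>)" .
      have "(\<integral>\<^sup>+w. f w \<partial>lborel) = (\<integral>\<^sup>+w. f w \<partial>density (distr lborel borel ((*v) A)) (\<lambda>_. ennreal \<bar>det A\<bar>))"
        using l by simp
      then show "(\<integral>\<^sup>+w. f w \<partial>lborel) = ennreal \<bar>det A\<bar> * (\<integral>\<^sup>+w. f (A *v w) \<partial>lborel)"
        by (simp add: nn_integral_density nn_integral_distr nn_integral_cmult)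
    qed
  next
    fix m n :: 'n assume mn: "m \<noteq> n"
    let ?t = "Transposition.transpose m n"
    let ?M = "(\<chi> i j. mat 1 $ i $ ?t j) :: real^'n^'n"
    have Mv: "(?M *v w) $ i = w $ ?t i" for w i
    proof -
      have "(?M *v w) $ i = (\<Sum>j\<in>UNIV. if j = ?t i then w $ j else 0)"
        unfolding matrix_vector_mult_def vec_lambda_beta
      proof (intro sum.cong refl)
        fix j
        have "i = ?t j \<longleftrightarrow> j = ?t i" by (metis transpose_involutory)
        then show "mat 1 $ i $ ?t j * w $ j = (if j = ?t i then w $ j else 0)"
          by (simp add: mat_def)
      qed
      then show ?thesis by simp
    qed
    have "?M ** ?M = mat 1"
    proof -
      have "(?M ** ?M) *v w = mat 1 *v w" for w
        by (simp add: vec_eq_iff Mv flip: matrix_vector_mul_assoc)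
      then show ?thesis by (simp add: matrix_eq)
    qed
    then have "det ?M * det ?M = 1" by (metis det_mul det_I)
    then have det: "\<bar>det ?M\<bar> = 1" by (simp only: power2_eq_square[symmetric] abs_square_eq_1)
    have Basis: "(Basis :: (real^'n) set) = (\<lambda>i. axis i 1) ` UNIV" by (auto simp: Basis_vec_def)
    have inj: "inj (\<lambda>i::'n. axis i (1::real))" by (auto simp: inj_def axis_eq_axis)
    have "lborel = distr lborel borel ((*v) ?M)"
    proof (rule lborel_eqI)
      fix l u :: "real^'n" assume lu: "\<And>b. b \<in> Basis \<Longrightarrow> l \<bullet> b \<le> u \<bullet> b"
      have le: "l $ i \<le> u $ i" for i using lu[of "axis i 1"] by (simp add: Basis inner_axis)
      have "(*v) ?M -` box l u = box (?M *v l) (?M *v u)"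
      proof (intro set_eqI)
        fix x
        have "x \<in> (*v) ?M -` box l u \<longleftrightarrow> (\<forall>i. l $ i < x $ ?t i \<and> x $ ?t i < u $ i)"
          by (simp add: mem_box_cart Mv)
        also have "\<dots> \<longleftrightarrow> (\<forall>i. l $ ?t i < x $ i \<and> x $ i < u $ ?t i)"
          by (metis transpose_involutory)
        finally show "x \<in> (*v) ?M -` box l u \<longleftrightarrow> x \<in> box (?M *v l) (?M *v u)"
          by (simp add: mem_box_cart Mv)
      qed
      then have "emeasure (distr lborel borel ((*v) ?M)) (box l u) = emeasure lborel (box (?M *v l) (?M *v u))"
        by (simp add: emeasure_distr)
      also have "\<dots> = ennreal (\<Prod>b\<in>Basis. (?M *v u - ?M *v l) \<bullet> b)"
        using le by (intro emeasure_lborel_box) (auto simp: Basis inner_axis Mv)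
      also have "(\<Prod>b\<in>Basis. (?M *v u - ?M *v l) \<bullet> b) = (\<Prod>i\<in>UNIV. (u - l) $ ?t i)"
        by (simp add: Basis prod.reindex[OF inj] inner_axis Mv)
      also have "\<dots> = (\<Prod>i\<in>UNIV. (u - l) $ i)"
        by (rule prod.reindex_bij_betw) (rule bij_transpose)
      also have "\<dots> = (\<Prod>b\<in>Basis. (u - l) \<bullet> b)"
        by (simp add: Basis prod.reindex[OF inj] inner_axis)
      finally show "emeasure (distr lborel borel ((*v) ?M)) (box l u) = ennreal (\<Prod>b\<in>Basis. (u - l) \<bullet> b)" .
    qed simp
    then have "(\<integral>\<^sup>+w. f w \<partial>lborel) = (\<integral>\<^sup>+w. f (?M *v w) \<partial>lborel)" if "f \<in> borel_measurable borel" for f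
      using that nn_integral_distr[of "(*v) ?M" lborel borel f] by simp
    then show "P ?M" unfolding P_def det ennreal_1 mult_1 by blast
  next
    fix m n :: 'n and c :: real assume mn: "m \<noteq> n"
    let ?M = "(\<chi> i j. if i = m \<and> j = n then c else of_bool (i = j)) :: real^'n^'n"
    have Mv: "?M *v w = w + (c * w $ n) *\<^sub>R axis m 1" for w
    proof -
      have "(?M *v w) $ i = w $ i + (if i = m then c * w $ n else 0)" for i
      proof -
        have "(?M *v w) $ i = (\<Sum>j\<in>UNIV. (if j = i then w $ i else 0) + (if j = n then (if i = m then c * w $ n else 0) else 0))"
          unfolding matrix_vector_mult_def vec_lambda_beta
        proof (intro sum.cong refl)
          fix j
          show "(if i = m \<and> j = n then c else of_bool (i = j)) * w $ j
              = (if j = i then w $ i else 0) + (if j = n then (if i = m then c * w $ n else 0) else 0)"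
            using mn by (cases "i = j"; cases "j = n"; cases "i = m") auto
        qed
        also have "\<dots> = w $ i + (if i = m then c * w $ n else 0)"
          unfolding sum.distrib by simp
        finally show ?thesis .
      qed
      then show ?thesis by (simp add: vec_eq_iff axis_def)
    qed
    have det: "\<bar>det ?M\<bar> = 1"
    proof -
      have "?M = (\<chi> k. if k = m then row m (mat 1) + c *s row n (mat 1) else row k (mat 1))"
        using mn by (auto simp: vec_eq_iff row_def mat_def of_bool_def)
      then show ?thesis using det_row_operation[OF mn, of "mat 1" c] by simp
    qed
    have "(\<integral>\<^sup>+w. f w \<partial>lborel) = (\<integral>\<^sup>+w. f (?M *v w) \<partial>lborel)" if "f \<in> borel_measurable borel" for f
      unfolding Mv using mn that
      by (intro nn_integral_lborel_shear[symmetric]) (auto simp: axis_def Basis_vec_def)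
    then show "P ?M" unfolding P_def det ennreal_1 mult_1 by blast
  qed
  then show ?thesis using assms by (intro \<open>P A\<close>[unfolded P_def, rule_format])
qed

section \<open>Positive definiteness and factorization of the covariance\<close>

lemma symmetric_inner:
  fixes K :: "real^'n^'n"
  assumes "transpose K = K"
  shows "x \<bullet> (K *v y) = (K *v x) \<bullet> y"
  using dot_lmul_matrix[of x K y] assms by (metis transpose_matrix_vector)

text \<open>If the form vanished at x, a small step from x in the direction -K x would make it
  negative: the linear term is a negative multiple of |K x|^2 and dominates the quadratic
  one.\<close>

lemma pos_def_of_invertible:
  fixes K :: "real^'n^'n"
  assumes sym: "transpose K = K" and psd: "\<And>x. x \<bullet> (K *v x) \<ge> 0" and inv: "invertible K" and "x \<noteq> 0"
  shows "x \<bullet> (K *v x) > 0"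
proof (rule ccontr)
  assume "\<not> x \<bullet> (K *v x) > 0"
  then have 0: "x \<bullet> (K *v x) = 0" using psd[of x] by linarith
  define y where "y = K *v x"
  define c where "c = y \<bullet> (K *v y)"
  have c: "c \<ge> 0" unfolding c_def by (rule psd)
  have "K *v x \<noteq> 0" using inv \<open>x \<noteq> 0\<close> by (metis invertible_def matrix_vector_mul_assoc matrix_vector_mul_lid matrix_vector_mult_0_right)
  then have q: "y \<bullet> y > 0" by (simp add: y_def)
  \<comment> \<open>A sufficiently small negative number; the denominator 1 + c tames the quadratic
    term r^2 c and cannot vanish.\<close>
  define r where "r = - (y \<bullet> y) / (1 + c)"
  have "0 \<le> (x + r *\<^sub>R y) \<bullet> (K *v (x + r *\<^sub>R y))" by (rule psd)
  also have "\<dots> = 2 * r * (y \<bullet> y) + r\<^sup>2 * c"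
    using 0 symmetric_inner[OF sym, of x y]
    by (simp add: matrix_vector_right_distrib matrix_vector_mult_scaleR inner_add_left inner_add_right
        y_def[symmetric] c_def[symmetric] power2_eq_square inner_commute algebra_simps)
  also have "\<dots> = (y \<bullet> y)\<^sup>2 / (1 + c) * (c / (1 + c) - 2)"
    using c by (simp add: r_def power2_eq_square divide_simps) (simp add: algebra_simps)
  also have "\<dots> < 0"
    using c q by (intro mult_pos_neg divide_pos_pos) (auto simp: divide_simps)
  finally show False by simp
qed

text \<open>Gram-Schmidt for the inner product \<open>x \<bullet> (K *v y)\<close>.\<close>

lemma exists_whitening:
  fixes K :: "real^'n^'n"
  assumes sym: "transpose K = K" and pos: "\<And>x. x \<noteq> 0 \<Longrightarrow> x \<bullet> (K *v x) > 0"
  obtains V :: "real^'n^'n" where "transpose V ** K ** V = mat 1"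
proof -
  have "\<exists>v. \<forall>i\<in>T. \<forall>j\<in>T. v i \<bullet> (K *v v j) = (if i = j then 1 else 0)" if "finite T" for T :: "'n set"
    using that
  proof (induction T rule: finite_induct)
    case (insert k T)
    then obtain v where v: "\<And>i j. i \<in> T \<Longrightarrow> j \<in> T \<Longrightarrow> v i \<bullet> (K *v v j) = (if i = j then 1 else 0)" by blast
    \<comment> \<open>The vectors K v_j found so far cannot span the space, so some nonzero x is
      orthogonal to all of them, that is, orthogonal to every v_j in the inner product of K.\<close>
    have "card T < CARD('n)"
      using insert.hyps by (metis UNIV_I card_seteq finite_class.finite_UNIV linorder_not_le subset_UNIV)
    moreover have "dim ((\<lambda>j. K *v v j) ` T) \<le> card T"
      using insert.hyps by (meson card_image_le dim_le_card finite_imageI order_trans span_superset)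
    ultimately have "dim ((\<lambda>j. K *v v j) ` T) < DIM(real^'n)" by simp
    then obtain x where x: "x \<noteq> 0" "\<And>y. y \<in> span ((\<lambda>j. K *v v j) ` T) \<Longrightarrow> orthogonal x y"
      using orthogonal_to_subspace_exists by blast
    have o: "x \<bullet> (K *v v j) = 0" if "j \<in> T" for j
      using x(2)[of "K *v v j"] that by (simp add: orthogonal_def span_base)
    have o': "v j \<bullet> (K *v x) = 0" if "j \<in> T" for j
      using o[OF that] symmetric_inner[OF sym, of "v j" x] by (simp add: inner_commute)
    define s where "s = sqrt (x \<bullet> (K *v x))"
    have s: "s > 0" "s * s = x \<bullet> (K *v x)" using pos[OF x(1)] by (auto simp: s_def)
    show ?case
    proof (intro exI[of _ "v(k := x /\<^sub>R s)"] ballI)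
      fix i j assume "i \<in> insert k T" "j \<in> insert k T"
      then show "(v(k := x /\<^sub>R s)) i \<bullet> (K *v (v(k := x /\<^sub>R s)) j) = (if i = j then 1 else 0)"
        using insert.hyps v o o' s by (auto simp: matrix_vector_mult_scaleR field_simps)
    qed
  qed simp
  then obtain v where v: "\<And>i j::'n. v i \<bullet> (K *v v j) = (if i = j then 1 else 0)"
    by (metis UNIV_I finite_class.finite_UNIV)
  define V :: "real^'n^'n" where "V = (\<chi> i j. v j $ i)"
  have "(transpose V ** K ** V) $ i $ j = v i \<bullet> (K *v v j)" for i j
    unfolding matrix_mul_assoc[symmetric]
    by (simp add: matrix_matrix_mult_def transpose_def V_def inner_vec_def matrix_vector_mult_def)
  then have "transpose V ** K ** V = mat 1" by (simp add: vec_eq_iff v mat_def)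
  then show ?thesis by (rule that)
qed

lemma matrix_inv_eqI:
  fixes A B :: "real^'n^'n"
  assumes "A ** B = mat 1"
  shows "matrix_inv A = B"
proof -
  have BA: "B ** A = mat 1" using assms by (simp add: matrix_left_right_inverse)
  have "A ** matrix_inv A = mat 1 \<and> matrix_inv A ** A = mat 1"
    unfolding matrix_inv_def by (rule someI[of _ B]) (use assms BA in blast)
  then show ?thesis by (metis BA matrix_mul_assoc matrix_mul_lid matrix_mul_rid)
qed

locale whitening =
  fixes K V :: "real^'n^'n"
  assumes sym: "transpose K = K" and VKV: "transpose V ** K ** V = mat 1"
begin

text \<open>This product is the inverse of \<open>transpose V\<close>. It maps whitened vectors back
  to the original coordinates, and S S^T = K makes it a square root of the covariance.\<close>

definition S :: "real^'n^'n"
  where "S = K ** V"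

lemma transpose_V_S: "transpose V ** S = mat 1"
  using VKV by (simp add: S_def matrix_mul_assoc)

lemma S_transpose_V: "S ** transpose V = mat 1"
  using transpose_V_S by (simp add: matrix_left_right_inverse)

lemma S_transpose_S: "S ** transpose S = K"
proof -
  have "S ** transpose S = S ** transpose V ** K"
    by (simp add: S_def matrix_transpose_mul sym matrix_mul_assoc)
  then show ?thesis by (simp add: S_transpose_V)
qed

lemma matrix_inv_K: "matrix_inv K = V ** transpose V"
  by (rule matrix_inv_eqI) (use S_transpose_V in \<open>simp add: S_def matrix_mul_assoc\<close>)

text \<open>V V^T is the inverse covariance. Hence whitening stretches lengths by at most the square
  root of its operator norm, which is how \<kappa> enters the bound.\<close>

lemma norm_transpose_V: "(norm (transpose V *v x))\<^sup>2 = x \<bullet> (matrix_inv K *v x)"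
proof -
  have "x \<bullet> (V *v (transpose V *v x)) = (transpose V *v x) \<bullet> (transpose V *v x)"
    by (metis dot_lmul_matrix transpose_matrix_vector transpose_transpose)
  then show ?thesis unfolding matrix_inv_K power2_norm_eq_inner by (simp only: matrix_vector_mul_assoc)
qed

lemma det_K: "det K = (det S)\<^sup>2"
  by (metis S_transpose_S det_mul det_transpose power2_eq_square)

lemma det_S: "det S \<noteq> 0"
  using S_transpose_V by (metis det_I det_mul mult_zero_left zero_neq_one)

text \<open>Change of variables z = S w: the quadratic form of the inverse covariance becomes |w|^2,
  and det K = (det S)^2 cancels the Jacobian.\<close>

lemma gaussian_eq_distr: "gaussian K = distr std_gauss borel ((*v) S)"
proof (rule measure_eqI)
  have [measurable]: "(*v) B \<in> borel_measurable borel" for B :: "real^'n^'n"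
    by (intro borel_measurable_continuous_onI linear_continuous_on) (simp add: linear_conv_bounded_linear[symmetric])
  fix A assume "A \<in> sets (gaussian K)"
  then have [measurable]: "A \<in> sets borel" by (simp add: gaussian_def)
  let ?p = "\<lambda>z. exp (- (z \<bullet> (matrix_inv K *v z)) / 2) / sqrt ((2 * pi) ^ CARD('n) * det K)"
  have p: "\<bar>det S\<bar> * ?p (S *v w) = gauss_density w" for w
  proof -
    have "(S *v w) \<bullet> (matrix_inv K *v (S *v w)) = (norm w)\<^sup>2"
    proof -
      have "transpose V *v (S *v w) = w"
        by (simp only: matrix_vector_mul_assoc transpose_V_S matrix_vector_mul_lid)
      then show ?thesis using norm_transpose_V[of "S *v w"] by (simp only:)
    qed
    moreover have "sqrt ((2 * pi) ^ CARD('n) * det K) = sqrt ((2 * pi) ^ CARD('n)) * \<bar>det S\<bar>"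
      by (simp add: det_K real_sqrt_mult)
    ultimately show ?thesis using det_S by (simp add: gauss_density_def)
  qed
  have "emeasure (gaussian K) A = (\<integral>\<^sup>+z. ennreal (?p z) * indicator A z \<partial>lborel)"
    unfolding gaussian_def by (rule emeasure_density) auto
  also have "\<dots> = ennreal \<bar>det S\<bar> * (\<integral>\<^sup>+w. ennreal (?p (S *v w)) * indicator A (S *v w) \<partial>lborel)"
    by (rule nn_integral_lborel_linear[OF det_S]) measurable
  also have "\<dots> = (\<integral>\<^sup>+w. ennreal \<bar>det S\<bar> * (ennreal (?p (S *v w)) * indicator A (S *v w)) \<partial>lborel)"
    by (rule nn_integral_cmult[symmetric]) measurable
  also have "\<dots> = (\<integral>\<^sup>+w. ennreal (gauss_density w) * indicator ((*v) S -` A) w \<partial>lborel)"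
  proof (intro nn_integral_cong)
    fix w
    have "ennreal (gauss_density w) = ennreal \<bar>det S\<bar> * ennreal (?p (S *v w))"
      unfolding p[symmetric] by (rule ennreal_mult') simp
    moreover have "indicator A (S *v w) = (indicator ((*v) S -` A) w :: ennreal)"
      by (simp add: indicator_def)
    ultimately show "ennreal \<bar>det S\<bar> * (ennreal (?p (S *v w)) * indicator A (S *v w))
        = ennreal (gauss_density w) * indicator ((*v) S -` A) w"
      by (simp only: mult.assoc)
  qed
  also have "\<dots> = emeasure std_gauss ((*v) S -` A)"
    unfolding std_gauss_def
    by (rule emeasure_density[symmetric]) (use measurable_sets[of "(*v) S" borel borel A] in auto)
  also have "\<dots> = emeasure (distr std_gauss borel ((*v) S)) A"
    by (simp add: emeasure_distr)
  finally show "emeasure (gaussian K) A = emeasure (distr std_gauss borel ((*v) S)) A" .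
qed (simp add: gaussian_def)

lemma norm_S_power2: "(norm (S *v w))\<^sup>2 = (\<Sum>i\<in>UNIV. (row i S \<bullet> w) * (row i S \<bullet> w))"
  by (simp add: power2_norm_eq_inner inner_vec_def matrix_vector_mul_component row_def)

lemma integrable_norm_S_power2: "integrable std_gauss (\<lambda>w. (norm (S *v w))\<^sup>2)"
  unfolding norm_S_power2 by (intro Bochner_Integration.integrable_sum integrable_std_gauss) auto

lemma second_moment_S: "(\<integral>w. (norm (S *v w))\<^sup>2 \<partial>std_gauss) = (\<Sum>i\<in>UNIV. K $ i $ i)"
proof -
  have "(\<integral>w. (norm (S *v w))\<^sup>2 \<partial>std_gauss) = (\<Sum>i\<in>UNIV. (\<integral>w. (row i S \<bullet> w) * (row i S \<bullet> w) \<partial>std_gauss))"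
    unfolding norm_S_power2 by (intro Bochner_Integration.integral_sum integrable_std_gauss) auto
  also have "\<dots> = (\<Sum>i\<in>UNIV. (S ** transpose S) $ i $ i)"
    by (simp only: gauss_moment_2) (simp add: matrix_matrix_mult_def transpose_def inner_vec_def row_def)
  finally show ?thesis by (simp add: S_transpose_S)
qed

end

section \<open>Gaussian limit of the network\<close>

text \<open>Coordinates of a product space are independent, and so are measurable functions of
  disjoint blocks of them. The work lies in writing f, which is given on the whole space, as a
  measurable function of the block A.\<close>

lemma integral_PiM_mult_disjoint_coordinates:
  fixes f g :: "('i \<Rightarrow> 'b) \<Rightarrow> real"
  assumes N: "\<And>i. i \<in> I \<Longrightarrow> prob_space (N i)"
    and AB: "A \<inter> B = {}" "A \<subseteq> I" "B \<subseteq> I"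
    and int: "integrable (Pi\<^sub>M I N) f" "integrable (Pi\<^sub>M I N) g"
    and f: "\<And>x y. (\<And>i. i \<in> A \<Longrightarrow> x i = y i) \<Longrightarrow> f x = f y"
    and g: "\<And>x y. (\<And>i. i \<in> B \<Longrightarrow> x i = y i) \<Longrightarrow> g x = g y"
  shows "(\<integral>\<omega>. f \<omega> * g \<omega> \<partial>Pi\<^sub>M I N) = (\<integral>\<omega>. f \<omega> \<partial>Pi\<^sub>M I N) * (\<integral>\<omega>. g \<omega> \<partial>Pi\<^sub>M I N)"
proof -
  define M where M: "M = Pi\<^sub>M I N"
  note int = int[folded M]
  interpret prob_space M unfolding M by (rule prob_space_PiM[OF N])
  obtain \<omega>0 where \<omega>0: "\<omega>0 \<in> space M" using not_empty by blast
  have \<omega>0': "\<omega>0 i \<in> space (N i)" if "i \<in> I" for i using \<omega>0 that by (auto simp: M space_PiM)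
  have indep: "indep_vars N (\<lambda>i \<omega>. \<omega> i) I"
  proof (cases "I = {}")
    case True
    then show ?thesis by (simp add: indep_vars_def indep_sets_def)
  next
    case False
    have rv: "random_variable (N i) (\<lambda>\<omega>. \<omega> i)" if "i \<in> I" for i using that by (simp add: M)
    have "distr M (Pi\<^sub>M I N) (\<lambda>x. \<lambda>i\<in>I. x i) = distr M M (\<lambda>x. x)"
      by (rule distr_cong) (auto simp: M space_PiM PiE_def extensional_restrict)
    also have "\<dots> = Pi\<^sub>M I N" by (simp add: distr_id2 M)
    also have "\<dots> = (\<Pi>\<^sub>M i\<in>I. distr M (N i) (\<lambda>\<omega>. \<omega> i))"
    proof (rule PiM_cong[OF refl])
      fix i assume "i \<in> I"
      then show "N i = distr M (N i) (\<lambda>\<omega>. \<omega> i)"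
        unfolding M by (intro distr_PiM_component[symmetric] N)
    qed
    finally show ?thesis
      using indep_vars_iff_distr_eq_PiM'[OF False rv] by simp
  qed
  \<comment> \<open>The coordinates outside the block are filled with those of the fixed point
    \<open>\<omega>0\<close>. Restricting to the block and extending again leaves f unchanged, and
    measurability on the block comes from measurability of the extension.\<close>
  define ext where "ext J a = (\<lambda>i\<in>I. if i \<in> J then a i else \<omega>0 i)" for J :: "'i set" and a
  have ext: "ext J \<in> measurable (Pi\<^sub>M J N) M" if "J \<subseteq> I" for J
    unfolding ext_def M
  proof (rule measurable_restrict)
    fix i assume "i \<in> I"
    then show "(\<lambda>a. if i \<in> J then a i else \<omega>0 i) \<in> measurable (Pi\<^sub>M J N) (N i)"
      using \<omega>0' by (cases "i \<in> J") (simp_all add: measurable_component_singleton)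
  qed
  have fm: "f \<in> borel_measurable M" "g \<in> borel_measurable M" using int by auto
  have "indep_var borel ((f \<circ> ext A) \<circ> (\<lambda>\<omega>. restrict (\<lambda>i. \<omega> i) A)) borel ((g \<circ> ext B) \<circ> (\<lambda>\<omega>. restrict (\<lambda>i. \<omega> i) B))"
    by (rule indep_var_compose[OF indep_var_restrict[OF indep AB]
          measurable_comp[OF ext[OF AB(2)] fm(1)] measurable_comp[OF ext[OF AB(3)] fm(2)]])
  moreover have "(f \<circ> ext A) \<circ> (\<lambda>\<omega>. restrict (\<lambda>i. \<omega> i) A) = f"
  proof
    fix \<omega>
    show "((f \<circ> ext A) \<circ> (\<lambda>\<omega>. restrict (\<lambda>i. \<omega> i) A)) \<omega> = f \<omega>"
      unfolding comp_def by (rule f) (use AB(2) in \<open>auto simp: ext_def\<close>)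
  qed
  moreover have "(g \<circ> ext B) \<circ> (\<lambda>\<omega>. restrict (\<lambda>i. \<omega> i) B) = g"
  proof
    fix \<omega>
    show "((g \<circ> ext B) \<circ> (\<lambda>\<omega>. restrict (\<lambda>i. \<omega> i) B)) \<omega> = g \<omega>"
      unfolding comp_def by (rule g) (use AB(3) in \<open>auto simp: ext_def\<close>)
  qed
  ultimately have "indep_var borel f borel g" by simp
  then show ?thesis unfolding M[symmetric] by (rule indep_var_lebesgue_integral[OF _ int])
qed

lemma (in prob_space) expectation_le_of_second_moment:
  fixes u :: "'a \<Rightarrow> real"
  assumes "\<tau> > 0" "integrable M u" "integrable M (\<lambda>\<omega>. (u \<omega>)\<^sup>2)" "expectation (\<lambda>\<omega>. (u \<omega>)\<^sup>2) \<le> \<tau>\<^sup>2"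
  shows "expectation u \<le> \<tau>"
proof -
  have "2 * \<tau> * expectation u = expectation (\<lambda>\<omega>. 2 * \<tau> * u \<omega>)" by simp
  also have "\<dots> \<le> expectation (\<lambda>\<omega>. (u \<omega>)\<^sup>2 + \<tau>\<^sup>2)"
  proof (intro integral_mono)
    fix \<omega>
    have "0 \<le> (u \<omega> - \<tau>)\<^sup>2" by simp
    then show "2 * \<tau> * u \<omega> \<le> (u \<omega>)\<^sup>2 + \<tau>\<^sup>2" by (simp add: power2_diff algebra_simps)
  qed (use assms in auto)
  also have "\<dots> \<le> \<tau>\<^sup>2 + \<tau>\<^sup>2" using assms by (simp add: prob_space)
  also have "\<dots> = 2 * \<tau> * \<tau>" by (simp add: power2_eq_square)
  finally show ?thesis using assms(1) by simp
qed

text \<open>The assumption on \<open>D'\<close> holds for positive integers and is needed for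
  \<open>(D' - 1) (D' - 4/3) \<ge> 0\<close>.\<close>

lemma numeric_bound:
  fixes n m D' N \<kappa> lam l :: real
  assumes n: "n \<ge> 1" and m: "m \<ge> 1" and D: "D' \<ge> 2 \<or> D' = 1" and N: "N \<ge> 1" "N\<^sup>2 \<le> m * D'"
    and \<kappa>: "\<kappa> \<ge> 0" and lam: "lam \<ge> 1" and l: "l \<ge> 0"
  shows "4 * sqrt n / N + 4/3 * ((sqrt n / N) * (sqrt \<kappa> * (sqrt n / N))\<^sup>2 * (m * (D' * (7/2 * D' - 2)))) * l
    \<le> n powr (3/2) * (2 * \<kappa> * sqrt lam + 6) * (m * D' powr (7/2) / N ^ 3) * (1 + l)"
proof -
  have D1: "D' \<ge> 1" using D by auto
  have nn: "n powr (3/2) = sqrt n * n"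
    using n powr_add[of n "1/2" 1] by (simp add: powr_half_sqrt)
  define R where "R = n powr (3/2) * (m * D' powr (7/2) / N ^ 3)"
  have "(D' - 1) * (D' - 4/3) \<ge> 0" using D by auto
  moreover have "(D' - 1) * (D' - 4/3) = D' * D' - 7/3 * D' + 4/3" by (simp add: field_simps)
  ultimately have "0 \<le> D' * D' - 7/3 * D' + 4/3" by (simp only:)
  \<comment> \<open>Equality holds at D' = 1, where 4/3 (7/2 - 2) is exactly the constant 2 of the
    claim.\<close>
  then have "2/3 * (7/2 * D' - 2) \<le> D' * D'" by (simp add: field_simps)
  then have "D' * (2/3 * (7/2 * D' - 2)) \<le> D' * (D' * D')" using D1 by (intro mult_left_mono) auto
  also have "\<dots> = D' powr 3" using D1 by (simp add: powr_numeral power3_eq_cube)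
  also have "\<dots> \<le> D' powr (7/2)" using D1 by (intro powr_mono) auto
  finally have D2: "D' * (2/3 * (7/2 * D' - 2)) \<le> D' powr (7/2)" .
  have "4/3 * ((sqrt n / N) * (sqrt \<kappa> * (sqrt n / N))\<^sup>2 * (m * (D' * (7/2 * D' - 2))))
      = (2 * \<kappa> * (sqrt n * n) * m / N ^ 3) * (D' * (2/3 * (7/2 * D' - 2)))"
    using \<kappa> n N(1) by (simp add: power_mult_distrib power_divide power3_eq_cube power2_eq_square field_simps)
  also have "\<dots> \<le> (2 * \<kappa> * (sqrt n * n) * m / N ^ 3) * D' powr (7/2)"
    using \<kappa> n m N D2 by (intro mult_left_mono) auto
  also have "\<dots> = 2 * \<kappa> * R" by (simp add: R_def nn)
  \<comment> \<open>The factor \<open>sqrt lam\<close> of the claim is inserted here, using lam >=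
    1.\<close>
  also have "\<dots> \<le> 2 * \<kappa> * sqrt lam * R"
  proof -
    have "R \<ge> 0" unfolding R_def using m N by auto
    moreover have "\<kappa> \<le> \<kappa> * sqrt lam" using \<kappa> lam by (simp add: mult_le_cancel_left1)
    ultimately show ?thesis by (simp add: mult_right_mono)
  qed
  finally have main: "4/3 * ((sqrt n / N) * (sqrt \<kappa> * (sqrt n / N))\<^sup>2 * (m * (D' * (7/2 * D' - 2)))) \<le> 2 * \<kappa> * sqrt lam * R" .
  have "1 / N \<le> m * D' / N ^ 3"
    using N by (simp add: field_simps power2_eq_square power3_eq_cube)
  also have "\<dots> \<le> m * D' powr (7/2) / N ^ 3"
    using D1 m N powr_mono[of 1 "7/2" D'] by (intro divide_right_mono mult_left_mono) auto
  finally have "sqrt n * (1 / N) \<le> n powr (3/2) * (m * D' powr (7/2) / N ^ 3)"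
    using n N unfolding nn by (intro mult_mono) auto
  then have "sqrt n * (1 / N) \<le> R" by (simp only: R_def)
  moreover have R: "R \<ge> 0" unfolding R_def using m N by auto
  ultimately have first: "4 * sqrt n / N \<le> 6 * R" by simp
  have "4 * sqrt n / N + 4/3 * ((sqrt n / N) * (sqrt \<kappa> * (sqrt n / N))\<^sup>2 * (m * (D' * (7/2 * D' - 2)))) * l
      \<le> 6 * R + 2 * \<kappa> * sqrt lam * R * l"
    using first main l by (intro add_mono mult_right_mono)
  also have "\<dots> \<le> (2 * \<kappa> * sqrt lam + 6) * R * (1 + l)"
    using R \<kappa> lam l by (simp add: algebra_simps)
  finally show ?thesis by (simp add: R_def mult_ac)
qed

locale gaussian_limit = network Q X
  for Q :: "('q::finite, 'x) qnn" and X :: "'x set" +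
  fixes xs :: "'x^'n"
  assumes xs: "bij_betw (\<lambda>i. xs $ i) UNIV X"
    and centered: "\<And>k x. x \<in> X \<Longrightarrow> (\<integral>\<Theta>. local_output Q k \<Theta> x \<partial>init_measure Q) = 0"
    and max_K0: "(MAX x\<in>X. K0 Q x x) = 1"
    and N1: "normalization Q \<ge> 1"
    and inv: "invertible (K0_matrix Q xs)"
begin

abbreviation "N \<equiv> normalization Q"
abbreviation "K \<equiv> K0_matrix Q xs"
abbreviation "D \<equiv> max_past Q * max_future Q"

sublocale init: prob_space "init_measure Q"
  by (rule prob_space_init)

lemma xs_in [simp]: "xs $ i \<in> X"
  using xs by (auto simp: bij_betw_def)

definition y :: "'q \<Rightarrow> (nat \<times> 'q \<Rightarrow> real) \<Rightarrow> real^'n"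
  where "y k \<Theta> = (\<chi> i. local_output Q k \<Theta> (xs $ i) / N)"

definition f :: "(nat \<times> 'q \<Rightarrow> real) \<Rightarrow> real^'n"
  where "f \<Theta> = (\<chi> i. network_output Q \<Theta> (xs $ i))"

lemma f_eq_sum: "f \<Theta> = (\<Sum>k\<in>UNIV. y k \<Theta>)"
  by (simp add: vec_eq_iff f_def y_def network_output_def sum_divide_distrib)

lemma vec_measurable:
  fixes g :: "'b \<Rightarrow> real^'n"
  assumes "\<And>i. (\<lambda>\<omega>. g \<omega> $ i) \<in> borel_measurable M"
  shows "g \<in> borel_measurable M"
proof (rule borel_measurable_euclidean_space[THEN iffD2], intro ballI)
  fix b :: "real^'n" assume "b \<in> Basis"
  then obtain i where "b = axis i 1" by (auto simp: Basis_vec_def)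
  then show "(\<lambda>\<omega>. g \<omega> \<bullet> b) \<in> borel_measurable M" using assms[of i] by (simp add: inner_axis)
qed

lemma y_measurable [measurable]: "y k \<in> borel_measurable (init_measure Q)"
  by (rule vec_measurable) (simp add: y_def)

lemma f_measurable [measurable]: "f \<in> borel_measurable (init_measure Q)"
  unfolding f_eq_sum[abs_def] by measurable

lemma y_light_cone: "(\<And>i. i \<in> past_cone Q k \<Longrightarrow> \<Theta> i = \<Theta>' i) \<Longrightarrow> y k \<Theta> = y k \<Theta>'"
  unfolding y_def by (intro Cart_lambda_cong arg_cong2[where f = divide] refl local_output_light_cone xs_in)

lemma abs_y_component: "\<bar>y k \<Theta> $ i\<bar> \<le> 1 / N"
  using abs_local_output_le[OF xs_in, of k \<Theta> i] N1 by (simp add: y_def divide_right_mono)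

lemma norm_y: "norm (y k \<Theta>) \<le> sqrt CARD('n) / N"
proof -
  have "(norm (y k \<Theta>))\<^sup>2 = (\<Sum>i\<in>UNIV. (y k \<Theta> $ i)\<^sup>2)"
    unfolding power2_norm_eq_inner by (simp add: inner_vec_def power2_eq_square)
  also have "\<dots> \<le> (\<Sum>i\<in>(UNIV::'n set). (1 / N)\<^sup>2)"
    using abs_y_component N1 by (intro sum_mono) (metis abs_le_square_iff abs_of_nonneg divide_nonneg_nonneg order_trans zero_le_one)
  also have "\<dots> = (sqrt CARD('n) / N)\<^sup>2" by (simp add: power_divide)
  finally show ?thesis using N1 by (simp add: power2_le_iff_abs_le)
qed

lemma integrable_y: "integrable (init_measure Q) (\<lambda>\<Theta>. y k \<Theta> $ i)"
proof (rule init.integrable_const_bound[where B = "1 / N"])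
  have "(\<lambda>\<Theta>. y k \<Theta> \<bullet> axis i 1) \<in> borel_measurable (init_measure Q)" by measurable
  then show "(\<lambda>\<Theta>. y k \<Theta> $ i) \<in> borel_measurable (init_measure Q)" by (simp add: inner_axis)
qed (use abs_y_component in auto)

lemma integrable_y_y: "integrable (init_measure Q) (\<lambda>\<Theta>. y k \<Theta> $ i * y k' \<Theta> $ j)"
proof (rule init.integrable_const_bound[where B = "1 / N * (1 / N)"])
  have "(\<lambda>\<Theta>. (y k \<Theta> \<bullet> axis i 1) * (y k' \<Theta> \<bullet> axis j 1)) \<in> borel_measurable (init_measure Q)" by measurable
  then show "(\<lambda>\<Theta>. y k \<Theta> $ i * y k' \<Theta> $ j) \<in> borel_measurable (init_measure Q)" by (simp add: inner_axis)
  have "\<bar>y k \<Theta> $ i * y k' \<Theta> $ j\<bar> \<le> 1 / N * (1 / N)" for \<Theta>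
    unfolding abs_mult using abs_y_component N1 by (intro mult_mono) auto
  then show "AE \<Theta> in init_measure Q. norm (y k \<Theta> $ i * y k' \<Theta> $ j) \<le> 1 / N * (1 / N)" by simp
qed

lemma expectation_y: "init.expectation (\<lambda>\<Theta>. y k \<Theta> $ i) = 0"
  using centered[OF xs_in, of k i] by (simp add: y_def)

definition nbhd :: "'q \<Rightarrow> 'q set"
  where "nbhd k = {k'. past_cone Q k \<inter> past_cone Q k' \<noteq> {}}"

lemma past_cone_subset: "past_cone Q k \<subseteq> param_indices Q"
  by (auto simp: past_cone_def param_indices_def)

lemma finite_params: "finite (param_indices Q)"
  by (simp add: param_indices_def)

lemma finite_past_cone: "finite (past_cone Q k)"
  using past_cone_subset finite_params by (rule finite_subset)

lemma self_nbhd: "k \<in> nbhd k"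
proof -
  have "depth Q \<ge> 1" using wf by (simp add: wf_qnn_def)
  moreover have "k \<in> cone_qubits Q (depth Q) k"
    by (subst cone_qubits.simps) (simp add: interaction_nbhd_def)
  ultimately have "(depth Q, k) \<in> past_cone Q k" by (auto simp: past_cone_def)
  then show ?thesis by (auto simp: nbhd_def)
qed

text \<open>A neighbour shares a parameter with k: it lies in the future cone of one of the at most
  \<open>max_past Q\<close> parameters in the past cone of k, and each of these cones has at most
  \<open>max_future Q\<close> elements.\<close>

lemma card_nbhd: "card (nbhd k) \<le> D"
proof -
  have "nbhd k \<subseteq> (\<Union>i\<in>past_cone Q k. future_cone Q i)"
    by (auto simp: nbhd_def future_cone_def)
  then have "card (nbhd k) \<le> card (\<Union>i\<in>past_cone Q k. future_cone Q i)"
    by (intro card_mono) auto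
  also have "\<dots> \<le> (\<Sum>i\<in>past_cone Q k. card (future_cone Q i))"
    by (rule card_UN_le) (rule finite_past_cone)
  also have "\<dots> \<le> (\<Sum>i\<in>past_cone Q k. max_future Q)"
    using past_cone_subset finite_params unfolding max_future_def
    by (intro sum_mono Max_ge) auto
  also have "\<dots> = card (past_cone Q k) * max_future Q" by simp
  also have "\<dots> \<le> max_past Q * max_future Q"
    unfolding max_past_def by (intro mult_right_mono Max_ge) auto
  finally show ?thesis .
qed

lemma D_pos: "D \<ge> 1"
proof -
  have "card (nbhd undefined) \<noteq> 0" using self_nbhd[of undefined] by auto
  with card_nbhd[of undefined] show ?thesis by linarith
qed

lemma expectation_mult_disjoint_cones:
  fixes u v :: "(nat \<times> 'q \<Rightarrow> real) \<Rightarrow> real"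
  assumes "A \<inter> B = {}" "A \<subseteq> param_indices Q" "B \<subseteq> param_indices Q"
    and "integrable (init_measure Q) u" "integrable (init_measure Q) v"
    and "\<And>\<Theta> \<Theta>'. (\<And>i. i \<in> A \<Longrightarrow> \<Theta> i = \<Theta>' i) \<Longrightarrow> u \<Theta> = u \<Theta>'"
    and "\<And>\<Theta> \<Theta>'. (\<And>i. i \<in> B \<Longrightarrow> \<Theta> i = \<Theta>' i) \<Longrightarrow> v \<Theta> = v \<Theta>'"
  shows "init.expectation (\<lambda>\<Theta>. u \<Theta> * v \<Theta>) = init.expectation u * init.expectation v"
  unfolding init_measure_def
proof (rule integral_PiM_mult_disjoint_coordinates[where A = A and B = B])
  show "prob_space (uniform_measure lborel {0..pi::real})" by (rule prob_space_uniform_measure) auto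
qed (fact assms[unfolded init_measure_def])+

lemma integrable_y_inner: "integrable (init_measure Q) (\<lambda>\<Theta>. y k \<Theta> \<bullet> u)"
  by (simp add: inner_vec_def Bochner_Integration.integrable_sum integrable_y)

lemma expectation_y_inner: "init.expectation (\<lambda>\<Theta>. y k \<Theta> \<bullet> u) = 0"
  by (simp add: inner_vec_def Bochner_Integration.integral_sum integrable_y expectation_y)

lemma expectation_y_y_inner_far:
  assumes "k' \<notin> nbhd k"
  shows "init.expectation (\<lambda>\<Theta>. (y k \<Theta> \<bullet> u) * (y k' \<Theta> \<bullet> v)) = 0"
proof -
  have "init.expectation (\<lambda>\<Theta>. (y k \<Theta> \<bullet> u) * (y k' \<Theta> \<bullet> v))
      = init.expectation (\<lambda>\<Theta>. y k \<Theta> \<bullet> u) * init.expectation (\<lambda>\<Theta>. y k' \<Theta> \<bullet> v)"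
  proof (rule expectation_mult_disjoint_cones)
    show "past_cone Q k \<inter> past_cone Q k' = {}" using assms by (simp add: nbhd_def)
    show "\<And>\<Theta> \<Theta>'. (\<And>i. i \<in> past_cone Q k \<Longrightarrow> \<Theta> i = \<Theta>' i) \<Longrightarrow> y k \<Theta> \<bullet> u = y k \<Theta>' \<bullet> u"
      by (intro arg_cong2[where f = inner] refl y_light_cone)
    show "\<And>\<Theta> \<Theta>'. (\<And>i. i \<in> past_cone Q k' \<Longrightarrow> \<Theta> i = \<Theta>' i) \<Longrightarrow> y k' \<Theta> \<bullet> v = y k' \<Theta>' \<bullet> v"
      by (intro arg_cong2[where f = inner] refl y_light_cone)
  qed (rule past_cone_subset integrable_y_inner)+
  then show ?thesis by (simp add: expectation_y_inner)
qed

lemma expectation_y_y_far: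
  "k' \<notin> nbhd k \<Longrightarrow> init.expectation (\<lambda>\<Theta>. y k \<Theta> $ i * y k' \<Theta> $ j) = 0"
  using expectation_y_y_inner_far[of k' k "axis i 1" "axis j 1"] by (simp add: inner_axis)

lemma K_component: "K $ i $ j = init.expectation (\<lambda>\<Theta>. f \<Theta> $ i * f \<Theta> $ j)"
  by (simp add: K0_matrix_def K0_def f_def)

lemma f_component: "f \<Theta> $ i = (\<Sum>k\<in>UNIV. y k \<Theta> $ i)"
  by (simp add: f_eq_sum)

lemma K_eq_sum: "K $ i $ j = (\<Sum>k\<in>UNIV. \<Sum>k'\<in>nbhd k. init.expectation (\<lambda>\<Theta>. y k \<Theta> $ i * y k' \<Theta> $ j))"
proof -
  have "K $ i $ j = init.expectation (\<lambda>\<Theta>. \<Sum>k\<in>UNIV. \<Sum>k'\<in>UNIV. y k \<Theta> $ i * y k' \<Theta> $ j)"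
    unfolding K_component f_component sum_product ..
  also have "\<dots> = (\<Sum>k\<in>UNIV. \<Sum>k'\<in>UNIV. init.expectation (\<lambda>\<Theta>. y k \<Theta> $ i * y k' \<Theta> $ j))"
    by (simp add: Bochner_Integration.integral_sum Bochner_Integration.integrable_sum integrable_y_y)
  also have "\<dots> = (\<Sum>k\<in>UNIV. \<Sum>k'\<in>nbhd k. init.expectation (\<lambda>\<Theta>. y k \<Theta> $ i * y k' \<Theta> $ j))"
    by (intro sum.cong refl sum.mono_neutral_right) (auto simp: expectation_y_y_far)
  finally show ?thesis .
qed

lemma integrable_f_f: "integrable (init_measure Q) (\<lambda>\<Theta>. f \<Theta> $ i * f \<Theta> $ j)"
  unfolding f_component sum_product by (intro Bochner_Integration.integrable_sum integrable_y_y)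

lemma K_sym: "transpose K = K"
  by (simp add: vec_eq_iff transpose_def K_component mult.commute)

lemma inner_K: "u \<bullet> (K *v v) = init.expectation (\<lambda>\<Theta>. (f \<Theta> \<bullet> u) * (f \<Theta> \<bullet> v))"
proof -
  have "(f \<Theta> \<bullet> u) * (f \<Theta> \<bullet> v) = (\<Sum>i\<in>UNIV. \<Sum>j\<in>UNIV. (u $ i * v $ j) * (f \<Theta> $ i * f \<Theta> $ j))" for \<Theta>
    by (simp add: inner_vec_def sum_product mult_ac)
  then have "init.expectation (\<lambda>\<Theta>. (f \<Theta> \<bullet> u) * (f \<Theta> \<bullet> v))
      = (\<Sum>i\<in>UNIV. \<Sum>j\<in>UNIV. (u $ i * v $ j) * K $ i $ j)"
    by (simp add: Bochner_Integration.integral_sum Bochner_Integration.integrable_sum integrable_f_f K_component)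
  also have "\<dots> = u \<bullet> (K *v v)"
    by (simp add: inner_vec_def matrix_vector_mult_def sum_distrib_left mult_ac)
  finally show ?thesis by simp
qed

lemma K_pos: "u \<noteq> 0 \<Longrightarrow> u \<bullet> (K *v u) > 0"
proof (rule pos_def_of_invertible[OF K_sym _ inv])
  show "v \<bullet> (K *v v) \<ge> 0" for v unfolding inner_K by (intro integral_nonneg_AE) auto
qed

lemma finite_X: "finite X"
  using xs by (metis bij_betw_finite finite_class.finite_UNIV)

lemma card_X: "card X = CARD('n)"
  using bij_betw_same_card[OF xs] by simp

lemma K_diag_le: "K $ i $ i \<le> 1"
  unfolding max_K0[symmetric] using finite_X by (auto simp: K0_matrix_def intro!: Max_ge)

lemma exists_K_diag: "\<exists>i. K $ i $ i = 1"
proof -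
  have "(MAX x\<in>X. K0 Q x x) \<in> (\<lambda>x. K0 Q x x) ` X"
    using finite_X xs_in[of undefined] by (intro Max_in) blast+
  then obtain x where "x \<in> X" "K0 Q x x = 1" using max_K0 by auto
  moreover obtain i where "x = xs $ i" using xs \<open>x \<in> X\<close> by (auto simp: bij_betw_def)
  ultimately show ?thesis by (auto simp: K0_matrix_def)
qed

lemma trace_K_le: "(\<Sum>i\<in>UNIV. K $ i $ i) \<le> CARD('n)"
  using sum_mono[of UNIV "\<lambda>i. K $ i $ i" "\<lambda>_. 1"] K_diag_le by simp

text \<open>Some input has variance 1, and this variance is a sum over at most m D dependent pairs
  of terms of size at most 1 / N^2.\<close>

lemma normalization_le: "N\<^sup>2 \<le> CARD('q) * D"
proof -
  obtain i where i: "K $ i $ i = 1" using exists_K_diag by blast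
  have "1 = (\<Sum>k\<in>UNIV. \<Sum>k'\<in>nbhd k. init.expectation (\<lambda>\<Theta>. y k \<Theta> $ i * y k' \<Theta> $ i))"
    using i K_eq_sum by simp
  also have "\<dots> \<le> (\<Sum>k\<in>(UNIV::'q set). \<Sum>k'\<in>nbhd k. 1 / N\<^sup>2)"
  proof (intro sum_mono)
    fix k k'
    have b: "\<bar>y k \<Theta> $ i * y k' \<Theta> $ i\<bar> \<le> 1 / N * (1 / N)" for \<Theta>
      unfolding abs_mult using abs_y_component N1 by (intro mult_mono) auto
    have "init.expectation (\<lambda>\<Theta>. y k \<Theta> $ i * y k' \<Theta> $ i) \<le> init.expectation (\<lambda>\<Theta>. 1 / N * (1 / N))"
      using b by (intro integral_mono integrable_y_y) (auto simp: abs_le_iff)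
    then show "init.expectation (\<lambda>\<Theta>. y k \<Theta> $ i * y k' \<Theta> $ i) \<le> 1 / N\<^sup>2"
      by (simp add: init.prob_space power2_eq_square)
  qed
  also have "\<dots> = (\<Sum>k\<in>(UNIV::'q set). real (card (nbhd k))) / N\<^sup>2"
    by (simp add: sum_divide_distrib)
  also have "\<dots> \<le> (\<Sum>k\<in>(UNIV::'q set). real D) / N\<^sup>2"
    using card_nbhd by (intro divide_right_mono sum_mono) (auto simp del: of_nat_mult)
  finally show ?thesis using N1 by (simp add: field_simps)
qed

text \<open>The basis vector of an input with variance 1 is not shortened by \<open>K\<close>. This
  is what allows \<open>numeric_bound\<close> to insert the square root of the norm.\<close>

lemma op_norm_K: "op_norm K \<ge> 1"
proof -
  obtain i where i: "K $ i $ i = 1" using exists_K_diag by blast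
  have "1 = (K *v axis i 1) $ i" using i by (simp add: matrix_vector_mult_basis column_def)
  also have "\<dots> \<le> norm (K *v axis i 1)" using component_le_norm_cart[of "K *v axis i 1" i] by linarith
  also have "\<dots> \<le> op_norm K * norm (axis i (1::real))"
    unfolding op_norm_def by (rule onorm) (simp add: linear_conv_bounded_linear[symmetric])
  finally show ?thesis by (simp add: norm_axis_1)
qed

lemma op_norm_inv: "op_norm (matrix_inv K) \<ge> 0"
  unfolding op_norm_def by (rule onorm_pos_le) (simp add: linear_conv_bounded_linear[symmetric])

end

lemma abs_inner_le_op_norm: "\<bar>x \<bullet> (A *v x)\<bar> \<le> op_norm A * (norm x)\<^sup>2"
proof -
  have "\<bar>x \<bullet> (A *v x)\<bar> \<le> norm x * norm (A *v x)" by (rule Cauchy_Schwarz_ineq2)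
  also have "\<dots> \<le> norm x * (op_norm A * norm x)"
    unfolding op_norm_def
    by (intro mult_left_mono onorm norm_ge_zero) (simp add: linear_conv_bounded_linear[symmetric])
  finally show ?thesis by (simp add: power2_eq_square mult_ac)
qed

lemma inner_transpose_mult: "(transpose A *v x) \<bullet> e = x \<bullet> (A *v e)" for A :: "real^'n^'m"
  by (simp add: dot_lmul_matrix)

lemma matrix_vector_mult_measurable [measurable]:
  "(*v) A \<in> borel_measurable borel" for A :: "real^'n^'m"
  by (intro borel_measurable_continuous_onI matrix_vector_mult_linear_continuous_on)

context gaussian_limit
begin

lemma integrable_y_y_inner: "integrable (init_measure Q) (\<lambda>\<Theta>. (y k \<Theta> \<bullet> u) * (y k' \<Theta> \<bullet> v))"
proof -
  have "(y k \<Theta> \<bullet> u) * (y k' \<Theta> \<bullet> v) = (\<Sum>i\<in>UNIV. \<Sum>j\<in>UNIV. (u $ i * v $ j) * (y k \<Theta> $ i * y k' \<Theta> $ j))" for \<Theta>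
    by (simp add: inner_vec_def sum_product mult_ac)
  then show ?thesis by (simp add: Bochner_Integration.integrable_sum integrable_y_y)
qed

lemma norm_f_power2: "(norm (f \<Theta>))\<^sup>2 = (\<Sum>i\<in>UNIV. f \<Theta> $ i * f \<Theta> $ i)"
  unfolding power2_norm_eq_inner by (simp add: inner_vec_def)

lemma integrable_norm_f_power2: "integrable (init_measure Q) (\<lambda>\<Theta>. (norm (f \<Theta>))\<^sup>2)"
  unfolding norm_f_power2 by (intro Bochner_Integration.integrable_sum integrable_f_f)

lemma integrable_norm_f: "integrable (init_measure Q) (\<lambda>\<Theta>. norm (f \<Theta>))"
  by (rule init.square_integrable_imp_integrable) (auto intro: integrable_norm_f_power2)

lemma expectation_norm_f: "init.expectation (\<lambda>\<Theta>. norm (f \<Theta>)) \<le> sqrt CARD('n)"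
proof (rule init.expectation_le_of_second_moment)
  show "init.expectation (\<lambda>\<Theta>. (norm (f \<Theta>))\<^sup>2) \<le> (sqrt CARD('n))\<^sup>2"
    unfolding norm_f_power2
    using trace_K_le by (simp add: Bochner_Integration.integral_sum integrable_f_f K_component)
qed (auto intro: integrable_norm_f integrable_norm_f_power2)

end

locale whitened_limit = gaussian_limit Q X xs + whitening "K0_matrix Q xs" V
  for Q :: "('q::finite, 'x) qnn" and X and xs :: "'x^'n" and V
begin

abbreviation "\<kappa> \<equiv> op_norm (matrix_inv K)"

lemma S_y: "S *v (transpose V *v x) = x"
  by (simp add: matrix_vector_mul_assoc S_transpose_V del: transpose_matrix_vector)

lemma norm_V_y: "norm (transpose V *v y k \<Theta>) \<le> sqrt \<kappa> * (sqrt CARD('n) / N)"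
proof -
  have "(norm (transpose V *v y k \<Theta>))\<^sup>2 \<le> \<kappa> * (norm (y k \<Theta>))\<^sup>2"
    unfolding norm_transpose_V using abs_inner_le_op_norm[of "y k \<Theta>" "matrix_inv K"] by linarith
  also have "\<dots> \<le> \<kappa> * (sqrt CARD('n) / N)\<^sup>2"
    using op_norm_inv norm_y by (intro mult_left_mono power_mono) auto
  also have "\<dots> = (sqrt \<kappa> * (sqrt CARD('n) / N))\<^sup>2"
    using op_norm_inv by (simp only: power_mult_distrib real_sqrt_pow2)
  finally show ?thesis
    by (rule power2_le_imp_le) (use op_norm_inv N1 in auto)
qed

lemma V_y_measurable [measurable]: "(\<lambda>\<Theta>. transpose V *v y k \<Theta>) \<in> borel_measurable (init_measure Q)"
  by (rule measurable_compose[OF y_measurable matrix_vector_mult_measurable])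

lemma integrable_locally_bounded:
  fixes \<psi> :: "real^'n \<Rightarrow> real"
  assumes [measurable]: "\<psi> \<in> borel_measurable borel"
    and bounded: "\<And>R. \<exists>C. \<forall>x. norm x \<le> R \<longrightarrow> \<bar>\<psi> x\<bar> \<le> C"
  shows "integrable (init_measure Q) (\<lambda>\<Theta>. \<psi> (\<Sum>j\<in>J. transpose V *v y j \<Theta>))"
proof -
  obtain C where C: "\<And>x. norm x \<le> (\<Sum>j\<in>J. sqrt \<kappa> * (sqrt CARD('n) / N)) \<Longrightarrow> \<bar>\<psi> x\<bar> \<le> C"
    using bounded by blast
  have "\<bar>\<psi> (\<Sum>j\<in>J. transpose V *v y j \<Theta>)\<bar> \<le> C" for \<Theta>
    by (intro C sum_norm_le norm_V_y)
  then show ?thesis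
    by (intro init.integrable_const_bound[where B = C]) (simp_all del: transpose_matrix_vector)
qed

lemma far_cones: "J \<inter> nbhd k = {} \<Longrightarrow> past_cone Q k \<inter> (\<Union>j\<in>J. past_cone Q j) = {}"
  by (auto simp: nbhd_def)

lemma sum_light_cone:
  assumes "\<And>i. i \<in> (\<Union>j\<in>J. past_cone Q j) \<Longrightarrow> \<Theta> i = \<Theta>' i"
  shows "\<psi> (\<Sum>j\<in>J. transpose V *v y j \<Theta>) = \<psi> (\<Sum>j\<in>J. transpose V *v y j \<Theta>')"
proof -
  have "y j \<Theta> = y j \<Theta>'" if "j \<in> J" for j
    by (rule y_light_cone, rule assms) (use that in blast)
  then have "(\<Sum>j\<in>J. transpose V *v y j \<Theta>) = (\<Sum>j\<in>J. transpose V *v y j \<Theta>')"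
    by (intro sum.cong refl arg_cong[where f = "(*v) (transpose V)"])
  then show ?thesis by (rule arg_cong)
qed

text \<open>The whitened bound carries sqrt \<kappa>; the bound after applying \<open>S\<close> does
  not. Moving \<open>V\<close> onto the test vectors turns components of the whitened summands into
  inner products with \<open>y k\<close>, which are centered and depend only on the past cone of
  k.\<close>

sublocale stein: local_dependence "init_measure Q" "\<lambda>k \<Theta>. transpose V *v y k \<Theta>" nbhd "(*v) S"
  "sqrt \<kappa> * (sqrt CARD('n) / N)" "sqrt CARD('n) / N" D
proof (intro local_dependence.intro local_dependence_axioms.intro init.prob_space_axioms)
  fix k k' :: 'q and e e' :: "real^'n" and \<psi> :: "real^'n \<Rightarrow> real"
  assume \<psi>: "\<psi> \<in> borel_measurable borel" "\<And>R. \<exists>C. \<forall>x. norm x \<le> R \<longrightarrow> \<bar>\<psi> x\<bar> \<le> C"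
  have "init.expectation (\<lambda>\<Theta>. (y k \<Theta> \<bullet> (V *v e)) * \<psi> (\<Sum>j\<in>-nbhd k. transpose V *v y j \<Theta>))
      = init.expectation (\<lambda>\<Theta>. y k \<Theta> \<bullet> (V *v e)) * init.expectation (\<lambda>\<Theta>. \<psi> (\<Sum>j\<in>-nbhd k. transpose V *v y j \<Theta>))"
  proof (rule expectation_mult_disjoint_cones[OF far_cones])
    show "\<And>\<Theta> \<Theta>'. (\<And>i. i \<in> past_cone Q k \<Longrightarrow> \<Theta> i = \<Theta>' i) \<Longrightarrow> y k \<Theta> \<bullet> (V *v e) = y k \<Theta>' \<bullet> (V *v e)"
      by (intro arg_cong2[where f = inner] refl y_light_cone)
    show "\<And>\<Theta> \<Theta>'. (\<And>i. i \<in> (\<Union>j\<in>-nbhd k. past_cone Q j) \<Longrightarrow> \<Theta> i = \<Theta>' i) \<Longrightarrow>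
      \<psi> (\<Sum>j\<in>-nbhd k. transpose V *v y j \<Theta>) = \<psi> (\<Sum>j\<in>-nbhd k. transpose V *v y j \<Theta>')"
      by (rule sum_light_cone) blast
    show "- nbhd k \<inter> nbhd k = {}" by blast
    show "(\<Union>j\<in>-nbhd k. past_cone Q j) \<subseteq> param_indices Q" by (intro UN_least past_cone_subset)
  qed (rule integrable_y_inner integrable_locally_bounded[OF \<psi>] past_cone_subset)+
  then show "init.expectation (\<lambda>\<Theta>. ((transpose V *v y k \<Theta>) \<bullet> e) * \<psi> (\<Sum>j\<in>-nbhd k. transpose V *v y j \<Theta>)) = 0"
    unfolding inner_transpose_mult by (simp only: expectation_y_inner mult_zero_left)
  let ?J = "- (nbhd k \<union> nbhd k')"
  have "init.expectation (\<lambda>\<Theta>. (y k \<Theta> \<bullet> (V *v e)) * (y k' \<Theta> \<bullet> (V *v e')) * \<psi> (\<Sum>j\<in>?J. transpose V *v y j \<Theta>))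
      = init.expectation (\<lambda>\<Theta>. (y k \<Theta> \<bullet> (V *v e)) * (y k' \<Theta> \<bullet> (V *v e'))) * init.expectation (\<lambda>\<Theta>. \<psi> (\<Sum>j\<in>?J. transpose V *v y j \<Theta>))"
  proof (rule expectation_mult_disjoint_cones)
    show "(past_cone Q k \<union> past_cone Q k') \<inter> (\<Union>j\<in>?J. past_cone Q j) = {}"
      using far_cones[of ?J k] far_cones[of ?J k'] by blast
    show "\<And>\<Theta> \<Theta>'. (\<And>i. i \<in> past_cone Q k \<union> past_cone Q k' \<Longrightarrow> \<Theta> i = \<Theta>' i) \<Longrightarrow>
      (y k \<Theta> \<bullet> (V *v e)) * (y k' \<Theta> \<bullet> (V *v e')) = (y k \<Theta>' \<bullet> (V *v e)) * (y k' \<Theta>' \<bullet> (V *v e'))"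
      by (intro arg_cong2[where f = times] arg_cong2[where f = inner] refl y_light_cone; simp)
    show "\<And>\<Theta> \<Theta>'. (\<And>i. i \<in> (\<Union>j\<in>?J. past_cone Q j) \<Longrightarrow> \<Theta> i = \<Theta>' i) \<Longrightarrow>
      \<psi> (\<Sum>j\<in>?J. transpose V *v y j \<Theta>) = \<psi> (\<Sum>j\<in>?J. transpose V *v y j \<Theta>')"
      by (rule sum_light_cone) blast
    show "(\<Union>j\<in>?J. past_cone Q j) \<subseteq> param_indices Q" by (intro UN_least past_cone_subset)
  qed (rule integrable_y_y_inner integrable_locally_bounded[OF \<psi>] past_cone_subset Un_least)+
  then show "init.expectation (\<lambda>\<Theta>. ((transpose V *v y k \<Theta>) \<bullet> e) * ((transpose V *v y k' \<Theta>) \<bullet> e') * \<psi> (\<Sum>j\<in>?J. transpose V *v y j \<Theta>))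
      = init.expectation (\<lambda>\<Theta>. ((transpose V *v y k \<Theta>) \<bullet> e) * ((transpose V *v y k' \<Theta>) \<bullet> e')) * init.expectation (\<lambda>\<Theta>. \<psi> (\<Sum>j\<in>?J. transpose V *v y j \<Theta>))"
    unfolding inner_transpose_mult .
next
  fix e e' :: "real^'n"
  \<comment> \<open>Far pairs are uncorrelated, so the sum over neighbours equals the sum over all
    pairs, which is the whitened covariance.\<close>
  have "(\<Sum>k\<in>UNIV. \<Sum>k'\<in>nbhd k. init.expectation (\<lambda>\<Theta>. (y k \<Theta> \<bullet> (V *v e)) * (y k' \<Theta> \<bullet> (V *v e'))))
      = (\<Sum>k\<in>UNIV. \<Sum>k'\<in>UNIV. init.expectation (\<lambda>\<Theta>. (y k \<Theta> \<bullet> (V *v e)) * (y k' \<Theta> \<bullet> (V *v e'))))"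
    by (intro sum.cong refl sum.mono_neutral_left) (auto simp: expectation_y_y_inner_far)
  also have "\<dots> = init.expectation (\<lambda>\<Theta>. \<Sum>k\<in>UNIV. \<Sum>k'\<in>UNIV. (y k \<Theta> \<bullet> (V *v e)) * (y k' \<Theta> \<bullet> (V *v e')))"
    by (simp add: Bochner_Integration.integral_sum Bochner_Integration.integrable_sum integrable_y_y_inner)
  also have "\<dots> = (V *v e) \<bullet> (K *v (V *v e'))"
    unfolding inner_K f_eq_sum inner_sum_left sum_product ..
  also have "\<dots> = e \<bullet> ((transpose V ** K ** V) *v e')"
    by (metis inner_transpose_mult inner_commute matrix_vector_mul_assoc)
  also have "\<dots> = e \<bullet> e'" by (simp add: VKV)
  finally show "(\<Sum>k\<in>UNIV. \<Sum>k'\<in>nbhd k. init.expectation (\<lambda>\<Theta>. ((transpose V *v y k \<Theta>) \<bullet> e) * ((transpose V *v y k' \<Theta>) \<bullet> e'))) = e \<bullet> e'"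
    unfolding inner_transpose_mult .
next
  show "linear ((*v) S)" by simp
  show "\<And>j k. j \<in> nbhd k \<Longrightarrow> k \<in> nbhd j" by (auto simp: nbhd_def)
  show "\<And>k. card (nbhd k) \<le> D" by (rule card_nbhd)
qed (simp_all only: S_y self_nbhd norm_V_y norm_y V_y_measurable)

lemma X_eq: "stein.X \<Theta> = transpose V *v f \<Theta>"
  unfolding stein.W_def f_eq_sum by (simp add: vec.sum del: transpose_matrix_vector)

lemma integrable_norm_S: "integrable std_gauss (\<lambda>w. norm (S *v w))"
proof (rule std_gauss.square_integrable_imp_integrable)
  show "(\<lambda>w. norm (S *v w)) \<in> borel_measurable std_gauss"
    using measurable_compose[OF matrix_vector_mult_measurable borel_measurable_norm, of S] by simp
qed (rule integrable_norm_S_power2)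

lemma expectation_norm_S: "(\<integral>w. norm (S *v w) \<partial>std_gauss) \<le> sqrt CARD('n)"
proof (rule std_gauss.expectation_le_of_second_moment)
  show "(\<integral>w. (norm (S *v w))\<^sup>2 \<partial>std_gauss) \<le> (sqrt CARD('n))\<^sup>2"
    using trace_K_le by (simp add: second_moment_S)
qed (auto intro: integrable_norm_S integrable_norm_S_power2)

lemma output_law_eq: "output_law Q xs = distr (init_measure Q) borel f"
  by (simp add: output_law_def f_def[abs_def])

text \<open>The test function in whitened coordinates is \<open>h\<close> composed with
  \<open>S\<close>; applied to the whitened sum, \<open>S\<close> returns the network output, and
  applied to a standard Gaussian vector it returns the limit law.\<close>

lemma lipschitz_output_bound:
  fixes h :: "real^'n \<Rightarrow> real"
  assumes h: "\<And>x y. \<bar>h x - h y\<bar> \<le> dist x y"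
  shows "(\<integral>x. h x \<partial>output_law Q xs) - (\<integral>x. h x \<partial>gaussian K)
    \<le> 4 * sqrt CARD('n) / N + 4/3 * ((sqrt CARD('n) / N) * (sqrt \<kappa> * (sqrt CARD('n) / N))\<^sup>2
      * (CARD('q) * (D * (7/2 * D - 2)))) * ln N"
proof -
  have [measurable]: "h \<in> borel_measurable borel" by (rule lipschitz_measurable[where \<Lambda> = 1]) (use h in \<open>simp add: dist_norm\<close>)
  have "(\<integral>x. h x \<partial>output_law Q xs) = init.expectation (\<lambda>\<Theta>. h (S *v stein.X \<Theta>))"
    unfolding output_law_eq X_eq S_y by (rule integral_distr) measurable
  moreover have "(\<integral>x. h x \<partial>gaussian K) = (\<integral>w. h (S *v w) \<partial>std_gauss)"
    unfolding gaussian_eq_distr by (rule integral_distr) simp_all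
  moreover have "\<bar>init.expectation (\<lambda>\<Theta>. h (S *v stein.X \<Theta>)) - (\<integral>w. h (S *v w) \<partial>std_gauss)\<bar>
    \<le> 4 * sqrt CARD('n) / N + 4/3 * ((sqrt CARD('n) / N) * (sqrt \<kappa> * (sqrt CARD('n) / N))\<^sup>2
      * (CARD('q) * (D * (7/2 * D - 2)))) * ln N"
  proof (rule stein.lipschitz_expectation_bound)
    show "\<bar>h (S *v x) - h (S *v y)\<bar> \<le> norm (S *v (x - y))" for x y
      using h[of "S *v x" "S *v y"] by (simp add: dist_norm matrix_vector_mult_diff_distrib)
    show "init.expectation (\<lambda>\<Theta>. norm (S *v stein.X \<Theta>)) \<le> sqrt CARD('n)"
      unfolding X_eq S_y by (rule expectation_norm_f)
  qed (fact N1 expectation_norm_S)+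
  ultimately show ?thesis by linarith
qed

lemma wasserstein_whitened_le:
  "wasserstein (output_law Q xs) (gaussian K)
    \<le> ennreal (4 * sqrt CARD('n) / N + 4/3 * ((sqrt CARD('n) / N) * (sqrt \<kappa> * (sqrt CARD('n) / N))\<^sup>2
      * (CARD('q) * (D * (7/2 * D - 2)))) * ln N)"
proof (rule wasserstein_le_of_lipschitz)
  have S: "(*v) S \<in> borel_measurable std_gauss" using matrix_vector_mult_measurable[of S] by simp
  show "prob_space (output_law Q xs)" unfolding output_law_eq by (rule init.prob_space_distr) simp
  show "prob_space (gaussian K)" unfolding gaussian_eq_distr by (rule std_gauss.prob_space_distr) (rule S)
  show "integrable (output_law Q xs) norm"
    unfolding output_law_eq by (subst integrable_distr_eq) (auto intro: integrable_norm_f)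
  show "integrable (gaussian K) norm"
    unfolding gaussian_eq_distr by (subst integrable_distr_eq[OF S]) (auto intro: integrable_norm_S)
qed (simp_all only: output_law_eq gaussian_def sets_distr sets_density sets_lborel lipschitz_output_bound[unfolded output_law_eq gaussian_def])

end

theorem (in gaussian_limit) wasserstein_output_gaussian:
  "wasserstein (output_law Q xs) (gaussian K)
    \<le> ennreal (real CARD('n) powr (3/2) * (2 * op_norm (matrix_inv K) * sqrt (op_norm K) + 6)
        * (real CARD('q) * (real D powr (7/2)) / N ^ 3) * (1 + ln N))"
proof -
  obtain V :: "real^'n^'n" where "transpose V ** K ** V = mat 1" by (rule exists_whitening[OF K_sym K_pos])
  then interpret whitened_limit Q X xs V
    by (intro whitened_limit.intro gaussian_limit_axioms whitening.intro K_sym)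
  have "D \<ge> 2 \<or> D = 1" using D_pos by linarith
  then have D: "real D \<ge> 2 \<or> real D = 1" by linarith
  have "N\<^sup>2 \<le> real CARD('q) * real D" using normalization_le by (simp only: of_nat_mult)
  from numeric_bound[OF _ _ D N1 this op_norm_inv op_norm_K, of "real CARD('n)" "ln N"]
  show ?thesis
    using N1 by (intro order_trans[OF wasserstein_whitened_le] ennreal_leI) (simp add: Suc_le_eq)
qed

theorem theorem5p1:
  fixes Q :: "('q::finite, real^'d) qnn"
    and X :: "(real^'d) set"
    and xs :: "(real^'d)^'n"
  assumes "wf_qnn X Q"
    and "bij_betw (\<lambda>i. xs $ i) UNIV X"
    and "\<And>k x. x \<in> X \<Longrightarrow> (\<integral>\<Theta>. local_output Q k \<Theta> x \<partial>init_measure Q) = 0"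
    and "\<And>x. x \<in> X \<Longrightarrow> K0 Q x x > 0"
    and "(MAX x\<in>X. K0 Q x x) = 1"
    and "normalization Q \<ge> 1"
    and "invertible (K0_matrix Q xs)"
  shows "wasserstein (output_law Q xs) (gaussian (K0_matrix Q xs))
    \<le> ennreal (
        real (card X) powr (3/2)
        * (2 * op_norm (matrix_inv (K0_matrix Q xs)) * sqrt (op_norm (K0_matrix Q xs)) + 6)
        * (real CARD('q) * real (max_future Q) powr (7/2) * real (max_past Q) powr (7/2)
            / normalization Q ^ 3)
        * (1 + ln (normalization Q)))"
proof -
  interpret gaussian_limit Q X xs
    by (intro gaussian_limit.intro gaussian_limit_axioms.intro network.intro assms)
  have "real D powr (7/2) = real (max_future Q) powr (7/2) * real (max_past Q) powr (7/2)"
    by (simp add: powr_mult mult.commute)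
  then show ?thesis
    using wasserstein_output_gaussian unfolding card_X by (simp only: mult.assoc)
qed

end
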